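(* There exists a polynomial-time active learning algorithm that, given any $\eta\in[0,1/2)$, learns the class $\mathcal{H}_d$ of homogeneous halfspaces over $U_d$ with random classification noise of rate $\eta$ to error $\epsilon$ (with success probability at least $2/3$) using $$O\big((1-2\eta)^{-2}\cdot d^2\log(1/\epsilon)\log(d\log(1/\epsilon))\big)$$ labeled examples and $$O\big((1-2\eta)^{-2}\cdot d^2\cdot\epsilon^{-1}\log(1/\epsilon)\log(d\log(1/\epsilon))\big)$$ unlabeled samples.
   Context: $U_d$ is the uniform distribution over the unit sphere $S_{d-1}\subset\mathbb{R}^d$ and $\mathcal{H}_d$ is the class of functions $h_v(x)=\mathrm{sign}(\langle v,x\rangle)$ for unit vectors $v\in\mathbb{R}^d$. Active learning with random classification noise of rate $\eta$: there is an unknown target $h_w\in\mathcal{H}_d$. The algorithm can draw independent unlabeled points $x\sim U_d$ and, for any drawn point, may request its label, which equals $h_w(x)$ with probability $1-\eta$ and $-h_w(x)$ with probability $\eta$, independently for each example. The number of labeled examples is the number of label requests. Here the noise rate $\eta$ is given to the algorithm. The algorithm learns to error $\epsilon$ if, for every target $h_w$, with the stated probability it outputs $h$ with $\mathbf{Pr}_{x\sim U_d}[h(x)\neq h_w(x)]\le\epsilon$. Polynomial time means polynomial in $d$, $1/\epsilon$ and $1/(1-2\eta)$. Inside $O(\cdot)$, each factor $\log z$ is read as $\max\{1,\log z\}$. *)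

theory Defs
  imports "HOL-Probability.Probability"
begin

section \<open>Homogeneous halfspaces and the uniform distribution on the sphere\<close>

text \<open>
  The dimension is quantified inside the statement (one algorithm serves all dimensions), so a point
  of \<open>\<real>\<^sup>d\<close> is a function \<open>nat \<Rightarrow> real\<close> in \<open>extensional {..<d}\<close>, as in the finite products \<open>\<Pi>\<^sub>M\<close>.
\<close>

type_synonym vec = "nat \<Rightarrow> real"

definition unit_sphere :: "nat \<Rightarrow> vec set" where
  "unit_sphere d = {x \<in> extensional {..<d}. (\<Sum>i<d. (x i)\<^sup>2) = 1}"

definition unit_cball :: "nat \<Rightarrow> vec set" where
  "unit_cball d = {x \<in> extensional {..<d}. (\<Sum>i<d. (x i)\<^sup>2) \<le> 1}"

definition normalize_vec :: "nat \<Rightarrow> vec \<Rightarrow> vec" where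
  "normalize_vec d x = (\<lambda>i\<in>{..<d}. x i / sqrt (\<Sum>j<d. (x j)\<^sup>2))"

text \<open>
  The normalized surface measure as cone measure: the law of \<open>x / \<parallel>x\<parallel>\<close> for \<open>x\<close> uniform in the unit
  ball, that is, a set \<open>A\<close> of directions has probability \<open>vol {t a | 0 < t \<le> 1, a \<in> A} / vol B\<^sub>d\<close>.
  The ambient space is all of \<open>\<real>\<^sup>d\<close>; the mass is on \<^term>\<open>unit_sphere d\<close>.
\<close>

definition uniform_sphere :: "nat \<Rightarrow> vec measure" where
  "uniform_sphere d =
     distr (uniform_measure (Pi\<^sub>M {..<d} (\<lambda>_. lborel)) (unit_cball d)) (Pi\<^sub>M {..<d} (\<lambda>_. lborel))
       (normalize_vec d)"

text \<open>Unlike \<^const>\<open>sgn\<close>, the sign is two-valued; the tie \<open>\<langle>v,x\<rangle> = 0\<close> goes to \<open>1\<close>.\<close>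

definition sign_pm :: "real \<Rightarrow> real" where
  "sign_pm z = (if z \<ge> 0 then 1 else -1)"

definition halfspace :: "nat \<Rightarrow> vec \<Rightarrow> vec \<Rightarrow> real" where
  "halfspace d v x = sign_pm (\<Sum>i<d. v i * x i)"

definition log1 :: "real \<Rightarrow> real" where
  "log1 z = max 1 (ln z)"


section \<open>Real-RAM programs with access to examples\<close>

text \<open>
  Algorithms are programs of a unit-cost real RAM with natural-number registers (for counting and
  addressing) and arrays of reals.  A program is a finite object independent of the dimension and of
  the other parameters.  There are no real constants (one could encode an infinite table of advice), no
  rounding and no multiplication on \<open>nat\<close> (one could simulate exponentially long bit strings at unit
  cost).  A program contains finitely many expressions, so charging one step per command and per
  evaluated test changes the running time by at most a constant factor of the program.
\<close>

datatype nexp = NConst nat | NReg nat | NPlus nexp nexp | NMinus nexp nexp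

datatype rexp =
    Cell nat nexp
  | OfNat nexp
  | RPlus rexp rexp | RMinus rexp rexp | RTimes rexp rexp | RDivide rexp rexp

datatype bexp = NLess nexp nexp | RLess rexp rexp | BNot bexp | BAnd bexp bexp

text \<open>
  \<open>Draw a\<close> puts a fresh unlabeled point into array \<open>a\<close>; \<open>Request e a i\<close> requests the label of the
  drawn point number \<open>e\<close> (counted from \<open>0\<close>) and puts it into cell \<open>i\<close> of array \<open>a\<close>; \<open>Flip r\<close> puts a
  fair random bit into register \<open>r\<close>.
\<close>

datatype com =
    Skip
  | NSet nat nexp
  | RSet nat nexp rexp
  | Draw nat
  | Request nexp nat nexp
  | Flip nat
  | Seq com com
  | Cond bexp com com
  | Loop bexp com

record state =
  reg :: "nat \<Rightarrow> nat"
  arr :: "nat \<Rightarrow> nat \<Rightarrow> real"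
  drawn :: nat
  requested :: nat
  flipped :: nat
  steps :: nat

record environment =
  dimension :: nat
  point :: "nat \<Rightarrow> vec"
  label :: "nat \<Rightarrow> real"
  coin :: "nat \<Rightarrow> bool"

primrec nval :: "nexp \<Rightarrow> state \<Rightarrow> nat" where
  "nval (NConst n) s = n"
| "nval (NReg r) s = reg s r"
| "nval (NPlus e f) s = nval e s + nval f s"
| "nval (NMinus e f) s = nval e s - nval f s"

primrec rval :: "rexp \<Rightarrow> state \<Rightarrow> real" where
  "rval (Cell a e) s = arr s a (nval e s)"
| "rval (OfNat e) s = real (nval e s)"
| "rval (RPlus e f) s = rval e s + rval f s"
| "rval (RMinus e f) s = rval e s - rval f s"
| "rval (RTimes e f) s = rval e s * rval f s"
| "rval (RDivide e f) s = rval e s / rval f s"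

primrec bval :: "bexp \<Rightarrow> state \<Rightarrow> bool" where
  "bval (NLess e f) s = (nval e s < nval f s)"
| "bval (RLess e f) s = (rval e s < rval f s)"
| "bval (BNot b) s = (\<not> bval b s)"
| "bval (BAnd b c) s = (bval b s \<and> bval c s)"

definition tick :: "nat \<Rightarrow> state \<Rightarrow> state" where
  "tick n s = s\<lparr>steps := steps s + n\<rparr>"

definition set_reg :: "nat \<Rightarrow> nat \<Rightarrow> state \<Rightarrow> state" where
  "set_reg r n s = s\<lparr>reg := (reg s)(r := n)\<rparr>"

definition set_cell :: "nat \<Rightarrow> nat \<Rightarrow> real \<Rightarrow> state \<Rightarrow> state" where
  "set_cell a i z s = s\<lparr>arr := (arr s)(a := (arr s a)(i := z))\<rparr>"

definition set_vec :: "nat \<Rightarrow> nat \<Rightarrow> vec \<Rightarrow> state \<Rightarrow> state" where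
  "set_vec d a x s = s\<lparr>arr := (arr s)(a := (\<lambda>i. if i < d then x i else 0))\<rparr>"

text \<open>
  Drawing a point costs \<open>dimension + 1\<close> steps as it writes \<open>dimension\<close> cells.  Requesting again the label of the
  same point returns the same label but is counted again; a request for a point that has not been
  drawn is counted and returns \<open>0\<close>.
\<close>

inductive exec :: "environment \<Rightarrow> com \<Rightarrow> state \<Rightarrow> state \<Rightarrow> bool" for E :: environment where
  exec_Skip: "exec E Skip s (tick 1 s)"
| exec_NSet: "exec E (NSet r e) s (tick 1 (set_reg r (nval e s) s))"
| exec_RSet: "exec E (RSet a i e) s (tick 1 (set_cell a (nval i s) (rval e s) s))"
| exec_Draw: "exec E (Draw a) s
    (tick (dimension E + 1) ((set_vec (dimension E) a (point E (drawn s)) s)\<lparr>drawn := drawn s + 1\<rparr>))"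
| exec_Request: "exec E (Request e a i) s
    (tick 1 ((set_cell a (nval i s) (if nval e s < drawn s then label E (nval e s) else 0) s)
               \<lparr>requested := requested s + 1\<rparr>))"
| exec_Flip: "exec E (Flip r) s
    (tick 1 ((set_reg r (if coin E (flipped s) then 1 else 0) s)\<lparr>flipped := flipped s + 1\<rparr>))"
| exec_Seq: "exec E c s t \<Longrightarrow> exec E c' t u \<Longrightarrow> exec E (Seq c c') s u"
| exec_CondT: "bval b s \<Longrightarrow> exec E c (tick 1 s) t \<Longrightarrow> exec E (Cond b c c') s t"
| exec_CondF: "\<not> bval b s \<Longrightarrow> exec E c' (tick 1 s) t \<Longrightarrow> exec E (Cond b c c') s t"
| exec_LoopF: "\<not> bval b s \<Longrightarrow> exec E (Loop b c) s (tick 1 s)"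
| exec_LoopT: "bval b s \<Longrightarrow> exec E c (tick 1 s) t \<Longrightarrow> exec E (Loop b c) t u \<Longrightarrow> exec E (Loop b c) s u"

inductive_cases exec_elims:
  "exec E Skip s t" "exec E (NSet r e) s t" "exec E (RSet a i e) s t" "exec E (Draw a) s t"
  "exec E (Request e a i) s t" "exec E (Flip r) s t" "exec E (Seq c c') s t"
  "exec E (Cond b c c') s t" "exec E (Loop b c) s t"

lemma exec_deterministic: "exec E c s t \<Longrightarrow> exec E c s u \<Longrightarrow> u = t"
proof (induction arbitrary: u rule: exec.induct)
  case (exec_Seq c s t c' v)
  obtain t' where "exec E c s t'" "exec E c' t' u"
    using exec_Seq.prems by (rule exec_elims(7))
  then show ?case
    using exec_Seq.IH by simp
next
  case (exec_CondT b s c t c')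
  then have "exec E c (tick 1 s) u"
    by (auto elim: exec_elims(8))
  then show ?case
    by (rule exec_CondT.IH)
next
  case (exec_CondF b s c' t c)
  then have "exec E c' (tick 1 s) u"
    by (auto elim: exec_elims(8))
  then show ?case
    by (rule exec_CondF.IH)
next
  case (exec_LoopT b s c t v)
  obtain t' where "exec E c (tick 1 s) t'" "exec E (Loop b c) t' u"
    using exec_LoopT.prems exec_LoopT.hyps(1) by (auto elim: exec_elims(9))
  then show ?case
    using exec_LoopT.IH by simp
qed (erule exec_elims; simp)+

text \<open>The learner is started with \<open>d\<close> in register \<open>0\<close> and \<open>\<eta>\<close>, \<open>\<epsilon>\<close> in the first cells of array \<open>0\<close>.\<close>

definition initial_state :: "nat \<Rightarrow> real \<Rightarrow> real \<Rightarrow> state" where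
  "initial_state d \<eta> \<epsilon> =
     \<lparr>reg = (\<lambda>_. 0)(0 := d),
      arr = (\<lambda>_ _. 0)(0 := (\<lambda>_. 0)(0 := \<eta>, 1 := \<epsilon>)),
      drawn = 0, requested = 0, flipped = 0, steps = 0\<rparr>"

text \<open>
  A hypothesis need not be a halfspace: the learner outputs its final memory \<open>s\<close>, and \<open>h\<close> is what a
  fixed evaluation program computes from it, given the point \<open>x\<close> in array \<open>0\<close>, as the sign of cell
  \<open>0\<close> of that array.  The evaluation runs in the dummy environment, where it has access neither to
  examples nor to random bits.
\<close>

definition no_examples :: "nat \<Rightarrow> environment" where
  "no_examples d = \<lparr>dimension = d, point = (\<lambda>_ _. 0), label = (\<lambda>_. 0), coin = (\<lambda>_. False)\<rparr>"

definition represents :: "com \<Rightarrow> nat \<Rightarrow> real \<Rightarrow> state \<Rightarrow> (vec \<Rightarrow> real) \<Rightarrow> bool" where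
  "represents evaluator d T s h \<longleftrightarrow>
     (\<forall>x\<in>unit_sphere d. \<exists>t. exec (no_examples d) evaluator ((set_vec d 0 x s)\<lparr>steps := 0\<rparr>) t \<and>
        real (steps t) \<le> T \<and> h x = sign_pm (arr t 0 0))"


section \<open>Random classification noise\<close>

text \<open>
  An outcome lists, for every \<open>n\<close>, the \<open>n\<close>-th point, whether noise flips its label, and the \<open>n\<close>-th
  random bit of the learner; all of them are independent.
\<close>

type_synonym outcome = "nat \<Rightarrow> vec \<times> bool \<times> bool"

definition rcn_space :: "nat \<Rightarrow> real \<Rightarrow> outcome measure" where
  "rcn_space d \<eta> =
     (\<Pi>\<^sub>M n\<in>UNIV. uniform_sphere d \<Otimes>\<^sub>M
        (measure_pmf (bernoulli_pmf \<eta>) \<Otimes>\<^sub>M measure_pmf (bernoulli_pmf (1/2))))"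

definition rcn_environment :: "nat \<Rightarrow> vec \<Rightarrow> outcome \<Rightarrow> environment" where
  "rcn_environment d w \<omega> =
     \<lparr>dimension = d,
      point = (\<lambda>n. fst (\<omega> n)),
      label = (\<lambda>n. if fst (snd (\<omega> n)) then - halfspace d w (fst (\<omega> n)) else halfspace d w (fst (\<omega> n))),
      coin = (\<lambda>n. snd (snd (\<omega> n)))\<rparr>"

text \<open>
  Measurability of the disagreement set is demanded explicitly because \<^const>\<open>measure\<close> is \<open>0\<close> on
  non-measurable sets.
\<close>

definition has_error_at_most :: "nat \<Rightarrow> vec \<Rightarrow> real \<Rightarrow> (vec \<Rightarrow> real) \<Rightarrow> bool" where
  "has_error_at_most d w \<epsilon> h \<longleftrightarrow>
     {x \<in> unit_sphere d. h x \<noteq> halfspace d w x} \<in> sets (uniform_sphere d) \<and>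
     measure (uniform_sphere d) {x \<in> unit_sphere d. h x \<noteq> halfspace d w x} \<le> \<epsilon>"

text \<open>
  The resource bounds, including the one for evaluating the hypothesis, hold on every outcome whose
  points lie on the sphere (a set of outcomes of probability \<open>1\<close>).
\<close>

definition runs_within ::
  "com \<Rightarrow> com \<Rightarrow> nat \<Rightarrow> real \<Rightarrow> real \<Rightarrow> vec \<Rightarrow> real \<Rightarrow> real \<Rightarrow> real \<Rightarrow> bool" where
  "runs_within learner evaluator d \<eta> \<epsilon> w time labeled unlabeled \<longleftrightarrow>
     (\<forall>\<omega>. (\<forall>n. fst (\<omega> n) \<in> unit_sphere d) \<longrightarrow>
        (\<exists>s h. exec (rcn_environment d w \<omega>) learner (initial_state d \<eta> \<epsilon>) s \<and>
           real (steps s) \<le> time \<and>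
           real (requested s) \<le> labeled \<and>
           real (drawn s) \<le> unlabeled \<and>
           represents evaluator d time s h))"

definition learns_with_probability ::
  "com \<Rightarrow> com \<Rightarrow> nat \<Rightarrow> real \<Rightarrow> real \<Rightarrow> vec \<Rightarrow> real \<Rightarrow> real \<Rightarrow> bool" where
  "learns_with_probability learner evaluator d \<eta> \<epsilon> w time p \<longleftrightarrow>
     (\<exists>A\<in>sets (rcn_space d \<eta>). measure (rcn_space d \<eta>) A \<ge> p \<and>
        (\<forall>\<omega>\<in>A. \<exists>s h. exec (rcn_environment d w \<omega>) learner (initial_state d \<eta> \<epsilon>) s \<and>
           represents evaluator d time s h \<and> has_error_at_most d w \<epsilon> h))"


section \<open>Checks on the distribution\<close>

lemma space_PiM_lborel: "space (Pi\<^sub>M {..<d} (\<lambda>_. lborel :: real measure)) = extensional {..<d}"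
  by (auto simp: space_PiM PiE_def)

lemma unit_cball_sets: "unit_cball d \<in> sets (Pi\<^sub>M {..<d} (\<lambda>_. lborel :: real measure))"
proof -
  have "unit_cball d = {x \<in> space (Pi\<^sub>M {..<d} (\<lambda>_. lborel)). (\<Sum>i<d. (x i)\<^sup>2) \<le> (1::real)}"
    by (simp add: unit_cball_def space_PiM_lborel)
  also have "\<dots> \<in> sets (Pi\<^sub>M {..<d} (\<lambda>_. lborel :: real measure))"
    by measurable
  finally show ?thesis .
qed

lemma emeasure_unit_cball:
  "emeasure (Pi\<^sub>M {..<d} (\<lambda>_. lborel)) (unit_cball d) = ennreal (unit_ball_vol (real d))"
proof -
  have "unit_cball d =
      {f. sqrt (\<Sum>i\<in>{..<d}. (f i)\<^sup>2) \<le> 1} \<inter> space (Pi\<^sub>M {..<d} (\<lambda>_. lborel))"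
    by (auto simp: unit_cball_def space_PiM_lborel)
  then show ?thesis
    using emeasure_cball_aux[of "{..<d}" 1] by simp
qed

lemma normalize_vec_measurable:
  "normalize_vec d \<in> (Pi\<^sub>M {..<d} (\<lambda>_. lborel)) \<rightarrow>\<^sub>M (Pi\<^sub>M {..<d} (\<lambda>_. lborel :: real measure))"
  unfolding normalize_vec_def by (rule measurable_restrict) measurable

lemma prob_space_uniform_sphere: "prob_space (uniform_sphere d)"
  unfolding uniform_sphere_def
proof (rule prob_space.prob_space_distr)
  show "prob_space (uniform_measure (Pi\<^sub>M {..<d} (\<lambda>_. lborel)) (unit_cball d))"
    by (rule prob_space_uniform_measure)
      (simp_all add: emeasure_unit_cball less_imp_neq[OF unit_ball_vol_pos, symmetric])
  show "normalize_vec d \<in> uniform_measure (Pi\<^sub>M {..<d} (\<lambda>_. lborel)) (unit_cball d) \<rightarrow>\<^sub>M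
      (Pi\<^sub>M {..<d} (\<lambda>_. lborel))"
    using normalize_vec_measurable by (simp add: measurable_def)
qed

lemma normalize_vec_in_unit_sphere:
  assumes "i < d" "x i \<noteq> 0"
  shows "normalize_vec d x \<in> unit_sphere d"
proof -
  let ?q = "\<Sum>j<d. (x j)\<^sup>2"
  have "?q > 0"
    using assms by (intro sum_pos2[of _ i]) auto
  then have "(\<Sum>i<d. (x i / sqrt ?q)\<^sup>2) = 1"
    by (simp add: power_divide flip: sum_divide_distrib)
  then show ?thesis
    by (simp add: unit_sphere_def normalize_vec_def)
qed

lemma unit_sphere_sets: "unit_sphere d \<in> sets (uniform_sphere d)"
proof -
  have "unit_sphere d = {x \<in> space (Pi\<^sub>M {..<d} (\<lambda>_. lborel)). (\<Sum>i<d. (x i)\<^sup>2) = (1::real)}"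
    by (simp add: unit_sphere_def space_PiM_lborel)
  also have "\<dots> \<in> sets (Pi\<^sub>M {..<d} (\<lambda>_. lborel :: real measure))"
    by measurable
  finally show ?thesis
    by (simp add: uniform_sphere_def)
qed

lemma measure_uniform_sphere_unit_sphere:
  assumes "d \<ge> 1"
  shows "measure (uniform_sphere d) (unit_sphere d) = 1"
proof -
  interpret product_sigma_finite "\<lambda>_::nat. lborel :: real measure"
    by standard
  interpret prob_space "uniform_sphere d"
    by (rule prob_space_uniform_sphere)
  let ?P = "Pi\<^sub>M {..<d} (\<lambda>_. lborel :: real measure)"
  let ?Z = "PiE {..<d} (\<lambda>i. if i = 0 then {0} else UNIV) :: vec set"
  have "emeasure ?P ?Z = (\<Prod>i\<in>{..<d}. emeasure lborel (if i = 0 then {0::real} else UNIV))"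
    by (rule emeasure_PiM) auto
  also have "\<dots> = 0"
    using assms by (intro prod_zero) (auto intro!: bexI[of _ 0])
  finally have "?Z \<in> null_sets ?P"
    by (auto simp: null_sets_def intro!: sets_PiM_I_finite)
  then have "AE x in ?P. x \<notin> ?Z"
    by (rule AE_not_in)
  moreover have "AE x in ?P. x \<in> space ?P"
    by (rule AE_space)
  ultimately have "AE x in ?P. normalize_vec d x \<in> unit_sphere d"
  proof eventually_elim
    case (elim x)
    then have "x 0 \<noteq> 0"
      by (auto simp: space_PiM_lborel PiE_def split: if_splits)
    then show ?case
      using assms by (intro normalize_vec_in_unit_sphere[of 0]) auto
  qed
  then have "AE x in uniform_measure ?P (unit_cball d). normalize_vec d x \<in> unit_sphere d"
    by (intro AE_uniform_measureI unit_cball_sets) auto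
  then have "AE x in uniform_sphere d. x \<in> unit_sphere d"
    unfolding uniform_sphere_def
    by (subst AE_distr_iff)
      (use normalize_vec_measurable unit_sphere_sets in
        \<open>auto simp: uniform_sphere_def measurable_def space_PiM_lborel unit_sphere_def\<close>)
  then show ?thesis
    using unit_sphere_sets by (intro prob_eq_1[THEN iffD2])
qed

end

theory Submission
  imports Defs
begin

text \<open>
  The learner keeps an approximation \<open>v\<close> of the normal vector \<open>w\<close> and a bound \<open>\<sigma>\<close> on the sine of the angle
  between them. In a phase it draws about \<open>M / \<sigma>\<close> points, requests the labels of those with
  \<open>|\<langle>v, x\<rangle>| \<le> b |v|\<close> for \<open>b\<close> of order \<open>\<sigma> / \<surd>d\<close>, and averages \<open>y x\<close>, set to \<open>0\<close> for
  the other points. Up to noise and the factor \<open>1 - 2 \<eta>\<close>, the part of the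
  mean orthogonal to \<open>v\<close> is a positive multiple \<open>A u\<close> of the direction \<open>u\<close> in which \<open>v\<close> has to be turned, with
  \<open>A\<close> at most \<open>2 b / \<pi>\<close>, and at least \<open>b / \<pi>\<close> if the sine of the angle exceeds \<open>\<sigma> / 2\<close>. So a step of length of
  order \<open>\<sigma>\<close> never overshoots and decreases the bound to \<open>15 \<sigma> / 16\<close>; after \<open>O(log (1/\<epsilon>))\<close> phases it is
  below \<open>\<epsilon>\<close>.

  The band has probability \<open>O(\<sigma>)\<close>, so a phase requests \<open>O(M)\<close> labels. An error of order \<open>(1 - 2 \<eta>) \<sigma> / d\<close>
  in each coordinate of the mean is harmless, and by a Chernoff bound with variance \<open>O(\<sigma>)\<close> this is reached in all
  coordinates and phases for \<open>M\<close> of order \<open>(1 - 2 \<eta>)\<^sup>-\<^sup>2 d\<^sup>2 log (d log (1/\<epsilon>))\<close>. Every phase draws a number of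
  points fixed in advance, so its points are independent of the direction it starts from.

  All expectations come from the invariance of the uniform distribution under reflections: averaging
  over the reflections in a plane reduces them to integrals over a half circle.
\<close>

section \<open>Reflections\<close>

text \<open>The resource bounds must hold on every outcome, not just with high probability. Hence a
  phase stops requesting labels after \<open>2 * M\<close> of them, and the event that this cap
  suppresses a label is charged to the failure probability.

  The machine has no square roots, logarithms or ceilings. An integer \<open>r\<close> found by
  counting up replaces the square root of \<open>d\<close>, the band test is squared, norms are kept
  near 1 by a rational iteration, and an exponent \<open>n\<close> with \<open>2 ^ n\<close> at
  least \<open>d\<close> times the number of phases replaces the logarithm. The loop over the draws
  compares real numbers and so performs the rounding itself.

  The fourth power of \<open>r\<close> in the budget comes from the accuracy: to reach an error t of
  order rho sigma / r^2 with variables of second moment of order sigma takes about sigma L / t^2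
  draws, that is r^4 L / (rho^2 sigma). Multiplied by the band probability, of order sigma, this
  leaves a number of labels per phase that no longer depends on sigma.\<close>

definition ip :: "nat \<Rightarrow> vec \<Rightarrow> vec \<Rightarrow> real" where
  "ip d x y = (\<Sum>i<d. x i * y i)"

definition reflect :: "nat \<Rightarrow> vec \<Rightarrow> vec \<Rightarrow> vec" where
  "reflect d q z = (\<lambda>i\<in>{..<d}. z i - 2 * ip d q z * q i)"

abbreviation coords :: "nat \<Rightarrow> vec measure" where
  "coords d \<equiv> Pi\<^sub>M {..<d} (\<lambda>_. lborel)"

lemma ip_commute: "ip d x y = ip d y x"
  by (simp add: ip_def mult.commute)

lemma ip_add_right: "ip d x (\<lambda>i. y i + z i) = ip d x y + ip d x z"
  by (simp add: ip_def algebra_simps sum.distrib)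

lemma ip_diff_right: "ip d x (\<lambda>i. y i - z i) = ip d x y - ip d x z"
  by (simp add: ip_def algebra_simps sum_subtractf)

lemma ip_scale_right: "ip d x (\<lambda>i. c * y i) = c * ip d x y"
  by (simp add: ip_def sum_distrib_left algebra_simps)

lemma ip_divide_right: "ip d x (\<lambda>i. y i / c) = ip d x y / c"
  by (simp add: ip_def sum_divide_distrib)

lemma ip_add_left: "ip d (\<lambda>i. y i + z i) x = ip d y x + ip d z x"
  by (simp add: ip_def algebra_simps sum.distrib)

lemma ip_diff_left: "ip d (\<lambda>i. y i - z i) x = ip d y x - ip d z x"
  by (simp add: ip_def algebra_simps sum_subtractf)

lemma ip_scale_left: "ip d (\<lambda>i. c * y i) x = c * ip d y x"
  by (simp add: ip_def sum_distrib_left algebra_simps)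

lemma ip_divide_left: "ip d (\<lambda>i. y i / c) x = ip d y x / c"
  by (simp add: ip_def sum_divide_distrib)

lemmas ip_linear = ip_add_right ip_diff_right ip_scale_right ip_divide_right
  ip_add_left ip_diff_left ip_scale_left ip_divide_left

lemma ip_cong: "(\<And>i. i < d \<Longrightarrow> x i = x' i) \<Longrightarrow> (\<And>i. i < d \<Longrightarrow> y i = y' i) \<Longrightarrow> ip d x y = ip d x' y'"
  by (simp add: ip_def)

lemma ip_self_nonneg: "0 \<le> ip d x x"
  by (auto simp: ip_def intro: sum_nonneg)

lemma ip_self_eq_0: "ip d x x = 0 \<Longrightarrow> i < d \<Longrightarrow> x i = 0"
  by (simp add: ip_def sum_nonneg_eq_0_iff)

lemma ip_self_eq_0_left: "ip d x x = 0 \<Longrightarrow> ip d x y = 0"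
  using ip_self_eq_0[of d x] by (simp add: ip_def)

lemma ip_self_conv: "(\<Sum>i<d. (x i)\<^sup>2) = ip d x x"
  by (simp add: ip_def power2_eq_square)

lemma ip_Cauchy_Schwarz: "(ip d x y)\<^sup>2 \<le> ip d x x * ip d y y"
  unfolding ip_def using Cauchy_Schwarz_ineq_sum[of x y "{..<d}"] by (simp add: power2_eq_square)

lemma ip_reflect: "ip d x (reflect d q z) = ip d x z - 2 * ip d q z * ip d x q"
proof -
  have "ip d x (reflect d q z) = ip d x (\<lambda>i. z i - 2 * ip d q z * q i)"
    by (rule ip_cong) (auto simp: reflect_def)
  then show ?thesis
    by (simp add: ip_linear)
qed

lemma ip_self_reflect: "ip d q q = 1 \<Longrightarrow> ip d (reflect d q z) (reflect d q z) = ip d z z"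
  by (simp add: ip_reflect ip_commute[of d "reflect d q z"] ip_commute[of d z q] algebra_simps)

section \<open>Invariance of Lebesgue measure under reflections\<close>

lemma ip_measurable [measurable]:
  "(\<lambda>z. ip d x z) \<in> borel_measurable (coords d)"
  unfolding ip_def by measurable

lemma reflect_measurable [measurable]: "reflect d q \<in> coords d \<rightarrow>\<^sub>M coords d"
  unfolding reflect_def by (rule measurable_restrict) measurable

lemma update_measurable_coords:
  assumes "h \<in> borel_measurable (coords d)" and "i0 < d"
  shows "(\<lambda>x. x(i0 := h x)) \<in> coords d \<rightarrow>\<^sub>M coords d"
proof -
  have "(\<lambda>x. (\<lambda>i\<in>{..<d}. if i = i0 then h x else x i)) \<in> coords d \<rightarrow>\<^sub>M coords d"
    using assms by (intro measurable_restrict) auto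
  moreover have "(\<lambda>i\<in>{..<d}. if i = i0 then h x else x i) = x(i0 := h x)" if "x \<in> space (coords d)" for x
    using that assms(2) by (auto simp: space_PiM_lborel extensional_def)
  ultimately show ?thesis
    by (subst measurable_cong[of _ _ "\<lambda>x. (\<lambda>i\<in>{..<d}. if i = i0 then h x else x i)"]) auto
qed

text \<open>Fubini isolates the coordinate \<open>i0\<close>. For fixed other coordinates the shift
  \<open>g x\<close> is a constant, since \<open>g\<close> ignores \<open>i0\<close>, and the
  one-dimensional affine substitution supplies the factor |a|.\<close>

lemma nn_integral_coords_affine:
  fixes F :: "vec \<Rightarrow> ennreal"
  assumes i0: "i0 < d" and a: "a \<noteq> 0"
    and [measurable]: "g \<in> borel_measurable (coords d)" "F \<in> borel_measurable (coords d)"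
    and g: "\<And>x t. g (x(i0 := t)) = g x"
  shows "ennreal \<bar>a\<bar> * (\<integral>\<^sup>+x. F (x(i0 := a * x i0 + g x)) \<partial>coords d) = (\<integral>\<^sup>+x. F x \<partial>coords d)"
proof -
  interpret product_sigma_finite "\<lambda>_::nat. lborel :: real measure"
    by standard
  let ?J = "{..<d} - {i0}"
  have ins: "insert i0 ?J = {..<d}"
    using i0 by auto
  have up: "(\<lambda>x. x(i0 := a * x i0 + g x)) \<in> coords d \<rightarrow>\<^sub>M coords d"
    using i0 by (intro update_measurable_coords) measurable
  have m: "(\<lambda>x. F (x(i0 := a * x i0 + g x))) \<in> borel_measurable (coords d)"
    using measurable_compose[OF up assms(4)] .
  have "(\<integral>\<^sup>+x. F x \<partial>coords d) = (\<integral>\<^sup>+x. (\<integral>\<^sup>+t. F (x(i0 := t)) \<partial>lborel) \<partial>Pi\<^sub>M ?J (\<lambda>_. lborel))"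
    using product_nn_integral_insert[of ?J i0 F] unfolding ins by simp
  also have "\<dots> = (\<integral>\<^sup>+x. ennreal \<bar>a\<bar> * (\<integral>\<^sup>+t. F (x(i0 := g x + a * t)) \<partial>lborel) \<partial>Pi\<^sub>M ?J (\<lambda>_. lborel))"
  proof (rule nn_integral_cong)
    fix x assume x: "x \<in> space (Pi\<^sub>M ?J (\<lambda>_. lborel :: real measure))"
    have "(\<lambda>t. x(i0 := t)) \<in> lborel \<rightarrow>\<^sub>M Pi\<^sub>M (insert i0 ?J) (\<lambda>_. lborel)"
      using x by (intro measurable_fun_upd[where J="?J"]) auto
    then have "(\<lambda>t. F (x(i0 := t))) \<in> borel_measurable borel"
      unfolding ins using measurable_compose[OF _ assms(4)] by simp
    from nn_integral_real_affine[OF this a, of "g x"]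
    show "(\<integral>\<^sup>+t. F (x(i0 := t)) \<partial>lborel) = ennreal \<bar>a\<bar> * (\<integral>\<^sup>+t. F (x(i0 := g x + a * t)) \<partial>lborel)" .
  qed
  also have "\<dots> = ennreal \<bar>a\<bar> * (\<integral>\<^sup>+x. (\<integral>\<^sup>+t. F (x(i0 := g x + a * t)) \<partial>lborel) \<partial>Pi\<^sub>M ?J (\<lambda>_. lborel))"
  proof (rule nn_integral_cmult)
    have "(\<lambda>p. F (((fst p)(i0 := snd p))(i0 := a * ((fst p)(i0 := snd p)) i0 + g ((fst p)(i0 := snd p)))))
      \<in> borel_measurable (Pi\<^sub>M ?J (\<lambda>_. lborel) \<Otimes>\<^sub>M lborel)"
    proof (rule measurable_compose[OF _ m, of "\<lambda>p. (fst p)(i0 := snd p)"])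
      show "(\<lambda>p. (fst p)(i0 := snd p)) \<in> Pi\<^sub>M ?J (\<lambda>_. lborel) \<Otimes>\<^sub>M lborel \<rightarrow>\<^sub>M coords d"
        using i0 by (intro measurable_fun_upd[where J="?J"]) auto
    qed
    then have "(\<lambda>p. F ((fst p)(i0 := g (fst p) + a * snd p))) \<in> borel_measurable (Pi\<^sub>M ?J (\<lambda>_. lborel) \<Otimes>\<^sub>M lborel)"
      by (simp add: g add.commute)
    then have "case_prod (\<lambda>x t. F (x(i0 := g x + a * t))) \<in> borel_measurable (Pi\<^sub>M ?J (\<lambda>_. lborel) \<Otimes>\<^sub>M lborel)"
      by (simp add: case_prod_beta')
    then show "(\<lambda>x. \<integral>\<^sup>+t. F (x(i0 := g x + a * t)) \<partial>lborel) \<in> borel_measurable (Pi\<^sub>M ?J (\<lambda>_. lborel))"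
      by (rule lborel.borel_measurable_nn_integral)
  qed
  also have "(\<integral>\<^sup>+x. (\<integral>\<^sup>+t. F (x(i0 := g x + a * t)) \<partial>lborel) \<partial>Pi\<^sub>M ?J (\<lambda>_. lborel)) =
      (\<integral>\<^sup>+x. F (x(i0 := a * x i0 + g x)) \<partial>coords d)"
    using product_nn_integral_insert[of ?J i0 "\<lambda>x. F (x(i0 := a * x i0 + g x))"] m
    unfolding ins by (simp add: g add.commute)
  finally show ?thesis ..
qed

text \<open>Each shear is an instance of \<open>nn_integral_coords_affine\<close> with slope 1. As
  \<open>i0\<close> is outside \<open>J\<close>, the multiplier \<open>x i0\<close> survives all of
  them, so they can be applied one at a time.\<close>

lemma nn_integral_coords_shears:
  fixes F :: "vec \<Rightarrow> ennreal"
  assumes F: "F \<in> borel_measurable (coords d)" and "finite J" and "J \<subseteq> {..<d}" and "i0 < d" "i0 \<notin> J"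
  shows "(\<integral>\<^sup>+x. F (\<lambda>i. if i \<in> J then x i + x i0 * c i else x i) \<partial>coords d) = (\<integral>\<^sup>+x. F x \<partial>coords d)"
  using assms(2,1,3,5)
proof (induction J arbitrary: F)
  case empty
  then show ?case by simp
next
  case (insert j J)
  let ?G = "\<lambda>x. F (x(j := x j + x i0 * c j))"
  have j: "j < d" "j \<noteq> i0"
    using insert by auto
  have "(\<lambda>x. x(j := x j + x i0 * c j)) \<in> coords d \<rightarrow>\<^sub>M coords d"
    using j assms(4) by (intro update_measurable_coords) measurable
  then have G: "?G \<in> borel_measurable (coords d)"
    using insert.prems(1) by (rule measurable_compose)
  have eq: "(\<lambda>i. if i \<in> insert j J then x i + x i0 * c i else x i) =
      (\<lambda>i. if i \<in> J then x i + x i0 * c i else x i)(j := (\<lambda>i. if i \<in> J then x i + x i0 * c i else x i) j +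
        (\<lambda>i. if i \<in> J then x i + x i0 * c i else x i) i0 * c j)" for x :: vec
    using insert by (auto simp: fun_eq_iff)
  have "(\<integral>\<^sup>+x. F (\<lambda>i. if i \<in> insert j J then x i + x i0 * c i else x i) \<partial>coords d) =
      (\<integral>\<^sup>+x. ?G (\<lambda>i. if i \<in> J then x i + x i0 * c i else x i) \<partial>coords d)"
    by (simp only: eq)
  also have "\<dots> = (\<integral>\<^sup>+x. ?G x \<partial>coords d)"
    using insert.prems(2,3) by (intro insert.IH[OF G]) auto
  also have "\<dots> = ennreal \<bar>1\<bar> * (\<integral>\<^sup>+x. F (x(j := 1 * x j + x i0 * c j)) \<partial>coords d)"
    by simp
  also have "\<dots> = (\<integral>\<^sup>+x. F x \<partial>coords d)"
    using j assms(4) insert.prems(1) by (intro nn_integral_coords_affine) (auto intro!: borel_measurable_times)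
  finally show ?case .
qed

text \<open>
  For \<^term>\<open>q i0 \<noteq> 0\<close>, taking \<^term>\<open>ip d q z\<close> as the new coordinate \<^term>\<open>i0\<close> turns the reflection into
  a composition of maps that change a single coordinate; the two scalings cancel.
\<close>

lemma nn_integral_coords_reflect:
  fixes F :: "vec \<Rightarrow> ennreal"
  assumes q: "ip d q q = 1" and F: "F \<in> borel_measurable (coords d)"
  shows "(\<integral>\<^sup>+z. F (reflect d q z) \<partial>coords d) = (\<integral>\<^sup>+z. F z \<partial>coords d)"
proof -
  obtain i0 where i0: "i0 < d" "q i0 \<noteq> 0"
  proof -
    have "\<exists>i<d. q i \<noteq> 0"
    proof (rule ccontr)
      assume "\<not> ?thesis"
      then have "ip d q q = 0"
        by (simp add: ip_def)
      with q show False by simp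
    qed
    then show ?thesis using that by blast
  qed
  let ?J = "{..<d} - {i0}"
  let ?r = "\<lambda>x::vec. \<Sum>j\<in>?J. q j * x j"
  \<comment> \<open>\<open>?P\<close> stores \<open>ip d q x\<close> in coordinate
    \<open>i0\<close>, \<open>?S\<close> subtracts its multiples from the other coordinates,
    \<open>?N\<close> negates it, because the reflection sends \<open>ip d q x\<close> to its
    negative, and \<open>?Q\<close> solves for the coordinate \<open>i0\<close> again.\<close>
  let ?P = "\<lambda>x::vec. x(i0 := q i0 * x i0 + ?r x)"
  let ?Q = "\<lambda>x::vec. x(i0 := (1 / q i0) * x i0 + (- ?r x / q i0))"
  let ?N = "\<lambda>x::vec. x(i0 := (-1) * x i0 + 0)"
  let ?S = "\<lambda>x::vec. (\<lambda>i. if i \<in> ?J then x i + x i0 * (-2 * q i) else x i)"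
  have ipeq: "ip d q x = q i0 * x i0 + ?r x" for x
    unfolding ip_def using i0 by (subst sum.remove[of _ i0]) auto
  have rup: "?r (x(i0 := t)) = ?r x" for x t
    by (intro sum.cong) auto
  have rS: "?r (?S x) = ?r x - 2 * x i0 * (1 - (q i0)\<^sup>2)" for x
  proof -
    have "1 = q i0 * q i0 + (\<Sum>j\<in>?J. q j * q j)"
      using q ipeq[of q] by simp
    then have "(\<Sum>j\<in>?J. q j * q j) = 1 - (q i0)\<^sup>2"
      by (simp add: power2_eq_square)
    moreover have "?r (?S x) = (\<Sum>j\<in>?J. q j * x j - 2 * x i0 * (q j * q j))"
      by (intro sum.cong) (auto simp: algebra_simps)
    ultimately show ?thesis
      by (simp add: sum_subtractf sum_distrib_left[symmetric])
  qed
  have eq: "reflect d q x = ?Q (?N (?S (?P x)))" if "x \<in> space (coords d)" for x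
  proof
    fix i
    consider "i \<ge> d" | "i < d" "i \<noteq> i0" | "i = i0" by linarith
    then show "reflect d q x i = ?Q (?N (?S (?P x))) i"
    proof cases
      case 1
      then show ?thesis
        using that i0 by (auto simp: reflect_def space_PiM_lborel extensional_def)
    next
      case 2
      then show ?thesis
        by (simp add: reflect_def ipeq)
    next
      case 3
      have "?Q (?N (?S (?P x))) i0 = (1 / q i0) * (- ip d q x) - ?r (?S (?P x)) / q i0"
        unfolding rup by (simp add: ipeq)
      also have "?r (?S (?P x)) = (ip d q x - q i0 * x i0) - 2 * ip d q x * (1 - (q i0)\<^sup>2)"
        unfolding rS rup by (simp add: ipeq)
      also have "(1 / q i0) * (- ip d q x) - \<dots> / q i0 = x i0 - 2 * ip d q x * q i0"
        using i0 by (simp add: field_simps power2_eq_square)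
      finally show ?thesis
        using i0 3 by (simp add: reflect_def)
    qed
  qed
  have rm: "?r \<in> borel_measurable (coords d)"
    by measurable
  have mQ: "?Q \<in> coords d \<rightarrow>\<^sub>M coords d" and mN: "?N \<in> coords d \<rightarrow>\<^sub>M coords d"
    using i0 by (auto intro!: update_measurable_coords simp del: fun_upd_apply) 
  have mS: "?S \<in> coords d \<rightarrow>\<^sub>M coords d"
  proof -
    have "(\<lambda>x. (\<lambda>i\<in>{..<d}. if i \<in> ?J then x i + x i0 * (-2 * q i) else x i)) \<in> coords d \<rightarrow>\<^sub>M coords d"
      using i0 by (intro measurable_restrict) auto
    moreover have "(\<lambda>i\<in>{..<d}. if i \<in> ?J then x i + x i0 * (-2 * q i) else x i) = ?S x"
      if "x \<in> space (coords d)" for x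
      using that by (auto simp: space_PiM_lborel extensional_def)
    ultimately show ?thesis
      by (subst measurable_cong[of _ _ "\<lambda>x. (\<lambda>i\<in>{..<d}. if i \<in> ?J then x i + x i0 * (-2 * q i) else x i)"]) auto
  qed
  note FQ = measurable_compose[OF mQ F]
  note FN = measurable_compose[OF mN FQ]
  note FS = measurable_compose[OF mS FN]
  have "(\<integral>\<^sup>+z. F (reflect d q z) \<partial>coords d) = (\<integral>\<^sup>+z. F (?Q (?N (?S (?P z)))) \<partial>coords d)"
    by (rule nn_integral_cong) (simp only: eq)
  also have "\<dots> = ennreal \<bar>1 / q i0\<bar> * (ennreal \<bar>q i0\<bar> * (\<integral>\<^sup>+z. F (?Q (?N (?S (?P z)))) \<partial>coords d))"
    using i0 by (simp add: mult.assoc[symmetric] ennreal_mult[symmetric])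
  also have "ennreal \<bar>q i0\<bar> * (\<integral>\<^sup>+z. F (?Q (?N (?S (?P z)))) \<partial>coords d) = (\<integral>\<^sup>+z. F (?Q (?N (?S z))) \<partial>coords d)"
    using i0 FS rm by (intro nn_integral_coords_affine) (auto intro!: sum.cong)
  also have "\<dots> = (\<integral>\<^sup>+z. F (?Q (?N z)) \<partial>coords d)"
    using i0 FN by (intro nn_integral_coords_shears) auto
  also have "\<dots> = ennreal \<bar>-1\<bar> * (\<integral>\<^sup>+z. F (?Q (?N z)) \<partial>coords d)"
    by simp
  also have "\<dots> = (\<integral>\<^sup>+z. F (?Q z) \<partial>coords d)"
    using i0 FQ by (intro nn_integral_coords_affine) auto
  also have "ennreal \<bar>1 / q i0\<bar> * (\<integral>\<^sup>+z. F (?Q z) \<partial>coords d) = (\<integral>\<^sup>+z. F z \<partial>coords d)"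
    using i0 F rm by (intro nn_integral_coords_affine) (auto intro!: sum.cong)
  finally show ?thesis .
qed

section \<open>Reflection invariance of the uniform distribution\<close>

lemma sets_uniform_sphere [measurable_cong, simp]: "sets (uniform_sphere d) = sets (coords d)"
  by (simp add: uniform_sphere_def)

lemma space_uniform_sphere: "space (uniform_sphere d) = extensional {..<d}"
  using space_PiM_lborel by (simp add: uniform_sphere_def)

lemma nn_integral_uniform_sphere:
  assumes F: "F \<in> borel_measurable (coords d)"
  shows "(\<integral>\<^sup>+z. F z \<partial>uniform_sphere d) =
    (\<integral>\<^sup>+x. F (normalize_vec d x) * indicator (unit_cball d) x \<partial>coords d) / ennreal (unit_ball_vol (real d))"
proof -
  let ?U = "uniform_measure (coords d) (unit_cball d)"
  have "normalize_vec d \<in> ?U \<rightarrow>\<^sub>M coords d"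
    using normalize_vec_measurable by (simp add: measurable_def)
  then have "(\<integral>\<^sup>+z. F z \<partial>uniform_sphere d) = (\<integral>\<^sup>+x. F (normalize_vec d x) \<partial>?U)"
    unfolding uniform_sphere_def using F by (simp add: nn_integral_distr)
  also have "\<dots> = (\<integral>\<^sup>+x. F (normalize_vec d x) * indicator (unit_cball d) x \<partial>coords d) /
      emeasure (coords d) (unit_cball d)"
    using measurable_compose[OF normalize_vec_measurable F] unit_cball_sets
    by (rule nn_integral_uniform_measure)
  finally show ?thesis
    by (simp add: emeasure_unit_cball)
qed

lemma normalize_reflect:
  assumes "ip d q q = 1"
  shows "normalize_vec d (reflect d q x) = reflect d q (normalize_vec d x)"
proof
  fix i
  let ?m = "sqrt (\<Sum>j<d. (x j)\<^sup>2)"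
  have "(\<Sum>j<d. (reflect d q x j)\<^sup>2) = (\<Sum>j<d. (x j)\<^sup>2)"
    using ip_self_reflect[OF assms] by (simp add: ip_self_conv)
  moreover have "ip d q (normalize_vec d x) = ip d q (\<lambda>i. x i / ?m)"
    by (rule ip_cong) (auto simp: normalize_vec_def)
  then have "ip d q (normalize_vec d x) = ip d q x / ?m"
    by (simp add: ip_linear)
  ultimately show "normalize_vec d (reflect d q x) i = reflect d q (normalize_vec d x) i"
    by (simp add: normalize_vec_def reflect_def diff_divide_distrib)
qed

text \<open>All ingredients of the cone measure are compatible with a reflection: Lebesgue measure
  and the ball are preserved, and normalization commutes with it.\<close>

lemma nn_integral_uniform_sphere_reflect:
  assumes q: "ip d q q = 1" and F[measurable]: "F \<in> borel_measurable (coords d)"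
  shows "(\<integral>\<^sup>+z. F (reflect d q z) \<partial>uniform_sphere d) = (\<integral>\<^sup>+z. F z \<partial>uniform_sphere d)"
proof -
  note [measurable] = normalize_vec_measurable unit_cball_sets
  have "reflect d q x \<in> unit_cball d \<longleftrightarrow> x \<in> unit_cball d" if "x \<in> space (coords d)" for x
    using that ip_self_reflect[OF q, of x]
    by (auto simp: unit_cball_def ip_self_conv reflect_def space_PiM_lborel)
  then have ind: "indicator (unit_cball d) (reflect d q x) = (indicator (unit_cball d) x :: ennreal)"
    if "x \<in> space (coords d)" for x
    using that by (simp add: indicator_def)
  have "(\<integral>\<^sup>+x. F (reflect d q (normalize_vec d x)) * indicator (unit_cball d) x \<partial>coords d) =
      (\<integral>\<^sup>+x. F (normalize_vec d (reflect d q x)) * indicator (unit_cball d) (reflect d q x) \<partial>coords d)"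
    by (intro nn_integral_cong) (simp add: ind normalize_reflect[OF q])
  also have "\<dots> = (\<integral>\<^sup>+x. F (normalize_vec d x) * indicator (unit_cball d) x \<partial>coords d)"
    by (intro nn_integral_coords_reflect q) measurable
  finally show ?thesis
    by (subst (1 2) nn_integral_uniform_sphere) auto
qed

lemma distr_uniform_sphere_reflect:
  assumes q: "ip d q q = 1"
  shows "distr (uniform_sphere d) (coords d) (reflect d q) = uniform_sphere d"
proof (rule measure_eqI)
  fix A assume "A \<in> sets (distr (uniform_sphere d) (coords d) (reflect d q))"
  then have A[measurable]: "A \<in> sets (coords d)"
    by simp
  have "emeasure (distr (uniform_sphere d) (coords d) (reflect d q)) A =
      (\<integral>\<^sup>+z. indicator A z \<partial>distr (uniform_sphere d) (coords d) (reflect d q))"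
    by simp
  also have "\<dots> = (\<integral>\<^sup>+z. indicator A (reflect d q z) \<partial>uniform_sphere d)"
    by (rule nn_integral_distr) measurable
  also have "\<dots> = (\<integral>\<^sup>+z. indicator A z \<partial>uniform_sphere d)"
    by (rule nn_integral_uniform_sphere_reflect[OF q]) measurable
  finally show "emeasure (distr (uniform_sphere d) (coords d) (reflect d q)) A = emeasure (uniform_sphere d) A"
    by simp
qed simp

lemma integral_uniform_sphere_reflect:
  fixes F :: "vec \<Rightarrow> real"
  assumes "ip d q q = 1" and "F \<in> borel_measurable (coords d)"
  shows "(\<integral>z. F (reflect d q z) \<partial>uniform_sphere d) = (\<integral>z. F z \<partial>uniform_sphere d)"
  using integral_distr[of "reflect d q" "uniform_sphere d" "coords d" F] assms
  by (simp add: distr_uniform_sphere_reflect)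

section \<open>Marginals of the uniform distribution\<close>

text \<open>The reflection along \<open>v - v'\<close> exchanges the two unit vectors, so the
  marginals in all directions coincide.\<close>

lemma nn_integral_ip_unit:
  fixes g :: "real \<Rightarrow> ennreal"
  assumes v: "ip d v v = 1" and v': "ip d v' v' = 1" and g: "g \<in> borel_measurable borel"
  shows "(\<integral>\<^sup>+z. g (ip d v z) \<partial>uniform_sphere d) = (\<integral>\<^sup>+z. g (ip d v' z) \<partial>uniform_sphere d)"
proof (cases "ip d (\<lambda>i. v i - v' i) (\<lambda>i. v i - v' i) = 0")
  case True
  have "ip d v z = ip d v' z" for z
    using ip_self_eq_0_left[OF True, of z] by (simp add: ip_linear)
  then show ?thesis by simp
next
  case False
  let ?u = "\<lambda>i. v i - v' i"
  define m where "m = sqrt (ip d ?u ?u)"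
  have m: "m > 0" "m * m = ip d ?u ?u"
    using False ip_self_nonneg[of d ?u] by (auto simp: m_def)
  have uu: "ip d ?u ?u = 2 * ip d v ?u"
    using v v' by (simp add: ip_linear ip_commute[of d v' v])
  let ?q = "\<lambda>i. ?u i / m"
  have q: "ip d ?q ?q = 1"
    using m by (simp only: ip_divide_left ip_divide_right) (simp flip: m(2))
  have "ip d v (reflect d ?q z) = ip d v' z" for z
  proof -
    have "ip d v (reflect d ?q z) = ip d v z - 2 * (ip d ?u z / m) * (ip d v ?u / m)"
      by (simp only: ip_reflect ip_divide_left ip_divide_right)
    also have "2 * (ip d ?u z / m) * (ip d v ?u / m) = ip d ?u z * ((2 * ip d v ?u) / (m * m))"
      by simp
    also have "\<dots> = ip d ?u z"
      using m False uu by simp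
    finally show ?thesis
      by (simp add: ip_linear)
  qed
  moreover have "(\<lambda>z. g (ip d v z)) \<in> borel_measurable (coords d)"
    using g by measurable
  ultimately show ?thesis
    using nn_integral_uniform_sphere_reflect[OF q, of "\<lambda>z. g (ip d v z)"] by simp
qed

text \<open>With x = (d + 1) / 2, log-convexity of Gamma at the midpoint of x and x + 1 gives Gamma
  (x + 1/2)^2 <= Gamma x * Gamma (x + 1) = x * Gamma x ^ 2, and x <= d. The remaining factor 1 /
  sqrt pi of the ratio is bounded by 1.\<close>

lemma unit_ball_vol_ratio:
  assumes "d \<ge> 1"
  shows "unit_ball_vol (real d - 1) \<le> sqrt (real d) * unit_ball_vol (real d)"
proof -
  define x where "x = real d / 2 + 1/2"
  have x: "x \<ge> 1" using assms by (simp add: x_def)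
  have pos: "Gamma x > 0" "Gamma (x + 1/2) > 0" "Gamma (x + 1) > 0"
    using x by (auto intro!: Gamma_real_pos)
  have "(ln \<circ> Gamma) ((1 - 1/2) *\<^sub>R x + (1/2) *\<^sub>R (x + 1)) \<le>
      (1 - 1/2) * (ln \<circ> Gamma) x + (1/2) * (ln \<circ> Gamma) (x + 1)"
    by (rule convex_onD[OF log_convex_Gamma_real]) (use x in auto)
  also have "(1 - 1/2) *\<^sub>R x + (1/2) *\<^sub>R (x + 1) = x + 1/2"
    by (simp add: field_simps)
  finally have "2 * ln (Gamma (x + 1/2)) \<le> ln (Gamma x) + ln (Gamma (x + 1))"
    by simp
  then have "ln ((Gamma (x + 1/2))\<^sup>2) \<le> ln (Gamma x * Gamma (x + 1))"
    using pos by (simp add: ln_realpow ln_mult)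
  then have "(Gamma (x + 1/2))\<^sup>2 \<le> Gamma x * Gamma (x + 1)"
    using pos by (subst (asm) ln_le_cancel_iff) auto
  also have "Gamma (x + 1) = x * Gamma x"
    using x by (intro Gamma_plus1) (auto simp: nonpos_Ints_def)
  also have "Gamma x * (x * Gamma x) \<le> Gamma x * (real d * Gamma x)"
    using x assms by (intro mult_left_mono mult_right_mono) (auto simp: x_def Gamma_real_pos less_imp_le)
  also have "\<dots> = (sqrt (real d) * Gamma x)\<^sup>2"
    by (simp add: power_mult_distrib) (simp add: power2_eq_square)
  finally have G: "Gamma (x + 1/2) \<le> sqrt (real d) * Gamma x"
    by (rule power2_le_imp_le) (use x in \<open>auto simp: Gamma_real_pos less_imp_le\<close>)
  have "unit_ball_vol (real d - 1) = pi powr (real d / 2 - 1/2) / Gamma x"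
    by (simp add: unit_ball_vol_def x_def field_simps)
  also have "\<dots> \<le> pi powr (real d / 2) / Gamma x"
    using x by (intro divide_right_mono powr_mono) (auto simp: Gamma_real_pos less_imp_le pi_ge_two intro: order_trans[OF _ pi_ge_two])
  also have "\<dots> \<le> sqrt (real d) * (pi powr (real d / 2) / Gamma (x + 1/2))"
    using G x by (simp add: field_simps Gamma_real_pos mult_left_mono)
  also have "pi powr (real d / 2) / Gamma (x + 1/2) = unit_ball_vol (real d)"
    by (simp add: unit_ball_vol_def x_def field_simps)
  finally show ?thesis .
qed

lemma abs_coord_normalize_le:
  assumes "x \<in> unit_cball d" "i < d"
  shows "\<bar>x i\<bar> \<le> \<bar>normalize_vec d x i\<bar>"
proof (cases "x i = 0")
  case False
  let ?m = "sqrt (\<Sum>j<d. (x j)\<^sup>2)"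
  have "0 < (\<Sum>j<d. (x j)\<^sup>2)"
    using False assms by (intro sum_pos2[of _ i]) auto
  moreover have "?m \<le> 1"
    using assms by (simp add: unit_cball_def)
  ultimately have "\<bar>x i\<bar> \<le> \<bar>x i\<bar> / ?m"
    by (simp add: field_simps mult_left_le)
  then show ?thesis
    using assms \<open>0 < _\<close> by (simp add: normalize_vec_def abs_divide)
qed simp

text \<open>By invariance \<open>v\<close> may be taken as the first basis vector. Normalizing a
  point of the ball only enlarges its coordinates, so the points of the ball whose direction lies in
  the slab are contained in the cylinder [-b, b] times the ball of dimension d - 1. The ratio of the
  volumes is bounded by \<open>unit_ball_vol_ratio\<close>.\<close>

lemma emeasure_slab_le:
  assumes d: "d \<ge> 1" and v: "ip d v v = 1" and b: "b \<ge> 0"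
  shows "emeasure (uniform_sphere d) {z \<in> space (uniform_sphere d). \<bar>ip d v z\<bar> \<le> b} \<le> ennreal (2 * b * sqrt (real d))"
proof -
  interpret product_sigma_finite "\<lambda>_::nat. lborel :: real measure"
    by standard
  let ?e = "\<lambda>i::nat. if i = 0 then 1 else 0 :: real"
  have ip_e: "ip d ?e z = z 0" for z
  proof -
    have "ip d ?e z = (\<Sum>i<d. if i = 0 then z i else 0)"
      unfolding ip_def by (intro sum.cong) auto
    then show ?thesis
      using d by (simp add: sum.delta')
  qed
  let ?J = "{1..<d}"
  have ins: "insert 0 ?J = {..<d}"
    using d by auto
  define B where "B = {f. sqrt (\<Sum>i\<in>?J. (f i)\<^sup>2) \<le> 1} \<inter> space (Pi\<^sub>M ?J (\<lambda>_. lborel :: real measure))"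
  have B_sets [measurable]: "B \<in> sets (Pi\<^sub>M ?J (\<lambda>_. lborel))"
  proof -
    have "B = {f \<in> space (Pi\<^sub>M ?J (\<lambda>_. lborel)). sqrt (\<Sum>i\<in>?J. (f i)\<^sup>2) \<le> 1}"
      by (auto simp: B_def)
    also have "\<dots> \<in> sets (Pi\<^sub>M ?J (\<lambda>_. lborel))"
      by measurable
    finally show ?thesis .
  qed
  have B_vol: "emeasure (Pi\<^sub>M ?J (\<lambda>_. lborel)) B = ennreal (unit_ball_vol (real d - 1))"
    unfolding B_def using emeasure_cball_aux[of ?J 1] d by (simp add: of_nat_diff)
  let ?f = "\<lambda>x::vec. ennreal (if \<bar>x 0\<bar> \<le> b \<and> (\<Sum>i\<in>?J. (x i)\<^sup>2) \<le> 1 then 1 else 0)"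
  have fm: "?f \<in> borel_measurable (coords d)"
  proof -
    have comp: "(\<lambda>x. x i) \<in> borel_measurable (coords d)" if "i < d" for i
      using that measurable_component_singleton[of i "{..<d}" "\<lambda>_. lborel :: real measure"] by simp
    define S where "S = (\<lambda>x::vec. \<Sum>i\<in>?J. (x i)\<^sup>2)"
    have [measurable]: "S \<in> borel_measurable (coords d)"
      unfolding S_def by (intro borel_measurable_sum borel_measurable_power comp) auto
    have [measurable]: "(\<lambda>x. x 0) \<in> borel_measurable (coords d)"
      using comp d by simp
    have "(\<lambda>x. ennreal (if \<bar>x 0\<bar> \<le> b \<and> S x \<le> 1 then 1 else 0)) \<in> borel_measurable (coords d)"
      by measurable
    then show ?thesis
      by (simp add: S_def)
  qed
  have slab: "{z \<in> space (uniform_sphere d). \<bar>ip d v z\<bar> \<le> b} \<in> sets (uniform_sphere d)"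
    by measurable
  have "emeasure (uniform_sphere d) {z \<in> space (uniform_sphere d). \<bar>ip d v z\<bar> \<le> b} =
      (\<integral>\<^sup>+z. indicator {-b..b} (ip d v z) \<partial>uniform_sphere d)"
    by (subst nn_integral_indicator[OF slab, symmetric])
      (auto intro!: nn_integral_cong simp: indicator_def abs_le_iff)
  also have "\<dots> = (\<integral>\<^sup>+z. indicator {-b..b} (z 0) \<partial>uniform_sphere d)"
  proof -
    have "ip d ?e ?e = 1"
      by (simp only: ip_e) simp
    from nn_integral_ip_unit[OF v this, of "indicator {-b..b}"] show ?thesis
      by (simp only: ip_e) simp
  qed
  also have "\<dots> = (\<integral>\<^sup>+x. indicator {-b..b} (normalize_vec d x 0) * indicator (unit_cball d) x \<partial>coords d) /
      ennreal (unit_ball_vol (real d))"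
    using d by (intro nn_integral_uniform_sphere) measurable
  also have "\<dots> \<le> (\<integral>\<^sup>+x. ?f x \<partial>coords d) / ennreal (unit_ball_vol (real d))"
  proof (intro divide_right_mono_ennreal nn_integral_mono)
    fix x
    show "indicator {-b..b} (normalize_vec d x 0) * indicator (unit_cball d) x \<le> ?f x"
    proof (cases "\<bar>normalize_vec d x 0\<bar> \<le> b \<and> x \<in> unit_cball d")
      case True
      then have "\<bar>x 0\<bar> \<le> b"
        using abs_coord_normalize_le[of x d 0] d by auto
      moreover have "(\<Sum>i\<in>?J. (x i)\<^sup>2) \<le> (\<Sum>i<d. (x i)\<^sup>2)"
        by (intro sum_mono2) auto
      ultimately show ?thesis
        using True by (auto simp: unit_cball_def indicator_def)
    qed (auto simp: indicator_def abs_le_iff)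
  qed
  also have "(\<integral>\<^sup>+x. ?f x \<partial>coords d) = (\<integral>\<^sup>+x. (\<integral>\<^sup>+t. ?f (x(0 := t)) \<partial>lborel) \<partial>Pi\<^sub>M ?J (\<lambda>_. lborel))"
    using product_nn_integral_insert[of ?J 0 ?f] fm unfolding ins by simp
  also have "\<dots> = (\<integral>\<^sup>+x. ennreal (2 * b) * indicator B x \<partial>Pi\<^sub>M ?J (\<lambda>_. lborel))"
  proof (rule nn_integral_cong)
    fix x assume x: "x \<in> space (Pi\<^sub>M ?J (\<lambda>_. lborel :: real measure))"
    have "?f (x(0 := t)) = indicator B x * indicator {-b..b} t" for t
      using x by (auto simp: B_def indicator_def abs_le_iff)
    then have "(\<integral>\<^sup>+t. ?f (x(0 := t)) \<partial>lborel) = indicator B x * emeasure lborel {-b..b}"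
      by (simp only:) (simp add: nn_integral_cmult)
    also have "emeasure lborel {-b..b} = ennreal (2 * b)"
      using b by simp
    finally show "(\<integral>\<^sup>+t. ?f (x(0 := t)) \<partial>lborel) = ennreal (2 * b) * indicator B x"
      by (simp add: mult.commute)
  qed
  also have "\<dots> = ennreal (2 * b) * ennreal (unit_ball_vol (real d - 1))"
    by (simp only: nn_integral_cmult_indicator[OF B_sets] B_vol)
  also have "\<dots> / ennreal (unit_ball_vol (real d)) = ennreal (2 * b * unit_ball_vol (real d - 1) / unit_ball_vol (real d))"
    using b d by (simp add: ennreal_mult[symmetric] divide_ennreal)
  also have "\<dots> \<le> ennreal (2 * b * sqrt (real d))"
  proof (rule ennreal_leI)
    have "unit_ball_vol (real d - 1) / unit_ball_vol (real d) \<le> sqrt (real d)"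
      using unit_ball_vol_ratio[OF d] by (simp add: field_simps)
    then show "2 * b * unit_ball_vol (real d - 1) / unit_ball_vol (real d) \<le> 2 * b * sqrt (real d)"
      using mult_left_mono[of _ _ "2 * b"] b by fastforce
  qed
  finally show ?thesis .
qed

lemma AE_uniform_sphere: "d \<ge> 1 \<Longrightarrow> AE z in uniform_sphere d. z \<in> unit_sphere d"
  using measure_uniform_sphere_unit_sphere unit_sphere_sets prob_space_uniform_sphere
  by (metis prob_space.AE_prob_1)

text \<open>All coordinates have the same second moment by invariance, and on the sphere their
  squares add up to 1.\<close>

lemma nn_integral_ip_square:
  assumes d: "d \<ge> 1" and v: "ip d v v = 1"
  shows "(\<integral>\<^sup>+z. ennreal ((ip d v z)\<^sup>2) \<partial>uniform_sphere d) = ennreal (1 / real d)"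
proof -
  interpret prob_space "uniform_sphere d"
    by (rule prob_space_uniform_sphere)
  let ?I = "\<integral>\<^sup>+z. ennreal ((ip d v z)\<^sup>2) \<partial>uniform_sphere d"
  have coord: "(\<integral>\<^sup>+z. ennreal ((z i)\<^sup>2) \<partial>uniform_sphere d) = ?I" if "i < d" for i
  proof -
    let ?e = "\<lambda>j. if j = i then 1 else 0 :: real"
    have ip_e: "ip d ?e z = z i" for z
    proof -
      have "ip d ?e z = (\<Sum>j<d. if j = i then z j else 0)"
        unfolding ip_def by (intro sum.cong) auto
      then show ?thesis
        using that by (simp add: sum.delta')
    qed
    have "ip d ?e ?e = 1"
      by (simp only: ip_e) simp
    from nn_integral_ip_unit[OF this v, of "\<lambda>t. ennreal (t\<^sup>2)"] show ?thesis
      by (simp only: ip_e) simp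
  qed
  have "of_nat d * ?I = (\<Sum>i<d. \<integral>\<^sup>+z. ennreal ((z i)\<^sup>2) \<partial>uniform_sphere d)"
    by (simp add: coord)
  also have "\<dots> = (\<integral>\<^sup>+z. (\<Sum>i<d. ennreal ((z i)\<^sup>2)) \<partial>uniform_sphere d)"
    by (intro nn_integral_sum[symmetric]) measurable
  also have "\<dots> = (\<integral>\<^sup>+z. 1 \<partial>uniform_sphere d)"
    using AE_uniform_sphere[OF d]
    by (intro nn_integral_cong_AE) (auto simp: sum_ennreal unit_sphere_def)
  also have "\<dots> = 1"
    by (simp add: emeasure_space_1)
  finally have eq: "of_nat d * ?I = 1" .
  have "?I = ennreal (1 / real d) * (of_nat d * ?I)"
    using d by (simp add: mult.assoc[symmetric] ennreal_of_nat_eq_real_of_nat ennreal_mult[symmetric])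
  then show ?thesis
    by (simp add: eq)
qed

text \<open>The condition cuts out the arc from arccos m to pi - arccos m, on which the sine is
  nonnegative with primitive -cos. The half-open range of angles lets translates of it tile the line
  in the next lemma.\<close>

lemma nn_integral_arc:
  assumes m: "0 \<le> m" "m \<le> 1"
  shows "(\<integral>\<^sup>+t. ennreal (if \<bar>cos t\<bar> \<le> m then \<bar>sin t\<bar> else 0) * indicator {0..<pi} t \<partial>lborel) = ennreal (2 * m)"
proof -
  define a where "a = arccos m"
  have a: "0 \<le> a" "a \<le> pi / 2" "cos a = m" "a \<le> pi"
    using m arccos_bounded[of m] arccos_le_pi2[of m] by (auto simp: a_def cos_arccos)
  have iff: "\<bar>cos t\<bar> \<le> m \<longleftrightarrow> t \<in> {a..pi - a}" if "0 \<le> t" "t \<le> pi" for t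
  proof -
    have "cos t \<le> m \<longleftrightarrow> a \<le> t"
      using cos_mono_le_eq[of t a] that a by simp
    moreover have "- m \<le> cos t \<longleftrightarrow> t \<le> pi - a"
      using cos_mono_le_eq[of "pi - a" t] that a by simp
    ultimately show ?thesis by (auto simp: abs_le_iff)
  qed
  have "ennreal (if \<bar>cos t\<bar> \<le> m then \<bar>sin t\<bar> else 0) * indicator {0..<pi} t = ennreal (sin t) * indicator {a..pi - a} t"
    for t
  proof (cases "0 \<le> t \<and> t < pi")
    case True
    then show ?thesis
      using iff[of t] sin_ge_zero[of t] by (auto simp: indicator_def)
  next
    case False
    then show ?thesis
      using a by (cases "t = pi") (auto simp: indicator_def)
  qed
  then have "(\<integral>\<^sup>+t. ennreal (if \<bar>cos t\<bar> \<le> m then \<bar>sin t\<bar> else 0) * indicator {0..<pi} t \<partial>lborel) =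
      (\<integral>\<^sup>+t. ennreal (sin t) * indicator {a..pi - a} t \<partial>lborel)"
    by simp
  also have "\<dots> = ennreal (- cos (pi - a) - (- cos a))"
    using a by (intro nn_integral_FTC_Icc[where F="\<lambda>t. - cos t"])
      (auto intro!: derivative_eq_intros sin_ge_zero)
  finally show ?thesis
    using a by simp
qed

text \<open>The integrand has period pi, so the window of length pi may start anywhere.\<close>

lemma nn_integral_arc_shift:
  assumes m: "0 \<le> m" "m \<le> 1" and u: "0 \<le> u" "u \<le> pi"
  shows "(\<integral>\<^sup>+t. ennreal (if \<bar>cos (t - u)\<bar> \<le> m then \<bar>sin (t - u)\<bar> else 0) * indicator {0..<pi} t \<partial>lborel) = ennreal (2 * m)"
proof -
  let ?q = "\<lambda>t. ennreal (if \<bar>cos t\<bar> \<le> m then \<bar>sin t\<bar> else 0)"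
  have [measurable]: "?q \<in> borel_measurable borel"
    by measurable
  have per: "?q (t - pi) = ?q t" for t
    by (simp add: cos_diff sin_diff)
  have "(\<integral>\<^sup>+t. ?q (t - u) * indicator {0..<pi} t \<partial>lborel) =
      (\<integral>\<^sup>+t. ?q t * indicator {-u..<0} t + ?q t * indicator {0..<pi-u} t \<partial>lborel)"
    using u by (subst nn_integral_real_affine[where t=u and c=1])
      (auto intro!: nn_integral_cong simp: indicator_def)
  also have "\<dots> = (\<integral>\<^sup>+t. ?q t * indicator {-u..<0} t \<partial>lborel) + (\<integral>\<^sup>+t. ?q t * indicator {0..<pi-u} t \<partial>lborel)"
    by (intro nn_integral_add) measurable
  also have "(\<integral>\<^sup>+t. ?q t * indicator {-u..<0} t \<partial>lborel) = (\<integral>\<^sup>+t. ?q t * indicator {pi-u..<pi} t \<partial>lborel)"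
    by (subst nn_integral_real_affine[where t="-pi" and c=1])
      (auto intro!: nn_integral_cong simp: indicator_def per[simplified])
  also have "(\<integral>\<^sup>+t. ?q t * indicator {pi-u..<pi} t \<partial>lborel) + (\<integral>\<^sup>+t. ?q t * indicator {0..<pi-u} t \<partial>lborel) =
      (\<integral>\<^sup>+t. ?q t * indicator {pi-u..<pi} t + ?q t * indicator {0..<pi-u} t \<partial>lborel)"
    by (intro nn_integral_add[symmetric]) measurable
  also have "\<dots> = (\<integral>\<^sup>+t. ?q t * indicator {0..<pi} t \<partial>lborel)"
    using u by (intro nn_integral_cong) (auto simp: indicator_def)
  finally show ?thesis
    using nn_integral_arc[OF m] by simp
qed

lemma nn_integral_circle:
  assumes h: "0 \<le> h" "h \<le> sqrt (a\<^sup>2 + b\<^sup>2)"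
  shows "(\<integral>\<^sup>+t. ennreal (if \<bar>a * cos t + b * sin t\<bar> \<le> h then \<bar>a * sin t - b * cos t\<bar> else 0) * indicator {0..<pi} t \<partial>lborel)
    = ennreal (2 * h)"
proof -
  \<comment> \<open>For nonnegative \<open>b\<close> the polar angle of (a, b) lies in [0, pi], as
    \<open>nn_integral_arc_shift\<close> requires. The other case follows by negating both
    \<open>a\<close> and \<open>b\<close>.\<close>
  have *: "(\<integral>\<^sup>+t. ennreal (if \<bar>a * cos t + b * sin t\<bar> \<le> h then \<bar>a * sin t - b * cos t\<bar> else 0) * indicator {0..<pi} t \<partial>lborel)
    = ennreal (2 * h)" if b: "b \<ge> 0" and h': "0 \<le> h" "h \<le> sqrt (a\<^sup>2 + b\<^sup>2)" for a b
  proof (cases "a\<^sup>2 + b\<^sup>2 = 0")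
    case True
    then have ab: "a = 0" "b = 0"
      by (simp_all add: sum_power2_eq_zero_iff)
    show ?thesis
      using h' unfolding ab by simp
  next
    case False
    define R where "R = sqrt (a\<^sup>2 + b\<^sup>2)"
    have R: "R > 0" "R\<^sup>2 = a\<^sup>2 + b\<^sup>2"
      using False by (auto simp: R_def sum_power2_gt_zero_iff)
    have "(a / R)\<^sup>2 + (b / R)\<^sup>2 = 1"
      using R False by (simp add: power_divide add_divide_distrib[symmetric])
    moreover have "0 \<le> b / R"
      using b R by simp
    ultimately obtain u where u: "0 \<le> u" "u \<le> pi" "a / R = cos u" "b / R = sin u"
      using sincos_total_pi[of "b / R" "a / R"] by auto
    then have ab: "a = R * cos u" "b = R * sin u"
      using R by (auto simp: field_simps)
    have eq: "(if \<bar>a * cos t + b * sin t\<bar> \<le> h then \<bar>a * sin t - b * cos t\<bar> else 0) =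
        R * (if \<bar>cos (t - u)\<bar> \<le> h / R then \<bar>sin (t - u)\<bar> else 0)" for t
    proof -
      have "a * cos t + b * sin t = R * cos (t - u)" "a * sin t - b * cos t = R * sin (t - u)"
        by (simp_all add: ab cos_diff sin_diff algebra_simps)
      then show ?thesis
        using R by (simp add: abs_mult field_simps)
    qed
    have "(\<integral>\<^sup>+t. ennreal (if \<bar>a * cos t + b * sin t\<bar> \<le> h then \<bar>a * sin t - b * cos t\<bar> else 0) * indicator {0..<pi} t \<partial>lborel)
      = (\<integral>\<^sup>+t. ennreal R * (ennreal (if \<bar>cos (t - u)\<bar> \<le> h / R then \<bar>sin (t - u)\<bar> else 0) * indicator {0..<pi} t) \<partial>lborel)"
      unfolding eq using R by (simp add: ennreal_mult mult.assoc)
    also have "\<dots> = ennreal R * (\<integral>\<^sup>+t. ennreal (if \<bar>cos (t - u)\<bar> \<le> h / R then \<bar>sin (t - u)\<bar> else 0) * indicator {0..<pi} t \<partial>lborel)"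
      by (rule nn_integral_cmult) measurable
    also have "\<dots> = ennreal R * ennreal (2 * (h / R))"
      using R h' u by (subst nn_integral_arc_shift) (auto simp: R_def)
    also have "\<dots> = ennreal (2 * h)"
      using R h' by (simp add: ennreal_mult[symmetric])
    finally show ?thesis .
  qed
  show ?thesis
  proof (cases "b \<ge> 0")
    case True
    then show ?thesis using * h by blast
  next
    case False
    have neg: "\<bar>(- a) * cos t + (- b) * sin t\<bar> = \<bar>a * cos t + b * sin t\<bar>"
      "\<bar>(- a) * sin t - (- b) * cos t\<bar> = \<bar>a * sin t - b * cos t\<bar>" for t
      by (auto simp: abs_if)
    then show ?thesis
      using *[of "- b" "- a", unfolded neg] False h by simp
  qed
qed

text \<open>
  The reflections in the bisectors of the plane spanned by \<^term>\<open>p\<close> and \<^term>\<open>q\<close> turn the coordinates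
  \<^term>\<open>(ip d p z, ip d q z)\<close> by every angle; average over the angle.
\<close>

lemma nn_integral_planar:
  fixes \<Phi> h :: "real \<Rightarrow> real"
  assumes p: "ip d p p = 1" and q: "ip d q q = 1" and pq: "ip d p q = 0"
    and [measurable]: "\<Phi> \<in> borel_measurable borel" "h \<in> borel_measurable borel"
    and \<Phi>: "\<And>r. \<Phi> r \<ge> 0" and h: "\<And>r. r \<ge> 0 \<Longrightarrow> 0 \<le> h r \<and> h r \<le> r"
  defines "R \<equiv> \<lambda>z. sqrt ((ip d p z)\<^sup>2 + (ip d q z)\<^sup>2)"
  shows "(\<integral>\<^sup>+z. ennreal (\<Phi> (R z) * (if \<bar>ip d p z\<bar> \<le> h (R z) then \<bar>ip d q z\<bar> else 0)) \<partial>uniform_sphere d) =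
    (\<integral>\<^sup>+z. ennreal (2 / pi * \<Phi> (R z) * h (R z)) \<partial>uniform_sphere d)"
proof -
  interpret prob_space "uniform_sphere d"
    by (rule prob_space_uniform_sphere)
  interpret pair_sigma_finite lborel "uniform_sphere d"
    by standard
  have [measurable]: "(\<lambda>z. ip d x z) \<in> borel_measurable (uniform_sphere d)" for x
    using ip_measurable[of d x] by (simp add: measurable_def space_uniform_sphere space_PiM_lborel)
  have R0: "R z \<ge> 0" for z
    by (simp add: R_def)
  have Rm [measurable]: "R \<in> borel_measurable (uniform_sphere d)"
    unfolding R_def by measurable
  have Rm' [measurable]: "R \<in> borel_measurable (coords d)"
    unfolding R_def by measurable
  let ?F = "\<lambda>z. ennreal (\<Phi> (R z) * (if \<bar>ip d p z\<bar> \<le> h (R z) then \<bar>ip d q z\<bar> else 0))"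
  let ?G = "\<lambda>t z. ennreal (if \<bar>ip d p z * cos t + ip d q z * sin t\<bar> \<le> h (R z)
              then \<bar>ip d p z * sin t - ip d q z * cos t\<bar> else 0)"
  have refl: "(\<integral>\<^sup>+z. ennreal (\<Phi> (R z)) * ?G t z \<partial>uniform_sphere d) = (\<integral>\<^sup>+z. ?F z \<partial>uniform_sphere d)" for t
  proof -
    \<comment> \<open>On the plane coordinates, reflecting along this unit vector sends (x, y) to (x
      cos t + y sin t, x sin t - y cos t). The half angle appears because a reflection turns by
      twice the angle of its axis.\<close>
    define n where "n = (\<lambda>i. sin (t/2) * p i - cos (t/2) * q i)"
    have sc: "sin t = 2 * sin (t/2) * cos (t/2)" "cos t = 1 - 2 * (sin (t/2))\<^sup>2" "cos t = 2 * (cos (t/2))\<^sup>2 - 1"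
      using sin_double[of "t/2"] cos_double_sin[of "t/2"] cos_double_cos[of "t/2"] by auto
    have one: "(sin (t/2))\<^sup>2 = 1 - (cos (t/2))\<^sup>2"
      by (simp add: sin_squared_eq)
    have n: "ip d n n = 1" "ip d p n = sin (t/2)" "ip d q n = - cos (t/2)"
      using p q pq ip_commute[of d p q] one by (simp_all add: n_def ip_linear power2_eq_square[symmetric])
    have nz: "ip d n z = sin (t/2) * ip d p z - cos (t/2) * ip d q z" for z
      by (simp add: n_def ip_linear)
    have pz: "ip d p (reflect d n z) = ip d p z * cos t + ip d q z * sin t" for z
      unfolding ip_reflect n nz sc(1,2) by (simp add: algebra_simps power2_eq_square)
    have qz: "ip d q (reflect d n z) = ip d p z * sin t - ip d q z * cos t" for z
      unfolding ip_reflect n nz sc(1,3) by (simp add: algebra_simps power2_eq_square)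
    have Rz: "R (reflect d n z) = R z" for z
    proof -
      have "(ip d p z * cos t + ip d q z * sin t)\<^sup>2 + (ip d p z * sin t - ip d q z * cos t)\<^sup>2 =
          ((ip d p z)\<^sup>2 + (ip d q z)\<^sup>2) * ((sin t)\<^sup>2 + (cos t)\<^sup>2)"
        by algebra
      then show ?thesis
        unfolding R_def pz qz by simp
    qed
    have "ennreal (\<Phi> (R z)) * ?G t z = ?F (reflect d n z)" for z
      by (simp only: pz qz Rz ennreal_mult''[OF \<Phi>] ennreal_mult'[OF \<Phi>])
    moreover have "?F \<in> borel_measurable (coords d)"
      by measurable
    ultimately show ?thesis
      using nn_integral_uniform_sphere_reflect[OF n(1), of ?F] by simp
  qed
  have "ennreal pi * (\<integral>\<^sup>+z. ?F z \<partial>uniform_sphere d) =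
      (\<integral>\<^sup>+t. (\<integral>\<^sup>+z. ennreal (\<Phi> (R z)) * ?G t z \<partial>uniform_sphere d) * indicator {0..<pi} t \<partial>lborel)"
    unfolding refl by (subst nn_integral_cmult_indicator) (auto simp: mult.commute)
  also have "\<dots> = (\<integral>\<^sup>+t. (\<integral>\<^sup>+z. ennreal (\<Phi> (R z)) * ?G t z * indicator {0..<pi} t \<partial>uniform_sphere d) \<partial>lborel)"
    by (intro nn_integral_cong nn_integral_multc[symmetric]) measurable
  also have "\<dots> = (\<integral>\<^sup>+z. (\<integral>\<^sup>+t. ennreal (\<Phi> (R z)) * ?G t z * indicator {0..<pi} t \<partial>lborel) \<partial>uniform_sphere d)"
    by (rule Fubini'[symmetric]) measurable
  also have "\<dots> = (\<integral>\<^sup>+z. ennreal (\<Phi> (R z)) * ennreal (2 * h (R z)) \<partial>uniform_sphere d)"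
  proof (rule nn_integral_cong)
    fix z
    have "(\<integral>\<^sup>+t. ennreal (\<Phi> (R z)) * ?G t z * indicator {0..<pi} t \<partial>lborel) =
        ennreal (\<Phi> (R z)) * (\<integral>\<^sup>+t. ?G t z * indicator {0..<pi} t \<partial>lborel)"
      by (subst nn_integral_cmult[symmetric]) (auto simp: mult.assoc)
    also have "(\<integral>\<^sup>+t. ?G t z * indicator {0..<pi} t \<partial>lborel) = ennreal (2 * h (R z))"
      using h[OF R0[of z]] by (intro nn_integral_circle) (auto simp: R_def)
    finally show "(\<integral>\<^sup>+t. ennreal (\<Phi> (R z)) * ?G t z * indicator {0..<pi} t \<partial>lborel) =
        ennreal (\<Phi> (R z)) * ennreal (2 * h (R z))" .
  qed
  also have "\<dots> = (\<integral>\<^sup>+z. ennreal pi * ennreal (2 / pi * \<Phi> (R z) * h (R z)) \<partial>uniform_sphere d)"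
    using h[OF R0] \<Phi> by (intro nn_integral_cong) (simp add: ennreal_mult[symmetric])
  also have "\<dots> = ennreal pi * (\<integral>\<^sup>+z. ennreal (2 / pi * \<Phi> (R z) * h (R z)) \<partial>uniform_sphere d)"
    by (rule nn_integral_cmult) measurable
  finally have "ennreal (1 / pi) * (ennreal pi * (\<integral>\<^sup>+z. ?F z \<partial>uniform_sphere d)) =
      ennreal (1 / pi) * (ennreal pi * (\<integral>\<^sup>+z. ennreal (2 / pi * \<Phi> (R z) * h (R z)) \<partial>uniform_sphere d))"
    by simp
  then show ?thesis
    by (simp add: mult.assoc[symmetric] ennreal_mult[symmetric])
qed

section \<open>First moments of a coordinate and of a noiseless label in a band\<close>

lemma sign_pm_measurable [measurable]: "sign_pm \<in> borel_measurable borel"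
  unfolding sign_pm_def by measurable

lemma halfspace_eq: "halfspace d v x = sign_pm (ip d v x)"
  by (simp add: halfspace_def ip_def)

lemma abs_sign_pm [simp]: "\<bar>sign_pm x\<bar> = 1"
  by (simp add: sign_pm_def)

lemma abs_ip_le_1:
  assumes "z \<in> unit_sphere d" "ip d q q \<le> 1"
  shows "\<bar>ip d q z\<bar> \<le> 1"
proof -
  have "(ip d q z)\<^sup>2 \<le> ip d q q * ip d z z"
    by (rule ip_Cauchy_Schwarz)
  also have "\<dots> \<le> 1"
    using assms by (simp add: unit_sphere_def ip_self_conv)
  finally show ?thesis
    by (simp add: abs_square_le_1)
qed

lemma abs_coord_le_1:
  assumes "z \<in> unit_sphere d" "i < d"
  shows "\<bar>z i\<bar> \<le> 1"
proof -
  have "(z i)\<^sup>2 \<le> (\<Sum>i<d. (z i)\<^sup>2)"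
    using assms by (intro member_le_sum) auto
  then show ?thesis
    using assms by (simp add: unit_sphere_def abs_square_le_1)
qed

lemma ip_measurable_uniform_sphere [measurable]:
  "(\<lambda>z. ip d x z) \<in> borel_measurable (uniform_sphere d)"
  using ip_measurable[of d x] by (simp add: measurable_def space_uniform_sphere space_PiM_lborel)

lemma coord_measurable_uniform_sphere:
  "i < d \<Longrightarrow> (\<lambda>z. z i) \<in> borel_measurable (uniform_sphere d)"
  using measurable_component_singleton[of i "{..<d}" "\<lambda>_. lborel :: real measure"]
  by (simp add: measurable_def space_uniform_sphere space_PiM_lborel)

text \<open>The threshold makes the bound 2 b sqrt d of \<open>emeasure_slab_le\<close> equal to
  1/2.\<close>

lemma ip_lower_tail:
  assumes d: "d \<ge> 1" and v: "ip d v v = 1"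
  shows "emeasure (uniform_sphere d) {z \<in> space (uniform_sphere d). 1 / (4 * sqrt (real d)) < \<bar>ip d v z\<bar>} \<ge> ennreal (1/2)"
proof -
  interpret prob_space "uniform_sphere d"
    by (rule prob_space_uniform_sphere)
  let ?A = "{z \<in> space (uniform_sphere d). \<bar>ip d v z\<bar> \<le> 1 / (4 * sqrt (real d))}"
  let ?B = "{z \<in> space (uniform_sphere d). 1 / (4 * sqrt (real d)) < \<bar>ip d v z\<bar>}"
  have slab: "?A \<in> sets (uniform_sphere d)"
    by measurable
  have "emeasure (uniform_sphere d) ?A \<le> ennreal (2 * (1 / (4 * sqrt (real d))) * sqrt (real d))"
    using d v by (intro emeasure_slab_le) auto
  also have "2 * (1 / (4 * sqrt (real d))) * sqrt (real d) = 1/2"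
    using d by simp
  finally have A: "prob ?A \<le> 1/2"
    unfolding emeasure_eq_measure by (subst (asm) ennreal_le_iff) auto
  have "?B = space (uniform_sphere d) - ?A"
    by auto
  then have "prob ?B = 1 - prob ?A"
    using prob_compl[OF slab] by simp
  with A show ?thesis
    unfolding emeasure_eq_measure by (intro ennreal_leI) linarith
qed

lemma integrable_uniform_sphere_bounded:
  fixes f :: "vec \<Rightarrow> real"
  assumes "f \<in> borel_measurable (uniform_sphere d)" and "d \<ge> 1" and "\<And>z. z \<in> unit_sphere d \<Longrightarrow> \<bar>f z\<bar> \<le> B"
  shows "integrable (uniform_sphere d) f"
proof -
  interpret prob_space "uniform_sphere d"
    by (rule prob_space_uniform_sphere)
  show ?thesis
    using AE_uniform_sphere[OF assms(2)] assms(1,3) by (intro integrable_const_bound[of _ B]) auto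
qed

text \<open>Arithmetic-geometric mean inequality; with m = sqrt d it balances the second moment 1 /
  d against the constant term.\<close>

lemma abs_le_square_plus_inverse:
  fixes m x :: real
  assumes "m > 0"
  shows "\<bar>x\<bar> \<le> (m * x\<^sup>2 + 1 / m) / 2"
proof -
  have "0 \<le> (m * \<bar>x\<bar> - 1)\<^sup>2 / m"
    using assms by simp
  also have "\<dots> = m * x\<^sup>2 - 2 * \<bar>x\<bar> + 1 / m"
  proof -
    have "(m * \<bar>x\<bar> - 1)\<^sup>2 = m * (m * x\<^sup>2 - 2 * \<bar>x\<bar>) + 1"
      by (simp add: power2_diff power_mult_distrib power2_eq_square[of m] algebra_simps)
    then show ?thesis
      using assms by (simp add: add_divide_distrib)
  qed
  finally show ?thesis by simp
qed

text \<open>The lower bound is Markov's inequality at the threshold of \<open>ip_lower_tail\<close>,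
  the upper one comes from the second moment. In the first phase this integral is the length of the
  moment vector, so the bounds determine the range of norms there.\<close>

lemma integral_abs_ip:
  assumes d: "d \<ge> 1" and v: "ip d v v = 1"
  defines "a \<equiv> \<integral>z. \<bar>ip d v z\<bar> \<partial>uniform_sphere d"
  shows "1 / (8 * sqrt (real d)) \<le> a" "a \<le> 1 / sqrt (real d)"
proof -
  interpret prob_space "uniform_sphere d"
    by (rule prob_space_uniform_sphere)
  let ?m = "sqrt (real d)"
  have m: "?m > 0" "?m * ?m = d" using d by auto
  have int: "integrable (uniform_sphere d) (\<lambda>z. \<bar>ip d v z\<bar>)"
    using abs_ip_le_1[of _ d v] v by (intro integrable_uniform_sphere_bounded[OF _ d, of _ 1]) auto
  have a: "ennreal a = (\<integral>\<^sup>+z. ennreal \<bar>ip d v z\<bar> \<partial>uniform_sphere d)"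
    unfolding a_def by (intro nn_integral_eq_integral[symmetric] int) simp
  let ?B = "{z \<in> space (uniform_sphere d). 1 / (4 * ?m) < \<bar>ip d v z\<bar>}"
  have B: "?B \<in> sets (uniform_sphere d)"
    by measurable
  have "ennreal (1 / (8 * ?m)) = ennreal (1 / (4 * ?m)) * ennreal (1/2)"
    by (subst ennreal_mult[symmetric]) auto
  also have "\<dots> \<le> ennreal (1 / (4 * ?m)) * emeasure (uniform_sphere d) ?B"
    using ip_lower_tail[OF d v] by (intro mult_left_mono) auto
  also have "\<dots> = (\<integral>\<^sup>+z. ennreal (1 / (4 * ?m)) * indicator ?B z \<partial>uniform_sphere d)"
    by (rule nn_integral_cmult_indicator[OF B, symmetric])
  also have "\<dots> \<le> (\<integral>\<^sup>+z. ennreal \<bar>ip d v z\<bar> \<partial>uniform_sphere d)"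
    by (intro nn_integral_mono) (auto simp: indicator_def intro!: ennreal_leI)
  finally have "ennreal (1 / (8 * ?m)) \<le> ennreal a"
    by (simp only: a)
  then show "1 / (8 * ?m) \<le> a"
    by (subst (asm) ennreal_le_iff) (auto simp: a_def)
  have int2: "integrable (uniform_sphere d) (\<lambda>z. (ip d v z)\<^sup>2)"
    using abs_ip_le_1[of _ d v] v
    by (intro integrable_uniform_sphere_bounded[OF _ d, of _ 1]) (auto simp: abs_square_le_1)
  have "ennreal (\<integral>z. (ip d v z)\<^sup>2 \<partial>uniform_sphere d) = ennreal (1 / d)"
    using nn_integral_ip_square[OF d v] nn_integral_eq_integral[OF int2] by simp
  then have sq: "(\<integral>z. (ip d v z)\<^sup>2 \<partial>uniform_sphere d) = 1 / d"
    by (subst (asm) ennreal_inj) auto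
  have "a \<le> (\<integral>z. (?m * (ip d v z)\<^sup>2 + 1 / ?m) / 2 \<partial>uniform_sphere d)"
    unfolding a_def
  proof (rule integral_mono[OF int])
    show "integrable (uniform_sphere d) (\<lambda>z. (?m * (ip d v z)\<^sup>2 + 1 / ?m) / 2)"
      using int2 by auto
    fix z
    show "\<bar>ip d v z\<bar> \<le> (?m * (ip d v z)\<^sup>2 + 1 / ?m) / 2"
      using abs_le_square_plus_inverse[OF m(1)] .
  qed
  also have "\<dots> = (?m * (1 / d) + 1 / ?m) / 2"
    using int2 by (simp add: sq prob_space)
  also have "\<dots> = 1 / ?m"
    using m d by (simp add: field_simps)
  finally show "a \<le> 1 / ?m" .
qed

text \<open>\<open>F\<close> averages label times \<open>b\<close> over a point and its mirror image
  with \<open>a\<close> negated. The two arguments of \<open>sign_pm\<close> add up to 2 s b, so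
  they cannot both have the sign opposite to that of \<open>b\<close>. If |a| is small compared with
  s times the radius, then c |a| < s |b| and both labels agree with the sign of
  \<open>b\<close>.\<close>

lemma halfspace_signal_pointwise:
  assumes s: "0 < s" "s \<le> 1" and c: "0 \<le> c" "c \<le> 1"
  defines "F \<equiv> \<lambda>a b. (sign_pm (c * a + s * b) + sign_pm (s * b - c * a)) * b / 2"
  shows "0 \<le> F a b" "F a b \<le> \<bar>b\<bar>" "\<bar>a\<bar> \<le> s * sqrt (a\<^sup>2 + b\<^sup>2) / 2 \<Longrightarrow> F a b = \<bar>b\<bar>"
proof -
  show "0 \<le> F a b"
  proof (cases "b \<ge> 0")
    case True
    then have "s * b \<ge> 0" using s by simp
    then show ?thesis
      using True by (auto simp: F_def sign_pm_def)
  next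
    case False
    then have "s * b < 0" using s by (simp add: mult_pos_neg)
    then show ?thesis
      using False by (auto simp: F_def sign_pm_def)
  qed
  show "F a b \<le> \<bar>b\<bar>"
    by (auto simp: F_def sign_pm_def)
  assume h: "\<bar>a\<bar> \<le> s * sqrt (a\<^sup>2 + b\<^sup>2) / 2"
  show "F a b = \<bar>b\<bar>"
  proof (cases "b = 0")
    case False
    have "a\<^sup>2 \<le> (s * sqrt (a\<^sup>2 + b\<^sup>2) / 2)\<^sup>2"
      using power_mono[OF h, of 2] by simp
    also have "\<dots> = s\<^sup>2 * (a\<^sup>2 + b\<^sup>2) / 4"
      by (simp add: power_divide power_mult_distrib)
    finally have 1: "4 * a\<^sup>2 \<le> s\<^sup>2 * a\<^sup>2 + s\<^sup>2 * b\<^sup>2"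
      by (simp add: algebra_simps)
    have "s\<^sup>2 * a\<^sup>2 \<le> a\<^sup>2" "c\<^sup>2 * a\<^sup>2 \<le> a\<^sup>2"
      using s c by (simp_all add: mult_left_le_one_le power_le_one)
    moreover have "0 < s\<^sup>2 * b\<^sup>2"
      using s False by simp
    ultimately have "(c * a)\<^sup>2 < (s * b)\<^sup>2"
      using 1 by (simp add: power_mult_distrib)
    then have "\<bar>c * a\<bar>\<^sup>2 < \<bar>s * b\<bar>\<^sup>2"
      by simp
    then have "\<bar>c * a\<bar> < \<bar>s * b\<bar>"
      by (rule power2_less_imp_less) simp
    then have lt: "c * a < \<bar>s * b\<bar>" "- (c * a) < \<bar>s * b\<bar>"
      by (auto simp: abs_less_iff)
    show ?thesis
    proof (cases "b > 0")
      case True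
      then have "0 < s * b" using s by simp
      then have "0 \<le> c * a + s * b" "0 \<le> s * b - c * a"
        using lt by linarith+
      then show ?thesis
        using True by (simp add: F_def sign_pm_def)
    next
      case nb: False
      then have "s * b < 0" using s False by (simp add: mult_pos_neg)
      then have "\<not> 0 \<le> c * a + s * b" "\<not> 0 \<le> s * b - c * a"
        using lt by linarith+
      then show ?thesis
        using nb by (simp add: F_def sign_pm_def)
    qed
  qed (simp add: F_def)
qed

text \<open>Both bounds replace the integrand by |ip d u z| on a set |ip d p z| <= h, which
  \<open>nn_integral_planar\<close> evaluates. From above, h is the minimum of b and the radius R.
  From below it is the minimum of b and s R / 2, where both mirror labels are right; with
  probability at least 1/2 the radius exceeds 1 / (4 sqrt d), and then this minimum is b.\<close>

lemma halfspace_signal: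
  assumes d: "d \<ge> 1" and p: "ip d p p = 1" and u: "ip d u u = 1" and pu: "ip d p u = 0"
    and s: "0 < s" "s \<le> 1" and c: "0 \<le> c" "c \<le> 1" and b: "0 \<le> b"
  defines "A \<equiv> \<integral>z. (if \<bar>ip d p z\<bar> \<le> b then sign_pm (c * ip d p z + s * ip d u z) * ip d u z else 0) \<partial>uniform_sphere d"
  shows "0 \<le> A" "A \<le> 2 / pi * b" "8 * b * sqrt (real d) \<le> s \<Longrightarrow> b / pi \<le> A"
proof -
  interpret prob_space "uniform_sphere d"
    by (rule prob_space_uniform_sphere)
  let ?F = "\<lambda>a b'. (sign_pm (c * a + s * b') + sign_pm (s * b' - c * a)) * b' / 2"
  let ?G = "\<lambda>z. if \<bar>ip d p z\<bar> \<le> b then ?F (ip d p z) (ip d u z) else 0"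
  let ?R = "\<lambda>z. sqrt ((ip d p z)\<^sup>2 + (ip d u z)\<^sup>2)"
  note pt = halfspace_signal_pointwise[OF s c]
  have R: "\<bar>ip d p z\<bar> \<le> ?R z" for z
    by (rule real_le_rsqrt) simp
  have iu: "\<bar>ip d u z\<bar> \<le> 1" if "z \<in> unit_sphere d" for z
    using abs_ip_le_1[OF that] u by simp
  let ?f1 = "\<lambda>z. if \<bar>ip d p z\<bar> \<le> b then sign_pm (c * ip d p z + s * ip d u z) * ip d u z else 0"
  let ?f2 = "\<lambda>z. if \<bar>ip d p z\<bar> \<le> b then sign_pm (s * ip d u z - c * ip d p z) * ip d u z else 0"
  have i1: "integrable (uniform_sphere d) ?f1" and i2: "integrable (uniform_sphere d) ?f2"
    using iu by (auto intro!: integrable_uniform_sphere_bounded[OF _ d, of _ 1] simp: abs_mult)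
  \<comment> \<open>The reflection along \<open>p\<close> negates \<open>ip d p z\<close> and fixes
    \<open>ip d u z\<close>, so \<open>?f1\<close> and its mirror image \<open>?f2\<close> have the
    same integral and can be averaged.\<close>
  have "(\<integral>z. ?f2 z \<partial>uniform_sphere d) = (\<integral>z. ?f1 (reflect d p z) \<partial>uniform_sphere d)"
    by (intro Bochner_Integration.integral_cong) (simp_all add: ip_reflect p pu ip_commute[of d u p])
  also have "\<dots> = A"
    unfolding A_def by (rule integral_uniform_sphere_reflect[OF p]) measurable
  finally have A2: "A = (\<integral>z. ?f2 z \<partial>uniform_sphere d)" ..
  have "(\<integral>z. ?G z \<partial>uniform_sphere d) = (\<integral>z. ?f1 z / 2 + ?f2 z / 2 \<partial>uniform_sphere d)"
    by (intro Bochner_Integration.integral_cong) (auto simp: algebra_simps add_divide_distrib)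
  also have "\<dots> = A"
    using i1 i2 A2 by (simp add: A_def[symmetric])
  finally have AG: "A = (\<integral>z. ?G z \<partial>uniform_sphere d)" ..
  have G0: "0 \<le> ?G z" for z
    using pt(1) by auto
  show "0 \<le> A"
    unfolding AG using G0 by (intro Bochner_Integration.integral_nonneg) auto
  have "\<bar>?G z\<bar> \<le> 1" if "z \<in> unit_sphere d" for z
    using pt(1)[of "ip d p z" "ip d u z"] pt(2)[of "ip d p z" "ip d u z"] iu[OF that] by auto
  then have iG: "integrable (uniform_sphere d) ?G"
    by (intro integrable_uniform_sphere_bounded[OF _ d, of _ 1]) auto
  have Ann: "ennreal A = (\<integral>\<^sup>+z. ennreal (?G z) \<partial>uniform_sphere d)"
    unfolding AG using G0 by (intro nn_integral_eq_integral[symmetric] iG) auto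
  have "ennreal A \<le> (\<integral>\<^sup>+z. ennreal (1 * (if \<bar>ip d p z\<bar> \<le> min b (?R z) then \<bar>ip d u z\<bar> else 0)) \<partial>uniform_sphere d)"
    unfolding Ann using R pt(2) by (intro nn_integral_mono ennreal_leI) auto
  also have "\<dots> = (\<integral>\<^sup>+z. ennreal (2 / pi * 1 * min b (?R z)) \<partial>uniform_sphere d)"
    by (rule nn_integral_planar[OF p u pu, where \<Phi>="\<lambda>_. 1" and h="\<lambda>r. min b r"]) (use b in auto)
  also have "\<dots> \<le> (\<integral>\<^sup>+z. ennreal (2 / pi * b) \<partial>uniform_sphere d)"
    using b by (intro nn_integral_mono ennreal_leI mult_mono) auto
  also have "\<dots> = ennreal (2 / pi * b)"
    by (simp add: emeasure_space_1)
  finally show "A \<le> 2 / pi * b"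
    using b by (subst (asm) ennreal_le_iff) auto
  assume sb: "8 * b * sqrt (real d) \<le> s"
  let ?B = "{z \<in> space (uniform_sphere d). 1 / (4 * sqrt (real d)) < \<bar>ip d p z\<bar>}"
  have B: "?B \<in> sets (uniform_sphere d)"
    by measurable
  have "ennreal (b / pi) = ennreal (2 / pi * b) * ennreal (1/2)"
    using b by (subst ennreal_mult[symmetric]) auto
  also have "\<dots> \<le> ennreal (2 / pi * b) * emeasure (uniform_sphere d) ?B"
    using ip_lower_tail[OF d p] by (intro mult_left_mono) auto
  also have "\<dots> = (\<integral>\<^sup>+z. ennreal (2 / pi * b) * indicator ?B z \<partial>uniform_sphere d)"
    by (rule nn_integral_cmult_indicator[OF B, symmetric])
  also have "\<dots> \<le> (\<integral>\<^sup>+z. ennreal (2 / pi * 1 * min b (s * ?R z / 2)) \<partial>uniform_sphere d)"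
  proof (intro nn_integral_mono)
    fix z
    have "b \<le> s * ?R z / 2" if "1 / (4 * sqrt (real d)) < \<bar>ip d p z\<bar>"
    proof -
      have "b \<le> s / (8 * sqrt (real d))"
        using sb d by (subst pos_le_divide_eq) (auto simp: mult_ac)
      then have "b \<le> s * (1 / (4 * sqrt (real d))) / 2"
        by simp
      also have "\<dots> \<le> s * ?R z / 2"
        using order_trans[OF less_imp_le[OF that] R[of z]] s by (intro divide_right_mono mult_left_mono) auto
      finally show ?thesis .
    qed
    then show "ennreal (2 / pi * b) * indicator ?B z \<le> ennreal (2 / pi * 1 * min b (s * ?R z / 2))"
      by (auto simp: indicator_def)
  qed
  also have "\<dots> = (\<integral>\<^sup>+z. ennreal (1 * (if \<bar>ip d p z\<bar> \<le> min b (s * ?R z / 2) then \<bar>ip d u z\<bar> else 0)) \<partial>uniform_sphere d)"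
  proof (rule nn_integral_planar[OF p u pu, where \<Phi>="\<lambda>_. 1" and h="\<lambda>r. min b (s * r / 2)", symmetric])
    fix r :: real assume "r \<ge> 0"
    moreover have "s * r \<le> r" using s \<open>r \<ge> 0\<close> by (simp add: mult_left_le_one_le)
    ultimately show "0 \<le> min b (s * r / 2) \<and> min b (s * r / 2) \<le> r"
      using b s by auto
  qed auto
  also have "\<dots> \<le> ennreal A"
    unfolding Ann
  proof (intro nn_integral_mono ennreal_leI)
    fix z
    show "1 * (if \<bar>ip d p z\<bar> \<le> min b (s * ?R z / 2) then \<bar>ip d u z\<bar> else 0) \<le> ?G z"
      using G0[of z] pt(3)[of "ip d p z" "ip d u z"] by (cases "\<bar>ip d p z\<bar> \<le> min b (s * ?R z / 2)") (simp_all only: min_le_iff_disj min.bounded_iff if_True if_False mult_1 order_refl, simp_all)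
  qed
  finally show "b / pi \<le> A"
    using \<open>0 \<le> A\<close> by (subst (asm) ennreal_le_iff) auto
qed

text \<open>The integrand is odd under the reflection along \<open>q\<close>.\<close>

lemma integral_orthogonal_eq_0:
  fixes f :: "vec \<Rightarrow> real"
  assumes f: "f \<in> borel_measurable (coords d)"
    and inv: "\<And>z. ip d q q = 1 \<Longrightarrow> f (reflect d q z) = f z" and q: "ip d q q = 1"
  shows "(\<integral>z. f z * ip d q z \<partial>uniform_sphere d) = 0"
proof -
  have "(\<integral>z. f z * ip d q z \<partial>uniform_sphere d) = (\<integral>z. f (reflect d q z) * ip d q (reflect d q z) \<partial>uniform_sphere d)"
    by (intro integral_uniform_sphere_reflect[OF q, symmetric] borel_measurable_times f ip_measurable)
  also have "\<dots> = - (\<integral>z. f z * ip d q z \<partial>uniform_sphere d)"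
    by (simp add: inv q ip_reflect)
  finally show ?thesis by simp
qed

lemma ip_integral:
  fixes f :: "vec \<Rightarrow> real"
  assumes f: "f \<in> borel_measurable (uniform_sphere d)" and f1: "\<And>z. \<bar>f z\<bar> \<le> 1" and d: "d \<ge> 1"
  shows "ip d q (\<lambda>i. \<integral>z. f z * z i \<partial>uniform_sphere d) = (\<integral>z. f z * ip d q z \<partial>uniform_sphere d)"
proof -
  have int: "integrable (uniform_sphere d) (\<lambda>z. f z * z i)" if "i < d" for i
    using abs_coord_le_1[OF _ that] f coord_measurable_uniform_sphere[OF that] f1
    by (intro integrable_uniform_sphere_bounded[OF _ d, of _ 1]) (auto simp: abs_mult intro!: mult_le_one)
  have "ip d q (\<lambda>i. \<integral>z. f z * z i \<partial>uniform_sphere d) = (\<Sum>i<d. \<integral>z. q i * (f z * z i) \<partial>uniform_sphere d)"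
    by (simp add: ip_def)
  also have "\<dots> = (\<integral>z. (\<Sum>i<d. q i * (f z * z i)) \<partial>uniform_sphere d)"
    using int by (intro Bochner_Integration.integral_sum[symmetric]) auto
  finally show ?thesis
    by (simp add: ip_def sum_distrib_left algebra_simps)
qed

text \<open>A weight that depends only on the inner products with \<open>v\<close> and
  \<open>w\<close> is fixed by every reflection along a direction orthogonal to both. So the
  weighted mean of the point lies in the span of \<open>v\<close> and \<open>w\<close>.\<close>

lemma ip_moment_orthogonal:
  fixes g :: "real \<Rightarrow> real \<Rightarrow> real"
  assumes g: "case_prod g \<in> borel_measurable (borel \<Otimes>\<^sub>M borel)" and g1: "\<And>x y. \<bar>g x y\<bar> \<le> 1" and d: "d \<ge> 1"
    and q: "ip d q v = 0" "ip d q w = 0"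
  shows "ip d q (\<lambda>i. \<integral>z. g (ip d v z) (ip d w z) * z i \<partial>uniform_sphere d) = 0"
proof (cases "ip d q q = 0")
  case True
  then show ?thesis by (rule ip_self_eq_0_left)
next
  case False
  define m where "m = sqrt (ip d q q)"
  have m: "m > 0" "m * m = ip d q q"
    using False ip_self_nonneg[of d q] by (auto simp: m_def)
  let ?q = "\<lambda>i. q i / m"
  have q1: "ip d ?q ?q = 1"
    using m by (simp only: ip_divide_left ip_divide_right) (simp flip: m(2))
  have orth: "ip d v ?q = 0" "ip d w ?q = 0"
    using q by (simp_all add: ip_linear ip_commute[of d _ q])
  have gm: "(\<lambda>z. g (ip d v z) (ip d w z)) \<in> borel_measurable (coords d)"
    using measurable_compose[OF _ g, of "\<lambda>z. (ip d v z, ip d w z)"] by simp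
  have "(\<lambda>z. g (ip d v z) (ip d w z)) \<in> borel_measurable (uniform_sphere d)"
    using gm by (simp add: measurable_def space_uniform_sphere space_PiM_lborel)
  from ip_integral[OF this g1 d, of ?q]
  have "ip d ?q (\<lambda>i. \<integral>z. g (ip d v z) (ip d w z) * z i \<partial>uniform_sphere d) =
      (\<integral>z. g (ip d v z) (ip d w z) * ip d ?q z \<partial>uniform_sphere d)" .
  also have "\<dots> = 0"
    using integral_orthogonal_eq_0[OF gm _ q1] by (simp add: ip_reflect orth)
  finally show ?thesis
    using m by (simp add: ip_linear)
qed

section \<open>Correcting the direction\<close>

definition vnorm :: "nat \<Rightarrow> vec \<Rightarrow> real" where
  "vnorm d x = sqrt (ip d x x)"

definition perp :: "nat \<Rightarrow> vec \<Rightarrow> vec \<Rightarrow> vec" where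
  "perp d w x = (\<lambda>i. x i - ip d x w * w i)"

text \<open>For a unit vector \<open>w\<close> the last condition bounds the sine of the angle
  between \<open>v\<close> and \<open>w\<close> by sigma, without a root or a division;
  \<open>0 < ip d v w\<close> keeps that angle acute. The norm is only required to be near 1, as the
  program cannot normalize exactly.\<close>

definition good :: "nat \<Rightarrow> vec \<Rightarrow> real \<Rightarrow> vec \<Rightarrow> bool" where
  "good d w \<sigma> v \<longleftrightarrow> 9/10 \<le> ip d v v \<and> ip d v v \<le> 1 \<and> 0 < ip d v w \<and>
     ip d v v - (ip d v w)\<^sup>2 \<le> \<sigma>\<^sup>2 * ip d v v"

text \<open>A scaling towards norm 1 that needs no square root: one Newton step for the inverse of the norm.\<close>

definition newton :: "nat \<Rightarrow> vec \<Rightarrow> vec" where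
  "newton d v = (\<lambda>i. 2 * v i / (1 + ip d v v))"

section \<open>Norms, components orthogonal to the target, and rescaling\<close>

lemma vnorm_nonneg: "0 \<le> vnorm d x"
  by (simp add: vnorm_def ip_self_nonneg)

lemma vnorm_square: "(vnorm d x)\<^sup>2 = ip d x x"
  by (simp add: vnorm_def ip_self_nonneg)

lemma vnorm_L2_set: "vnorm d x = L2_set x {..<d}"
  by (simp add: vnorm_def L2_set_def ip_self_conv)

lemma vnorm_triangle: "vnorm d (\<lambda>i. x i + y i) \<le> vnorm d x + vnorm d y"
  unfolding vnorm_L2_set by (rule L2_set_triangle_ineq)

lemma vnorm_scale: "vnorm d (\<lambda>i. c * x i) = \<bar>c\<bar> * vnorm d x"
  by (simp add: vnorm_def ip_linear real_sqrt_mult[symmetric] real_sqrt_abs2 flip: mult.assoc)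
     (simp add: real_sqrt_mult)

lemma abs_ip_le_vnorm: "\<bar>ip d x y\<bar> \<le> vnorm d x * vnorm d y"
proof -
  have "\<bar>ip d x y\<bar>\<^sup>2 \<le> (vnorm d x * vnorm d y)\<^sup>2"
    using ip_Cauchy_Schwarz[of d x y] by (simp add: power_mult_distrib vnorm_square)
  then show ?thesis
    by (rule power2_le_imp_le) (simp add: vnorm_nonneg)
qed

lemma ip_self_scale_add:
  "ip d (\<lambda>i. c * x i + y i) (\<lambda>i. c * x i + y i) = c\<^sup>2 * ip d x x + 2 * c * ip d x y + ip d y y"
  by (simp add: ip_linear ip_commute[of d y x] power2_eq_square algebra_simps)

lemma ip_perp: "ip d w w = 1 \<Longrightarrow> ip d (perp d w x) (perp d w x) = ip d x x - (ip d x w)\<^sup>2"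
  by (simp add: perp_def ip_linear ip_commute[of d w x] power2_eq_square)

lemma vnorm_perp_le: "ip d w w = 1 \<Longrightarrow> vnorm d (perp d w x) \<le> vnorm d x"
  unfolding vnorm_def by (rule real_sqrt_le_mono) (simp add: ip_perp)

lemma perp_add: "perp d w (\<lambda>i. x i + y i) = (\<lambda>i. perp d w x i + perp d w y i)"
  by (simp add: perp_def ip_linear algebra_simps)

lemma perp_scale_self: "ip d w w = 1 \<Longrightarrow> perp d w (\<lambda>i. c * w i) = (\<lambda>i. 0)"
  by (simp add: perp_def ip_linear)

lemma square_gap_le:
  assumes "ip d w w = 1" "vnorm d (perp d w x) \<le> a * vnorm d x"
  shows "ip d x x - (ip d x w)\<^sup>2 \<le> a\<^sup>2 * ip d x x"
proof -
  have "(vnorm d (perp d w x))\<^sup>2 \<le> (a * vnorm d x)\<^sup>2"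
    using assms(2) vnorm_nonneg by (intro power_mono)
  then show ?thesis
    by (simp add: power_mult_distrib vnorm_square ip_perp[OF assms(1)])
qed

text \<open>The squared norm n becomes 4 n / (1 + n)^2. This function is at most 1, invariant under
  n -> 1 / n and increasing up to n = 1, so on [l, 1 / l] it is at least its value at l. The angle
  to \<open>w\<close> does not change under scaling.\<close>

lemma newton_step:
  assumes l: "0 < l" "l \<le> ip d v v" "l * ip d v v \<le> 1" and w: "0 < ip d v w"
    and gap: "ip d v v - (ip d v w)\<^sup>2 \<le> s * ip d v v"
  shows "4 * l / (1 + l)\<^sup>2 \<le> ip d (newton d v) (newton d v)" "ip d (newton d v) (newton d v) \<le> 1"
    "0 < ip d (newton d v) w"
    "ip d (newton d v) (newton d v) - (ip d (newton d v) w)\<^sup>2 \<le> s * ip d (newton d v) (newton d v)"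
proof -
  define n where "n = ip d v v"
  have n: "n > 0" using l by (simp add: n_def)
  have nv: "newton d v = (\<lambda>i. (2 / (1 + n)) * v i)"
    by (simp add: newton_def n_def)
  have nn: "ip d (newton d v) (newton d v) = 4 * n / (1 + n)\<^sup>2"
    by (simp add: nv ip_linear n_def[symmetric] power2_eq_square)
  have nw: "ip d (newton d v) w = 2 / (1 + n) * ip d v w"
    by (simp add: nv ip_linear)
  have "0 \<le> (n - l) * (1 - l * n)"
    using l by (intro mult_nonneg_nonneg) (auto simp: n_def)
  then have "l * (1 + n)\<^sup>2 \<le> n * (1 + l)\<^sup>2"
    by (simp add: power2_eq_square algebra_simps)
  then show "4 * l / (1 + l)\<^sup>2 \<le> ip d (newton d v) (newton d v)"
    using l n by (simp add: nn divide_simps mult_ac)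
  have "0 \<le> (1 - n)\<^sup>2" by simp
  then have "4 * n \<le> (1 + n)\<^sup>2"
    by (simp add: power2_eq_square algebra_simps)
  then show "ip d (newton d v) (newton d v) \<le> 1"
    using n by (simp add: nn)
  show "0 < ip d (newton d v) w"
    using n w by (simp add: nw)
  have "(4 / (1 + n)\<^sup>2) * (n - (ip d v w)\<^sup>2) \<le> (4 / (1 + n)\<^sup>2) * (s * n)"
    using gap by (intro mult_left_mono) (simp_all add: n_def)
  then show "ip d (newton d v) (newton d v) - (ip d (newton d v) w)\<^sup>2 \<le> s * ip d (newton d v) (newton d v)"
    by (simp add: nn nw power_mult_distrib power_divide right_diff_distrib diff_divide_distrib mult_ac)
qed

lemma newton_good:
  assumes n: "1/500 \<le> ip d v v" "ip d v v \<le> 500" and w: "0 < ip d v w"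
    and gap: "ip d v v - (ip d v w)\<^sup>2 \<le> \<sigma>\<^sup>2 * ip d v v"
  shows "good d w \<sigma> ((newton d ^^ 8) v)"
proof -
  define Q where "Q l v \<longleftrightarrow> l \<le> ip d v v \<and> ip d v v \<le> 1 \<and> 0 < ip d v w \<and>
    ip d v v - (ip d v w)\<^sup>2 \<le> \<sigma>\<^sup>2 * ip d v v" for l v
  have step: "Q l' (newton d v)" if "Q l v" "0 < l" "l \<le> 1" "l' \<le> 4 * l / (1 + l)\<^sup>2" for l l' v
  proof -
    have "l * ip d v v \<le> 1"
      using that by (intro mult_le_one) (auto simp: Q_def ip_self_nonneg)
    with newton_step[of l d v w "\<sigma>\<^sup>2"] that(1,2)
    have "4 * l / (1 + l)\<^sup>2 \<le> ip d (newton d v) (newton d v)" "Q (4 * l / (1 + l)\<^sup>2) (newton d v)"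
      by (simp_all add: Q_def)
    with that(4) show ?thesis
      unfolding Q_def by linarith
  qed
  \<comment> \<open>This first step may start with norm above 1, so it uses
    \<open>newton_step\<close> on the symmetric range from 1/500 to 500. From here on the norm is at
    most 1, and the bounds in the chain are successive values of 4 l / (1 + l)^2 rounded
    down.\<close>
  have "Q (1/130) (newton d v)"
    using newton_step[of "1/500" d v w "\<sigma>\<^sup>2"] assms by (auto simp: Q_def power2_eq_square)
  then have "Q (1/34) (newton d (newton d v))"
    by (rule step) (auto simp: power2_eq_square)
  then have "Q (1/10) (newton d (newton d (newton d v)))"
    by (rule step) (auto simp: power2_eq_square)
  then have "Q (1/4) (newton d (newton d (newton d (newton d v))))"
    by (rule step) (auto simp: power2_eq_square)
  then have "Q (3/5) (newton d (newton d (newton d (newton d (newton d v)))))"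
    by (rule step) (auto simp: power2_eq_square)
  then have "Q (9/10) (newton d (newton d (newton d (newton d (newton d (newton d v))))))"
    by (rule step) (auto simp: power2_eq_square)
  then have "Q (9/10) (newton d (newton d (newton d (newton d (newton d (newton d (newton d v)))))))"
    by (rule step) (auto simp: power2_eq_square)
  then have "Q (9/10) (newton d (newton d (newton d (newton d (newton d (newton d (newton d (newton d v))))))))"
    by (rule step) (auto simp: power2_eq_square)
  then show ?thesis
    by (simp add: Q_def good_def numeral_eq_Suc)
qed

text \<open>The part of \<open>v\<close> orthogonal to \<open>w\<close> has norm at most 1/40 while
  \<open>v\<close> has norm at least 6/5, so the angle is far smaller than demanded. The norm is at
  most 21, whose square 441 explains the range up to 500 in \<open>newton_good\<close>.\<close>

lemma initial_direction:
  assumes w: "ip d w w = 1" and \<kappa>: "5/4 \<le> \<kappa>" "\<kappa> \<le> 20" and e: "vnorm d e \<le> 1/40"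
  defines "v \<equiv> \<lambda>i. \<kappa> * w i + e i"
  shows "good d w (15/16 * (1/2)) ((newton d ^^ 8) v)"
proof (rule newton_good)
  have nw: "vnorm d w = 1"
    using w by (simp add: vnorm_def)
  have ew: "\<bar>ip d e w\<bar> \<le> 1/40"
    using abs_ip_le_vnorm[of d e w] e nw by simp
  have vw: "ip d v w = \<kappa> + ip d e w"
    using w by (simp add: v_def ip_linear)
  then show "0 < ip d v w"
    using ew \<kappa> by linarith
  have "ip d v w \<le> vnorm d v"
    using abs_ip_le_vnorm[of d v w] nw by simp
  then have low: "6/5 \<le> vnorm d v"
    using vw ew \<kappa> by linarith
  have "vnorm d v \<le> \<bar>\<kappa>\<bar> * vnorm d w + vnorm d e"
    unfolding v_def using vnorm_triangle[of d "\<lambda>i. \<kappa> * w i" e] by (simp add: vnorm_scale)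
  then have up: "vnorm d v \<le> 21"
    using nw \<kappa> e by simp
  show "1/500 \<le> ip d v v" "ip d v v \<le> 500"
    using power_mono[OF low, of 2, unfolded vnorm_square] power_mono[OF up vnorm_nonneg, of 2, unfolded vnorm_square]
    by (simp_all add: power2_eq_square)
  have "perp d w v = (\<lambda>i. perp d w e i)"
    using w by (simp add: v_def perp_add perp_scale_self)
  then have "vnorm d (perp d w v) \<le> 1/40"
    using vnorm_perp_le[OF w, of e] e by simp
  also have "\<dots> \<le> 15/16 * (1/2) * vnorm d v"
    using low by simp
  finally show "ip d v v - (ip d v w)\<^sup>2 \<le> (15/16 * (1/2))\<^sup>2 * ip d v v"
    by (rule square_gap_le[OF w])
qed

text \<open>If s >= sigma/2, the turn removes at least about 0.13 sigma and, being at most sigma/3,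
  does not overshoot. If s < sigma/2, the signed remainder lies between -sigma/3 and sigma/2. In
  both cases there is room for the error sigma/20 below 15/16 sigma nu.\<close>

lemma rotation_progress:
  fixes \<sigma> \<nu> c s \<alpha> :: real
  assumes \<sigma>: "0 < \<sigma>" "\<sigma> \<le> 1/2" and \<nu>: "0 < \<nu>" "9/10 \<le> \<nu>\<^sup>2" "\<nu>\<^sup>2 \<le> 1" and c: "0 < c" and s: "0 \<le> s" "s \<le> \<sigma>"
    and cs: "c\<^sup>2 + s\<^sup>2 = 1" and \<alpha>: "0 \<le> \<alpha>" "\<alpha> \<le> \<sigma> / pi" "\<sigma> / 2 \<le> s \<Longrightarrow> \<sigma> / (2 * pi) \<le> \<alpha>"
  shows "\<bar>\<nu> * s - \<alpha> * c\<bar> + \<sigma> / 20 \<le> 15/16 * \<sigma> * \<nu>"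
proof -
  have "c\<^sup>2 \<le> 1"
    using cs zero_le_power2[of s] by linarith
  moreover have "s\<^sup>2 \<le> (1/2)\<^sup>2"
    using s \<sigma> by (intro power_mono) auto
  ultimately have s2: "s\<^sup>2 \<le> (1/2)\<^sup>2" "c\<^sup>2 \<le> 1"
    by auto
  \<comment> \<open>Rounded down: c >= sqrt (3/4) because s <= 1/2, and below nu >= sqrt
    (9/10).\<close>
  have c2: "86/100 \<le> c" "c \<le> 1"
    using cs c s2 power2_le_imp_le[of "86/100" c] power2_le_imp_le[of c 1] by (simp_all add: power_divide)
  have \<nu>2: "94/100 \<le> \<nu>" "\<nu> \<le> 1"
    using \<nu> power2_le_imp_le[of "94/100" \<nu>] power2_le_imp_le[of \<nu> 1] by (simp_all add: power_divide)
  have "\<sigma> / pi \<le> \<sigma> / 3"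
    using \<sigma> pi_approx(1) by (intro divide_left_mono) auto
  then have \<alpha>3: "\<alpha> \<le> \<sigma> / 3"
    using \<alpha>(2) by linarith
  have \<alpha>c: "\<alpha> * c \<le> \<sigma> / 3"
    using mult_mono[OF \<alpha>3 c2(2)] \<alpha>(1) c \<sigma> by simp
  have \<nu>\<sigma>: "94/100 * \<sigma> \<le> \<nu> * \<sigma>" "\<nu> * \<sigma> \<le> \<sigma>"
    using \<nu>2 \<sigma> by auto
  show ?thesis
  proof (cases "\<sigma> / 2 \<le> s")
    case True
    have "\<sigma> / (2 * (32/10)) \<le> \<sigma> / (2 * pi)"
      using \<sigma> pi_approx(2) by (intro divide_left_mono) auto
    then have "\<sigma> * (10 / 64) \<le> \<alpha>"
      using \<alpha>(3)[OF True] by simp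
    then have "(\<sigma> * (10 / 64)) * (86/100) \<le> \<alpha> * c"
      using c2 \<sigma> by (intro mult_mono) auto
    moreover have "\<nu> * s \<le> \<nu> * \<sigma>" "\<nu> * (\<sigma> / 2) \<le> \<nu> * s"
      using s \<nu> True by (auto intro: mult_left_mono)
    ultimately have "\<bar>\<nu> * s - \<alpha> * c\<bar> + \<sigma> / 20 \<le> 15/16 * (\<nu> * \<sigma>)"
      using \<alpha>c \<nu>\<sigma> \<sigma> by linarith
    then show ?thesis
      by (simp add: mult_ac)
  next
    case False
    then have "\<nu> * s \<le> \<nu> * (\<sigma> / 2)" "0 \<le> \<nu> * s"
      using s \<nu> by auto
    moreover have "0 \<le> \<alpha> * c"
      using \<alpha> c by simp
    ultimately have "\<bar>\<nu> * s - \<alpha> * c\<bar> + \<sigma> / 20 \<le> 15/16 * (\<nu> * \<sigma>)"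
      using \<alpha>c \<nu>\<sigma> \<sigma> by linarith
    then show ?thesis
      by (simp add: mult_ac)
  qed
qed

text \<open>Without \<open>e\<close>, the identity for (nu^2 + alpha^2) (c^2 + s^2) shows that the
  component orthogonal to \<open>w\<close> has norm at most |nu s - alpha c|, and \<open>e\<close>
  adds at most sigma/20. As \<open>u\<close> and \<open>e\<close> are orthogonal to
  \<open>p\<close>, the correction cannot shorten the vector below nu, so the bound of
  \<open>rotation_progress\<close> is one on the sine. The form \<open>ip d u u <= 1\<close> covers
  \<open>u = 0\<close>, when \<open>v\<close> is already parallel to \<open>w\<close>.\<close>

lemma corrected_direction:
  assumes w: "ip d w w = 1" and p: "ip d p p = 1" and u: "ip d u u \<le> 1" "ip d p u = 0"
    and pw: "ip d p w = c" and uw: "ip d u w = s"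
    and \<sigma>: "0 < \<sigma>" "\<sigma> \<le> 1/2" and \<nu>: "0 < \<nu>" "9/10 \<le> \<nu>\<^sup>2" "\<nu>\<^sup>2 \<le> 1" and c: "0 < c" and s: "0 \<le> s" "s \<le> \<sigma>"
    and cs: "c\<^sup>2 + s\<^sup>2 = 1" and \<alpha>: "0 \<le> \<alpha>" "\<alpha> \<le> \<sigma> / pi" "\<sigma> / 2 \<le> s \<Longrightarrow> \<sigma> / (2 * pi) \<le> \<alpha>"
    and e: "ip d p e = 0" "vnorm d e \<le> \<sigma> / 20"
  defines "v \<equiv> \<lambda>i. \<nu> * p i + (\<alpha> * u i + e i)"
  shows "good d w (15/16 * \<sigma>) ((newton d ^^ 8) v)"
proof (rule newton_good)
  let ?y = "\<lambda>i. \<alpha> * u i + e i" and ?x = "\<lambda>i. \<nu> * p i + \<alpha> * u i"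
  have "ip d p ?y = 0"
    using u e by (simp add: ip_linear)
  then have vv: "ip d v v = \<nu>\<^sup>2 + ip d ?y ?y"
    unfolding v_def ip_self_scale_add using p by simp
  have nu: "vnorm d u \<le> 1"
    unfolding vnorm_def using u by simp
  have \<sigma>pi: "\<sigma> / pi \<le> \<sigma> / 3"
    using \<sigma> pi_approx(1) by (intro divide_left_mono) auto
  have "vnorm d ?y \<le> \<alpha> * vnorm d u + vnorm d e"
    using vnorm_triangle[of d "\<lambda>i. \<alpha> * u i" e] \<alpha> by (simp add: vnorm_scale)
  also have "\<dots> \<le> (1/6) * 1 + 1/40"
    using nu \<alpha> \<sigma> \<sigma>pi e by (intro add_mono mult_mono) (auto simp: vnorm_nonneg)
  finally have "(vnorm d ?y)\<^sup>2 \<le> 1\<^sup>2"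
    by (intro power_mono) (auto simp: vnorm_nonneg)
  then have yy: "ip d ?y ?y \<le> 1"
    by (simp only: vnorm_square) simp
  show "1/500 \<le> ip d v v" "ip d v v \<le> 500"
    using vv yy ip_self_nonneg[of d ?y] \<nu> by linarith+
  have \<nu>v: "\<nu> \<le> vnorm d v"
    using vv ip_self_nonneg[of d ?y] \<nu> unfolding vnorm_def by (intro real_le_rsqrt) linarith
  have nw: "vnorm d w = 1"
    using w by (simp add: vnorm_def)
  have ew: "\<bar>ip d e w\<bar> \<le> \<sigma> / 20"
    using abs_ip_le_vnorm[of d e w] e nw by simp
  have vw: "ip d v w = \<nu> * c + \<alpha> * s + ip d e w"
    by (simp add: v_def ip_linear pw uw)
  have "s\<^sup>2 \<le> (1/2)\<^sup>2"
    using s \<sigma> by (intro power_mono) auto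
  then have "86/100 \<le> c"
    using cs c power2_le_imp_le[of "86/100" c] by (simp add: power_divide)
  moreover have "94/100 \<le> \<nu>"
    using \<nu> power2_le_imp_le[of "94/100" \<nu>] by (simp add: power_divide)
  ultimately have "(94/100) * (86/100) \<le> \<nu> * c"
    by (intro mult_mono) auto
  moreover have "0 \<le> \<alpha> * s"
    using \<alpha> s by simp
  ultimately show "0 < ip d v w"
    using vw ew \<sigma> by linarith
  have "ip d ?x ?x - (ip d ?x w)\<^sup>2 \<le> (\<nu> * s - \<alpha> * c)\<^sup>2"
  proof -
    have "ip d ?x ?x = \<nu>\<^sup>2 + \<alpha>\<^sup>2 * ip d u u"
      using p u by (simp add: ip_linear ip_commute[of d u p] power2_eq_square)
    also have "\<dots> \<le> \<nu>\<^sup>2 + \<alpha>\<^sup>2"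
      using u mult_left_mono[of "ip d u u" 1 "\<alpha>\<^sup>2"] by simp
    also have "\<dots> = (\<nu>\<^sup>2 + \<alpha>\<^sup>2) * (c\<^sup>2 + s\<^sup>2)"
      by (simp add: cs)
    also have "\<dots> = (\<nu> * c + \<alpha> * s)\<^sup>2 + (\<nu> * s - \<alpha> * c)\<^sup>2"
      by algebra
    finally show ?thesis
      by (simp add: ip_linear pw uw)
  qed
  then have "(vnorm d (perp d w ?x))\<^sup>2 \<le> \<bar>\<nu> * s - \<alpha> * c\<bar>\<^sup>2"
    by (simp add: vnorm_square ip_perp[OF w])
  then have "vnorm d (perp d w ?x) \<le> \<bar>\<nu> * s - \<alpha> * c\<bar>"
    by (rule power2_le_imp_le) simp
  moreover have "vnorm d (perp d w v) \<le> vnorm d (perp d w ?x) + vnorm d (perp d w e)"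
  proof -
    have "v = (\<lambda>i. ?x i + e i)"
      by (simp add: v_def algebra_simps)
    then have "perp d w v = (\<lambda>i. perp d w ?x i + perp d w e i)"
      using perp_add[of d w ?x e] by simp
    then show ?thesis
      using vnorm_triangle[of d "perp d w ?x" "perp d w e"] by simp
  qed
  moreover have "vnorm d (perp d w e) \<le> \<sigma> / 20"
    using vnorm_perp_le[OF w, of e] e by simp
  ultimately have "vnorm d (perp d w v) \<le> 15/16 * \<sigma> * \<nu>"
    using rotation_progress[OF \<sigma> \<nu> c s cs \<alpha>] by simp
  also have "\<dots> \<le> 15/16 * \<sigma> * vnorm d v"
    using \<nu>v \<sigma> by simp
  finally show "ip d v v - (ip d v w)\<^sup>2 \<le> (15/16 * \<sigma>)\<^sup>2 * ip d v v"
    by (rule square_gap_le[OF w])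
qed

text \<open>
  For \<open>v = 0\<close>, where the first phase starts, every point is in the band, and \<open>correction\<close> below changes
  nothing as it divides by \<open>0\<close>.  So the first phase estimates the mean of \<open>h\<^sub>w(x) x\<close> without special treatment.
\<close>

definition in_band :: "nat \<Rightarrow> nat \<Rightarrow> real \<Rightarrow> vec \<Rightarrow> vec \<Rightarrow> bool" where
  "in_band d r \<sigma> v z \<longleftrightarrow> \<not> (\<sigma>\<^sup>2 * ip d v v < 400 * (real r)\<^sup>2 * (ip d v z)\<^sup>2)"

definition moment :: "nat \<Rightarrow> vec \<Rightarrow> nat \<Rightarrow> real \<Rightarrow> vec \<Rightarrow> vec" where
  "moment d w r \<sigma> v = (\<lambda>i. \<integral>z. (if in_band d r \<sigma> v z then halfspace d w z else 0) * z i \<partial>uniform_sphere d)"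

definition correction :: "nat \<Rightarrow> vec \<Rightarrow> vec \<Rightarrow> vec" where
  "correction d v g = (\<lambda>i. g i - ip d v g / ip d v v * v i)"

section \<open>The moment vector in the plane of the current and the target direction\<close>

lemma moment_alt:
  "moment d w r \<sigma> v = (\<lambda>i. \<integral>z. (\<lambda>x y. if \<not> (\<sigma>\<^sup>2 * ip d v v < 400 * (real r)\<^sup>2 * x\<^sup>2) then sign_pm y else 0)
     (ip d v z) (ip d w z) * z i \<partial>uniform_sphere d)"
  unfolding moment_def in_band_def halfspace_eq ..

lemma ip_moment_eq_0:
  assumes "d \<ge> 1" "ip d q v = 0" "ip d q w = 0"
  shows "ip d q (moment d w r \<sigma> v) = 0"
  unfolding moment_alt
  by (rule ip_moment_orthogonal) (use assms in \<open>auto simp: abs_sign_pm\<close>)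

lemma ip_moment:
  assumes "d \<ge> 1"
  shows "ip d q (moment d w r \<sigma> v) = (\<integral>z. (if in_band d r \<sigma> v z then halfspace d w z else 0) * ip d q z \<partial>uniform_sphere d)"
  unfolding moment_def halfspace_eq in_band_def
  by (rule ip_integral) (use assms in auto)

text \<open>With \<open>v = 0\<close> the weight depends on \<open>ip d w z\<close> only, so the
  moment is a multiple of \<open>w\<close>: the residual \<open>q\<close> is orthogonal to
  \<open>w\<close>, hence to the moment, hence to itself.\<close>

lemma moment_zero:
  assumes d: "d \<ge> 1" and w: "ip d w w = 1" and v: "\<And>i. i < d \<Longrightarrow> v i = 0" and i: "i < d"
  shows "moment d w r \<sigma> v i = (\<integral>z. \<bar>ip d w z\<bar> \<partial>uniform_sphere d) * w i"
proof -
  let ?m = "moment d w r \<sigma> v"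
  define q where "q = (\<lambda>i. ?m i - ip d w ?m * w i)"
  have ipv: "ip d x v = 0" "ip d v x = 0" for x
    using v by (simp_all add: ip_def)
  have qw: "ip d q w = 0"
    using w by (simp add: q_def ip_linear ip_commute[of d ?m w])
  have "ip d q ?m = 0"
    using ip_moment_eq_0[OF d ipv(1) qw] .
  moreover have "ip d x q = ip d x ?m - ip d w ?m * ip d x w" for x
    by (simp add: q_def ip_linear)
  ultimately have "ip d q q = 0"
    using qw by simp
  then have "q i = 0"
    using ip_self_eq_0 i by blast
  moreover have "ip d w ?m = (\<integral>z. \<bar>ip d w z\<bar> \<partial>uniform_sphere d)"
    unfolding ip_moment[OF d]
    by (intro Bochner_Integration.integral_cong) (auto simp: in_band_def ipv halfspace_eq sign_pm_def)
  ultimately show ?thesis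
    by (simp add: q_def)
qed

text \<open>The direction \<open>p\<close> of \<open>v\<close> and the component \<open>u\<close> of the target \<open>w\<close> across it; \<open>s\<close> is the sine of the angle.\<close>

definition plane_coords ::
  "nat \<Rightarrow> vec \<Rightarrow> real \<Rightarrow> vec \<Rightarrow> real \<Rightarrow> vec \<Rightarrow> vec \<Rightarrow> real \<Rightarrow> real \<Rightarrow> bool" where
  "plane_coords d w \<sigma> v \<nu> p u c s \<longleftrightarrow>
     0 < \<nu> \<and> \<nu>\<^sup>2 = ip d v v \<and> v = (\<lambda>i. \<nu> * p i) \<and> ip d p p = 1 \<and>
     0 < c \<and> 0 \<le> s \<and> s \<le> \<sigma> \<and> c\<^sup>2 + s\<^sup>2 = 1 \<and> (\<forall>i<d. w i = c * p i + s * u i) \<and> ip d p u = 0 \<and>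
     ip d u u = (if s = 0 then 0 else 1) \<and> ip d u w = s \<and> ip d p w = c \<and> (s = 0 \<longrightarrow> u = (\<lambda>i. 0))"

lemma plane_coordsD:
  assumes "plane_coords d w \<sigma> v \<nu> p u c s"
  shows "0 < \<nu>" "\<nu>\<^sup>2 = ip d v v" "v = (\<lambda>i. \<nu> * p i)" "ip d p p = 1"
    "0 < c" "0 \<le> s" "s \<le> \<sigma>" "c\<^sup>2 + s\<^sup>2 = 1" "\<forall>i<d. w i = c * p i + s * u i" "ip d p u = 0"
    "ip d u u = (if s = 0 then 0 else 1)" "ip d u w = s" "ip d p w = c" "s = 0 \<longrightarrow> u = (\<lambda>i. 0)"
  using assms unfolding plane_coords_def by - (elim conjE, assumption)+

lemma good_decomposition:
  assumes g: "good d w \<sigma> v" and w: "ip d w w = 1" and \<sigma>: "0 < \<sigma>"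
  obtains \<nu> p u c s where "plane_coords d w \<sigma> v \<nu> p u c s"
proof -
  define \<nu> where "\<nu> = sqrt (ip d v v)"
  have \<nu>: "0 < \<nu>" "\<nu>\<^sup>2 = ip d v v"
    using g by (auto simp: good_def \<nu>_def)
  define p where "p = (\<lambda>i. v i / \<nu>)"
  have v: "v = (\<lambda>i. \<nu> * p i)"
    using \<nu> by (simp add: p_def)
  have p: "ip d p p = 1"
    unfolding p_def ip_divide_left ip_divide_right \<nu>(2)[symmetric] using \<nu>(1) by (simp add: power2_eq_square)
  define c where "c = ip d p w"
  have c: "0 < c"
    using g \<nu> by (simp add: c_def p_def ip_linear good_def)
  have c1: "c\<^sup>2 \<le> 1"
    using ip_Cauchy_Schwarz[of d p w] p w by (simp add: c_def)
  define s where "s = sqrt (1 - c\<^sup>2)"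
  have s: "0 \<le> s" "c\<^sup>2 + s\<^sup>2 = 1"
    using c1 by (simp_all add: s_def)
  have "\<nu>\<^sup>2 - (\<nu> * c)\<^sup>2 \<le> \<sigma>\<^sup>2 * \<nu>\<^sup>2"
    using g by (simp add: good_def \<nu>(2) c_def) (simp add: v ip_linear)
  then have "\<nu>\<^sup>2 * (1 - c\<^sup>2) \<le> \<nu>\<^sup>2 * \<sigma>\<^sup>2"
    by (simp add: power_mult_distrib algebra_simps)
  then have "1 - c\<^sup>2 \<le> \<sigma>\<^sup>2"
    by (rule mult_left_le_imp_le) (use \<nu>(1) in simp)
  then have "s\<^sup>2 \<le> \<sigma>\<^sup>2"
    using s(2) by linarith
  then have s\<sigma>: "s \<le> \<sigma>"
    by (rule power2_le_imp_le) (use \<sigma> in simp)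
  \<comment> \<open>For s = 0 the target is parallel to \<open>v\<close>. The value 0 keeps the
    decomposition of \<open>w\<close> and the orthogonality to \<open>p\<close> valid in that case
    as well.\<close>
  define u where "u = (if s = 0 then (\<lambda>i. 0) else (\<lambda>i. (w i - c * p i) / s))"
  have diff: "ip d (\<lambda>i. w i - c * p i) (\<lambda>i. w i - c * p i) = s\<^sup>2"
    using s w p by (simp add: ip_linear ip_commute[of d w p] c_def[symmetric] power2_eq_square)
  show ?thesis
  proof (rule that, unfold plane_coords_def, intro conjI allI impI)
    fix i assume i: "i < d"
    show "w i = c * p i + s * u i"
    proof (cases "s = 0")
      case True
      then have "ip d (\<lambda>i. w i - c * p i) (\<lambda>i. w i - c * p i) = 0"
        using diff by simp
      then have "w i - c * p i = 0"
        using ip_self_eq_0 i by blast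
      then show ?thesis
        using True by simp
    qed (simp add: u_def)
  next
    show "ip d p u = 0"
      using p by (simp add: u_def ip_linear c_def[symmetric]) (simp add: ip_def)
    show "ip d u u = (if s = 0 then 0 else 1)"
    proof (cases "s = 0")
      case False
      then have "ip d u u = s\<^sup>2 / s / s"
        unfolding u_def if_not_P[OF False] ip_divide_left ip_divide_right diff by simp
      then show ?thesis
        using False by (simp add: power2_eq_square)
    qed (simp add: u_def ip_def)
    show "ip d u w = s"
    proof (cases "s = 0")
      case False
      then have "ip d u w = (1 - c\<^sup>2) / s"
        using w by (simp add: u_def ip_linear c_def[symmetric] power2_eq_square)
      also have "\<dots> = s"
        using s(2) False by (simp add: field_simps power2_eq_square)
      finally show ?thesis .
    qed (simp add: u_def ip_def)
    show "ip d p w = c"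
      by (simp add: c_def)
    show "u = (\<lambda>i. 0)" if "s = 0"
      using that by (simp add: u_def)
  qed (fact \<nu> v p c s s\<sigma>)+
qed

text \<open>Dividing by the norm and taking the root gives the band of half-width sigma / (20 r)
  around the hyperplane; 400 is the square of 20. The program tests the squared form, which needs
  neither operation.\<close>

lemma in_band_iff:
  assumes \<nu>: "0 < \<nu>" and v: "v = (\<lambda>i. \<nu> * p i)" and p: "ip d p p = 1" and r: "0 < real r" and \<sigma>: "0 \<le> \<sigma>"
  shows "in_band d r \<sigma> v z \<longleftrightarrow> \<bar>ip d p z\<bar> \<le> \<sigma> / (20 * real r)"
proof -
  have "in_band d r \<sigma> v z \<longleftrightarrow> 400 * (real r)\<^sup>2 * (\<nu> * ip d p z)\<^sup>2 \<le> \<sigma>\<^sup>2 * \<nu>\<^sup>2"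
    unfolding in_band_def by (simp add: v ip_linear not_less p power2_eq_square)
  also have "\<dots> \<longleftrightarrow> (20 * real r * ip d p z)\<^sup>2 * \<nu>\<^sup>2 \<le> \<sigma>\<^sup>2 * \<nu>\<^sup>2"
    by (simp add: power_mult_distrib mult_ac)
  also have "\<dots> \<longleftrightarrow> (20 * real r * ip d p z)\<^sup>2 \<le> \<sigma>\<^sup>2"
    using \<nu> by simp
  also have "\<dots> \<longleftrightarrow> \<bar>20 * real r * ip d p z\<bar> \<le> \<bar>\<sigma>\<bar>"
    by (rule abs_le_square_iff[symmetric])
  also have "\<dots> \<longleftrightarrow> \<bar>ip d p z\<bar> \<le> \<sigma> / (20 * real r)"
    using \<sigma> r by (simp add: abs_mult field_simps)
  finally show ?thesis .
qed

text \<open>The moment lies in the plane of \<open>p\<close> and \<open>u\<close>, so removing its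
  component along \<open>v\<close> leaves a multiple of \<open>u\<close>. The coefficient is the
  signal of \<open>halfspace_signal\<close> for the half-width sigma / (20 r).\<close>

lemma correction_moment:
  assumes d: "d \<ge> 1" and r: "real d \<le> (real r)\<^sup>2" and \<sigma>: "0 < \<sigma>"
    and pc: "plane_coords d w \<sigma> v \<nu> p u c s"
  shows "\<exists>A. (\<forall>i<d. correction d v (moment d w r \<sigma> v) i = A * u i) \<and>
    0 \<le> A \<and> A \<le> 2 / pi * (\<sigma> / (20 * real r)) \<and> (\<sigma> / 2 \<le> s \<longrightarrow> \<sigma> / (20 * real r) / pi \<le> A)"
proof -
  note \<nu> = plane_coordsD(1)[OF pc] and v = plane_coordsD(3)[OF pc] and p = plane_coordsD(4)[OF pc]
    and c = plane_coordsD(5)[OF pc] and s = plane_coordsD(6)[OF pc] and cs = plane_coordsD(8)[OF pc]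
    and wi = plane_coordsD(9)[OF pc, rule_format] and pu = plane_coordsD(10)[OF pc]
    and uu = plane_coordsD(11)[OF pc] and u0 = plane_coordsD(14)[OF pc, rule_format]
  let ?G = "moment d w r \<sigma> v"
  have "real r \<noteq> 0" using d r by (cases "r = 0") auto
  then have r0: "real r > 0" by simp
  have n: "ip d v v = \<nu>\<^sup>2"
    by (simp add: v ip_linear p power2_eq_square)
  have wz: "ip d x w = c * ip d x p + s * ip d x u" for x
  proof -
    have "ip d x w = ip d x (\<lambda>i. c * p i + s * u i)"
      by (rule ip_cong) (auto simp: wi)
    then show ?thesis by (simp add: ip_linear)
  qed
  have wz': "ip d w z = c * ip d p z + s * ip d u z" for z
    using wz[of z] by (simp only: ip_commute[of d w z] ip_commute[of d z p] ip_commute[of d z u])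
  have vu: "ip d v u = 0"
    by (simp add: v ip_linear pu)
  \<comment> \<open>This residual is orthogonal to \<open>v\<close> and \<open>u\<close>, hence to
    \<open>w\<close> and to the moment. It is a combination of the moment, \<open>v\<close> and
    \<open>u\<close>, so it is orthogonal to itself.\<close>
  define q where "q = (\<lambda>i. correction d v ?G i - ip d u ?G * u i)"
  have qv: "ip d q v = 0"
    using \<nu> vu by (simp add: q_def correction_def ip_linear n ip_commute[of d ?G v] ip_commute[of d u v])
  then have qp: "ip d q p = 0"
    using \<nu> by (simp add: v ip_linear)
  have qu: "ip d q u = 0"
  proof (cases "s = 0")
    case True
    then show ?thesis by (simp add: u0 ip_def)
  next
    case False
    then show ?thesis
      using uu pu by (simp add: q_def correction_def ip_linear ip_commute[of d ?G u] vu)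
  qed
  have "ip d q w = 0"
    by (simp add: wz qp qu)
  then have "ip d q ?G = 0"
    using ip_moment_eq_0[OF d qv] by blast
  moreover have "ip d x q = ip d x ?G - ip d v ?G / ip d v v * ip d x v - ip d u ?G * ip d x u" for x
    by (simp add: q_def correction_def ip_linear)
  ultimately have "ip d q q = 0"
    using qv qu by simp
  then have q0: "q i = 0" if "i < d" for i
    using ip_self_eq_0 that by blast
  let ?b = "\<sigma> / (20 * real r)"
  have b0: "0 \<le> ?b" using \<sigma> by simp
  show ?thesis
  proof (cases "s = 0")
    case True
    show ?thesis
    proof (intro exI[of _ 0] conjI allI impI)
      fix i assume "i < d"
      then show "correction d v ?G i = 0 * u i"
        using q0[of i] u0[OF True] by (simp add: q_def)
    next
      show "\<sigma> / (20 * real r) / pi \<le> 0" if "\<sigma> / 2 \<le> s"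
        using that True \<sigma> by simp
    qed (use \<sigma> in auto)
  next
    case False
    then have s0: "0 < s" using s by simp
    have u1: "ip d u u = 1" using uu False by simp
    have s1: "s \<le> 1" and c1: "c \<le> 1"
    proof -
      have "s\<^sup>2 \<le> 1" "c\<^sup>2 \<le> 1"
        using cs zero_le_power2[of s] zero_le_power2[of c] by linarith+
      then show "s \<le> 1" "c \<le> 1"
        using power2_le_imp_le[of s 1] power2_le_imp_le[of c 1] by simp_all
    qed
    note band = in_band_iff[OF \<nu> v p r0 less_imp_le[OF \<sigma>]]
    have A: "ip d u ?G = (\<integral>z. (if \<bar>ip d p z\<bar> \<le> ?b then sign_pm (c * ip d p z + s * ip d u z) * ip d u z else 0) \<partial>uniform_sphere d)"
      unfolding ip_moment[OF d] band
      by (intro Bochner_Integration.integral_cong) (auto simp: halfspace_eq wz')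
    note sig = halfspace_signal[OF d p u1 pu s0 s1 _ c1 b0, folded A]
    show ?thesis
    proof (intro exI[of _ "ip d u ?G"] conjI allI impI)
      fix i assume "i < d"
      then show "correction d v ?G i = ip d u ?G * u i"
        using q0[of i] by (simp add: q_def)
    next
      show "0 \<le> ip d u ?G" "ip d u ?G \<le> 2 / pi * ?b"
        using sig c by auto
      assume "\<sigma> / 2 \<le> s"
      \<comment> \<open>The hypothesis of \<open>halfspace_signal\<close> becomes 8/20 sigma <= s,
        which follows from s >= sigma/2. This is what the 20 in the band width provides.\<close>
      have "sqrt (real d) \<le> real r"
        using r by (intro real_le_lsqrt) auto
      then have "8 * ?b * sqrt (real d) \<le> 8 * ?b * real r"
        using b0 by (intro mult_left_mono) auto
      also have "\<dots> = 2 / 5 * \<sigma>"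
        using r0 by simp
      also have "\<dots> \<le> s"
        using \<open>\<sigma> / 2 \<le> s\<close> \<sigma> by simp
      finally show "?b / pi \<le> ip d u ?G"
        using sig(3) c by auto
    qed
  qed
qed

section \<open>One phase, given an accurate estimate of the moment\<close>

lemma correction_add: "correction d v (\<lambda>i. x i + y i) = (\<lambda>i. correction d v x i + correction d v y i)"
  by (simp add: correction_def ip_linear fun_eq_iff add_divide_distrib algebra_simps)

lemma correction_scale: "correction d v (\<lambda>i. a * x i) = (\<lambda>i. a * correction d v x i)"
  by (simp add: correction_def ip_linear fun_eq_iff algebra_simps)

lemma ip_correction: "ip d v v \<noteq> 0 \<Longrightarrow> ip d v (correction d v x) = 0"
  by (simp add: correction_def ip_linear)

lemma vnorm_correction_le: "vnorm d (correction d v x) \<le> vnorm d x"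
proof (cases "ip d v v = 0")
  case False
  have "ip d (correction d v x) (correction d v x) = ip d x x - (ip d v x)\<^sup>2 / ip d v v"
    using False by (simp add: correction_def ip_linear ip_commute[of d x v]) (simp add: power2_eq_square)
  also have "\<dots> \<le> ip d x x"
    using ip_self_nonneg[of d v] by simp
  finally show ?thesis
    by (simp add: vnorm_def)
qed (simp add: correction_def)

lemma vnorm_le_of_coords:
  assumes "\<And>i. i < d \<Longrightarrow> \<bar>x i\<bar> \<le> t" "0 \<le> t" "real d \<le> (real r)\<^sup>2"
  shows "vnorm d x \<le> real r * t"
proof -
  have "ip d x x \<le> (\<Sum>i<d. t\<^sup>2)"
    unfolding ip_self_conv[symmetric] using assms(1,2) abs_le_square_iff[of _ t] by (intro sum_mono) auto
  also have "\<dots> = real d * t\<^sup>2" by simp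
  also have "\<dots> \<le> (real r * t)\<^sup>2"
    using assms(3) by (simp add: power_mult_distrib mult_right_mono)
  finally show ?thesis
    unfolding vnorm_def using assms(2) by (intro real_le_lsqrt) auto
qed

text \<open>The vector \<^term>\<open>g\<close> is the estimate of \<^term>\<open>\<rho>\<close> times the moment vector.\<close>

definition advance :: "nat \<Rightarrow> nat \<Rightarrow> real \<Rightarrow> vec \<Rightarrow> vec \<Rightarrow> vec" where
  "advance d r \<rho> v g = (newton d ^^ 8) (\<lambda>i. v i + 10 * real r / \<rho> * correction d v g i)"

text \<open>Vectors are functions on all indices, but only the coordinates below \<open>d\<close>
  are controlled, both by the decomposition of \<open>w\<close> and by the arrays of the program. So
  results are transported between vectors that agree there.\<close>

lemma newton_pow_cong:
  assumes "\<And>i. i < d \<Longrightarrow> x i = y i" "i < d"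
  shows "(newton d ^^ k) x i = (newton d ^^ k) y i"
  using assms(2)
proof (induction k arbitrary: i)
  case (Suc k)
  then have "ip d ((newton d ^^ k) x) ((newton d ^^ k) x) = ip d ((newton d ^^ k) y) ((newton d ^^ k) y)"
    by (intro ip_cong) auto
  moreover have "newton d z i = 2 * z i / (1 + ip d z z)" for z
    by (simp add: newton_def)
  ultimately show ?case
    using Suc by simp
qed (use assms(1) in simp)

lemma newton_pow_good_cong:
  assumes "\<And>i. i < d \<Longrightarrow> x i = y i"
  shows "good d w t ((newton d ^^ k) x) = good d w t ((newton d ^^ k) y)"
proof -
  have "ip d ((newton d ^^ k) x) ((newton d ^^ k) x) = ip d ((newton d ^^ k) y) ((newton d ^^ k) y)"
    "ip d ((newton d ^^ k) x) w = ip d ((newton d ^^ k) y) w"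
    using newton_pow_cong[OF assms] by (auto intro!: ip_cong)
  then show ?thesis
    by (simp add: good_def)
qed

text \<open>The step length 10 r / rho turns the signal, at most 2 / pi times the half-width sigma /
  (20 r), into a displacement of at most sigma / pi, and of at least sigma / (2 pi) once the sine
  reaches sigma/2. Errors of rho sigma / (200 r^2) per coordinate have norm at most r times that, so
  they contribute at most sigma/20.\<close>

lemma good_advance:
  assumes d: "d \<ge> 1" and r: "real d \<le> (real r)\<^sup>2" and w: "ip d w w = 1" and \<sigma>: "0 < \<sigma>" "\<sigma> \<le> 1/2"
    and \<rho>: "0 < \<rho>" and g: "good d w \<sigma> v"
    and est: "\<And>i. i < d \<Longrightarrow> \<bar>g i - \<rho> * moment d w r \<sigma> v i\<bar> \<le> \<rho> * \<sigma> / (200 * (real r)\<^sup>2)"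
  shows "good d w (15/16 * \<sigma>) (advance d r \<rho> v g)"
proof -
  obtain \<nu> p u c s where pc: "plane_coords d w \<sigma> v \<nu> p u c s"
    using good_decomposition[OF g w \<sigma>(1)] .
  note dec = plane_coordsD[OF pc]
  obtain A where A: "\<And>i. i < d \<Longrightarrow> correction d v (moment d w r \<sigma> v) i = A * u i"
    "0 \<le> A" "A \<le> 2 / pi * (\<sigma> / (20 * real r))" "\<sigma> / 2 \<le> s \<Longrightarrow> \<sigma> / (20 * real r) / pi \<le> A"
    using correction_moment[OF d r \<sigma>(1) pc] by blast
  have "real r \<noteq> 0" using d r by (cases "r = 0") auto
  then have r0: "real r > 0" by simp
  define x where "x = (\<lambda>i. g i - \<rho> * moment d w r \<sigma> v i)"
  define e where "e = (\<lambda>i. 10 * real r / \<rho> * correction d v x i)"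
  define \<alpha> where "\<alpha> = 10 * real r * A"
  have "vnorm d x \<le> real r * (\<rho> * \<sigma> / (200 * (real r)\<^sup>2))"
    using est \<sigma> \<rho> r by (intro vnorm_le_of_coords) (auto simp: x_def)
  then have "vnorm d (correction d v x) \<le> real r * (\<rho> * \<sigma> / (200 * (real r)\<^sup>2))"
    using vnorm_correction_le[of d v x] by linarith
  then have "10 * real r / \<rho> * vnorm d (correction d v x) \<le> 10 * real r / \<rho> * (real r * (\<rho> * \<sigma> / (200 * (real r)\<^sup>2)))"
    using r0 \<rho> by (intro mult_left_mono) auto
  also have "\<dots> = \<sigma> / 20"
    using r0 \<rho> by (simp add: power2_eq_square)
  finally have e: "vnorm d e \<le> \<sigma> / 20"
    unfolding e_def vnorm_scale using r0 \<rho> by simp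
  have pe: "ip d p e = 0"
  proof -
    have "ip d v (correction d v x) = 0"
      using dec(1,2) by (intro ip_correction) auto
    moreover have "ip d v y = \<nu> * ip d p y" for y
      by (subst dec(3)) (simp add: ip_linear)
    ultimately show ?thesis
      using dec(1) by (simp add: e_def ip_linear)
  qed
  have "g = (\<lambda>i. \<rho> * moment d w r \<sigma> v i + x i)"
    by (simp add: x_def)
  then have "correction d v g i = \<rho> * correction d v (moment d w r \<sigma> v) i + correction d v x i" for i
    by (simp add: correction_add correction_scale)
  then have eq: "v i + 10 * real r / \<rho> * correction d v g i = \<nu> * p i + (\<alpha> * u i + e i)" if "i < d" for i
    using that \<rho> A(1)[OF that] by (simp add: e_def \<alpha>_def algebra_simps dec(3)[THEN fun_cong])
  have \<alpha>: "0 \<le> \<alpha>" "\<alpha> \<le> \<sigma> / pi" "\<sigma> / 2 \<le> s \<Longrightarrow> \<sigma> / (2 * pi) \<le> \<alpha>"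
  proof -
    show "0 \<le> \<alpha>" using A r0 by (simp add: \<alpha>_def)
    have "\<alpha> \<le> 10 * real r * (2 / pi * (\<sigma> / (20 * real r)))"
      unfolding \<alpha>_def using A r0 by (intro mult_left_mono) auto
    then show "\<alpha> \<le> \<sigma> / pi" using r0 by simp
    assume "\<sigma> / 2 \<le> s"
    then have "10 * real r * (\<sigma> / (20 * real r) / pi) \<le> \<alpha>"
      unfolding \<alpha>_def using A r0 by (intro mult_left_mono) auto
    then show "\<sigma> / (2 * pi) \<le> \<alpha>" using r0 by simp
  qed
  have uu1: "ip d u u \<le> 1" using dec(11) by simp
  have \<nu>b: "9/10 \<le> \<nu>\<^sup>2" "\<nu>\<^sup>2 \<le> 1" using g dec(2) by (auto simp: good_def)
  have G: "good d w (15/16 * \<sigma>) ((newton d ^^ 8) (\<lambda>i. \<nu> * p i + (\<alpha> * u i + e i)))"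
    by (rule corrected_direction[OF w dec(4) uu1 dec(10,13,12) \<sigma> dec(1) \<nu>b dec(5,6,7,8) \<alpha> pe e])
  show ?thesis
    unfolding advance_def using G by (subst newton_pow_good_cong[OF eq])
qed

text \<open>The moment is a multiple of \<open>w\<close> with a factor between 1 / (8 sqrt d) and 1
  / sqrt d, and \<open>r\<close> lies between sqrt d and 2 sqrt d. Hence after the usual step the
  factor lies between 5/4 and 20, and the estimate itself serves as the direction.\<close>

lemma good_initial_advance:
  assumes d: "d \<ge> 1" and r: "real d \<le> (real r)\<^sup>2" "(real r)\<^sup>2 \<le> 4 * real d" and w: "ip d w w = 1"
    and \<rho>: "0 < \<rho>"
    and est: "\<And>i. i < d \<Longrightarrow> \<bar>g i - \<rho> * moment d w r (1/2) (\<lambda>i. 0) i\<bar> \<le> \<rho> * (1/2) / (200 * (real r)\<^sup>2)"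
  shows "good d w (15/16 * (1/2)) (advance d r \<rho> (\<lambda>i. 0) g)"
proof -
  have "real r \<noteq> 0" using d r by (cases "r = 0") auto
  then have r0: "real r > 0" by simp
  let ?a = "\<integral>z. \<bar>ip d w z\<bar> \<partial>uniform_sphere d"
  define x where "x = (\<lambda>i. g i - \<rho> * moment d w r (1/2) (\<lambda>i. 0) i)"
  \<comment> \<open>The value at indices from \<open>d\<close> on does not affect the norm. It is
    chosen so that the equation below holds at every index and can be used to rewrite the whole
    function.\<close>
  define e where "e = (\<lambda>i. if i < d then 10 * real r / \<rho> * x i else 10 * real r / \<rho> * g i - 10 * real r * ?a * w i)"
  have "vnorm d x \<le> real r * (\<rho> * (1/2) / (200 * (real r)\<^sup>2))"
    using est \<rho> r by (intro vnorm_le_of_coords) (auto simp: x_def)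
  then have "10 * real r / \<rho> * vnorm d x \<le> 10 * real r / \<rho> * (real r * (\<rho> * (1/2) / (200 * (real r)\<^sup>2)))"
    using r0 \<rho> by (intro mult_left_mono) auto
  also have "\<dots> = 1 / 40"
    using r0 \<rho> by (simp add: power2_eq_square)
  finally have "vnorm d (\<lambda>i. 10 * real r / \<rho> * x i) \<le> 1 / 40"
    unfolding vnorm_scale using r0 \<rho> by simp
  moreover have "vnorm d e = vnorm d (\<lambda>i. 10 * real r / \<rho> * x i)"
    unfolding vnorm_def by (intro arg_cong[where f=sqrt] ip_cong) (auto simp: e_def)
  ultimately have e: "vnorm d e \<le> 1 / 40"
    by simp
  have eq: "0 + 10 * real r / \<rho> * correction d (\<lambda>i. 0) g i = (10 * real r * ?a) * w i + e i" for i
    using \<rho> moment_zero[OF d w, of "\<lambda>i. 0" i r "1/2"]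
    by (cases "i < d") (simp_all add: e_def x_def correction_def algebra_simps)
  have sd: "sqrt (real d) \<le> real r" "real r \<le> 2 * sqrt (real d)" "sqrt (real d) > 0"
    using r d power2_le_imp_le[of "real r" "2 * sqrt (real d)"] by (simp_all add: real_le_lsqrt power_mult_distrib)
  have lo: "5/4 \<le> 10 * real r * ?a"
  proof -
    have "5/4 = 10 * sqrt (real d) * (1 / (8 * sqrt (real d)))"
      using sd by simp
    also have "\<dots> \<le> 10 * real r * ?a"
      using integral_abs_ip(1)[OF d w] sd by (intro mult_mono) auto
    finally show ?thesis .
  qed
  have hi: "10 * real r * ?a \<le> 20"
  proof -
    have "10 * real r * ?a \<le> 10 * (2 * sqrt (real d)) * (1 / sqrt (real d))"
      using integral_abs_ip(2)[OF d w] sd by (intro mult_mono) auto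
    also have "\<dots> = 20" using sd by simp
    finally show ?thesis .
  qed
  show ?thesis
    unfolding advance_def eq using initial_direction[OF w lo hi e] .
qed

text \<open>Where the hypotheses disagree, c |a| <= s |b| for the plane coordinates (a, b) of the
  point, hence |a| <= s R and c R <= |b| with the radius R. So the indicator is at most |b| / (c R)
  on the band |a| <= s R, and \<open>nn_integral_planar\<close> with weight 1 / R gives 2 s / (pi
  c), which is at most sigma as c >= 86/100.\<close>

lemma good_error:
  assumes d: "d \<ge> 1" and w: "ip d w w = 1" and \<sigma>: "0 < \<sigma>" "\<sigma> \<le> 1/2" and g: "good d w \<sigma> v"
  shows "{x \<in> unit_sphere d. halfspace d v x \<noteq> halfspace d w x} \<in> sets (uniform_sphere d)"
    and "measure (uniform_sphere d) {x \<in> unit_sphere d. halfspace d v x \<noteq> halfspace d w x} \<le> \<sigma>"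
proof -
  interpret prob_space "uniform_sphere d"
    by (rule prob_space_uniform_sphere)
  let ?D = "{x \<in> unit_sphere d. halfspace d v x \<noteq> halfspace d w x}"
  have "?D = {x \<in> space (uniform_sphere d). halfspace d v x \<noteq> halfspace d w x} \<inter> unit_sphere d"
    by (auto simp: space_uniform_sphere unit_sphere_def)
  moreover have "{x \<in> space (uniform_sphere d). halfspace d v x \<noteq> halfspace d w x} \<in> sets (uniform_sphere d)"
    unfolding halfspace_eq by (rule borel_measurable_neq) measurable
  ultimately show D: "?D \<in> sets (uniform_sphere d)"
    using unit_sphere_sets[of d] by auto
  obtain \<nu> p u c s where pc: "plane_coords d w \<sigma> v \<nu> p u c s"
    using good_decomposition[OF g w \<sigma>(1)] .
  note dec = plane_coordsD[OF pc]
  have wz: "ip d w z = c * ip d p z + s * ip d u z" for z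
  proof -
    have "ip d w z = ip d (\<lambda>i. c * p i + s * u i) z"
      by (rule ip_cong) (auto simp: dec(9))
    then show ?thesis by (simp add: ip_linear)
  qed
  have vz: "ip d v z = \<nu> * ip d p z" for z
    by (simp add: dec(3) ip_linear)
  have hv: "halfspace d v z = sign_pm (ip d p z)" for z
    using dec(1) by (auto simp: halfspace_eq vz sign_pm_def zero_le_mult_iff)
  have hw: "halfspace d w z = sign_pm (c * ip d p z + s * ip d u z)" for z
    by (simp add: halfspace_eq wz)
  show "measure (uniform_sphere d) ?D \<le> \<sigma>"
  proof (cases "s = 0")
    case True
    then have empty: "?D = {}"
      using dec(5) by (auto simp: hv hw sign_pm_def zero_le_mult_iff)
    show ?thesis
      unfolding empty using \<sigma> by simp
  next
    case False
    then have s: "0 < s" using dec by simp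
    have u1: "ip d u u = 1" using dec False by simp
    have s1: "s \<le> 1" using dec(7) \<sigma> by simp
    let ?R = "\<lambda>z. sqrt ((ip d p z)\<^sup>2 + (ip d u z)\<^sup>2)"
    have "s\<^sup>2 \<le> (1/2)\<^sup>2"
      using s dec(7) \<sigma> by (intro power_mono) auto
    then have c: "86/100 \<le> c"
      using dec(5,8) power2_le_imp_le[of "86/100" c] by (simp add: power_divide)
    have pt: "indicator ?D z \<le> ennreal (1 / c) * ennreal (inverse (?R z) * (if \<bar>ip d p z\<bar> \<le> s * ?R z then \<bar>ip d u z\<bar> else 0))" for z
    proof (cases "z \<in> ?D")
      case True
      let ?a = "ip d p z" and ?b = "ip d u z"
      have ne: "sign_pm ?a \<noteq> sign_pm (c * ?a + s * ?b)"
        using True by (simp add: hv hw)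
      have le: "c * \<bar>?a\<bar> \<le> s * \<bar>?b\<bar>"
      proof (cases "?a \<ge> 0")
        case True
        then have "c * ?a + s * ?b < 0"
          using ne by (auto simp: sign_pm_def split: if_splits)
        then show ?thesis
          using True mult_left_mono[OF abs_ge_minus_self[of ?b] less_imp_le[OF s]] by simp
      next
        case False
        then have "c * ?a + s * ?b \<ge> 0"
          using ne by (auto simp: sign_pm_def split: if_splits)
        then show ?thesis
          using False mult_left_mono[OF abs_ge_self[of ?b] less_imp_le[OF s]] by simp
      qed
      have Rpos: "?R z > 0"
      proof (rule ccontr)
        assume "\<not> ?R z > 0"
        then have "?a\<^sup>2 + ?b\<^sup>2 = 0"
          by (metis add_nonneg_nonneg antisym not_less real_sqrt_gt_0_iff zero_le_power2)
        then have "?a = 0" "?b = 0"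
          by (auto simp: sum_power2_eq_zero_iff)
        then show False using ne by simp
      qed
      have sq: "c\<^sup>2 * ?a\<^sup>2 \<le> s\<^sup>2 * ?b\<^sup>2"
        using power_mono[OF le, of 2] dec(5) by (simp add: power_mult_distrib)
      have "c\<^sup>2 * (?a\<^sup>2 + ?b\<^sup>2) \<le> (c\<^sup>2 + s\<^sup>2) * ?b\<^sup>2"
        using sq by (simp add: algebra_simps)
      then have "(c * ?R z)\<^sup>2 \<le> \<bar>?b\<bar>\<^sup>2"
        by (simp add: dec(8) power_mult_distrib)
      then have b: "c * ?R z \<le> \<bar>?b\<bar>"
        by (rule power2_le_imp_le) simp
      have "(c\<^sup>2 + s\<^sup>2) * ?a\<^sup>2 \<le> s\<^sup>2 * (?a\<^sup>2 + ?b\<^sup>2)"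
        using sq by (simp add: algebra_simps)
      then have "\<bar>?a\<bar>\<^sup>2 \<le> (s * ?R z)\<^sup>2"
        by (simp add: dec(8) power_mult_distrib)
      then have a: "\<bar>?a\<bar> \<le> s * ?R z"
        by (rule power2_le_imp_le) (use s in simp)
      have "1 \<le> (1 / c) * (inverse (?R z) * \<bar>?b\<bar>)"
        using b Rpos dec(5) by (simp add: field_simps)
      then have "ennreal 1 \<le> ennreal (1 / c) * ennreal (inverse (?R z) * \<bar>?b\<bar>)"
        using dec(5) Rpos by (subst ennreal_mult[symmetric]) (auto intro!: ennreal_leI)
      then show ?thesis
        using True a by simp
    qed simp
    have "(\<integral>\<^sup>+z. ennreal (inverse (?R z) * (if \<bar>ip d p z\<bar> \<le> s * ?R z then \<bar>ip d u z\<bar> else 0)) \<partial>uniform_sphere d) =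
        (\<integral>\<^sup>+z. ennreal (2 / pi * \<bar>inverse (?R z)\<bar> * (s * ?R z)) \<partial>uniform_sphere d)"
      \<comment> \<open>The absolute value makes the weight nonnegative on all reals, as
        \<open>nn_integral_planar\<close> demands.\<close>
      using nn_integral_planar[OF dec(4) u1 dec(10), of "\<lambda>r. \<bar>inverse r\<bar>" "\<lambda>r. s * r"] s s1
      by (simp add: mult_left_le_one_le)
    also have "\<dots> \<le> (\<integral>\<^sup>+z. ennreal (2 / pi * s) \<partial>uniform_sphere d)"
    proof (intro nn_integral_mono ennreal_leI)
      fix z
      have "\<bar>inverse (?R z)\<bar> * ?R z \<le> 1"
        by (cases "?R z = 0") simp_all
      then have "(2 / pi * s) * (\<bar>inverse (?R z)\<bar> * ?R z) \<le> (2 / pi * s) * 1"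
        using s by (intro mult_left_mono) auto
      then show "2 / pi * \<bar>inverse (?R z)\<bar> * (s * ?R z) \<le> 2 / pi * s"
        by (simp add: mult_ac)
    qed
    also have "\<dots> = ennreal (2 / pi * s)"
      by (simp add: emeasure_space_1)
    finally have inner: "(\<integral>\<^sup>+z. ennreal (inverse (?R z) * (if \<bar>ip d p z\<bar> \<le> s * ?R z then \<bar>ip d u z\<bar> else 0)) \<partial>uniform_sphere d) \<le> ennreal (2 / pi * s)" .
    have "emeasure (uniform_sphere d) ?D = (\<integral>\<^sup>+z. indicator ?D z \<partial>uniform_sphere d)"
      using D by simp
    also have "\<dots> \<le> (\<integral>\<^sup>+z. ennreal (1 / c) * ennreal (inverse (?R z) * (if \<bar>ip d p z\<bar> \<le> s * ?R z then \<bar>ip d u z\<bar> else 0)) \<partial>uniform_sphere d)"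
      using pt by (intro nn_integral_mono) auto
    also have "\<dots> = ennreal (1 / c) * (\<integral>\<^sup>+z. ennreal (inverse (?R z) * (if \<bar>ip d p z\<bar> \<le> s * ?R z then \<bar>ip d u z\<bar> else 0)) \<partial>uniform_sphere d)"
      by (rule nn_integral_cmult) measurable
    also have "\<dots> \<le> ennreal (1 / c) * ennreal (2 / pi * s)"
      using inner by (intro mult_left_mono) auto
    also have "ennreal (1 / c) * ennreal (2 / pi * s) = ennreal ((1 / c) * (2 / pi * s))"
      using dec(5) s by (subst ennreal_mult[symmetric]) auto
    finally have "ennreal (prob ?D) \<le> ennreal ((1 / c) * (2 / pi * s))"
      unfolding emeasure_eq_measure .
    then have "prob ?D \<le> (1 / c) * (2 / pi * s)"
      using dec(5) s by (subst (asm) ennreal_le_iff) auto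
    also have "\<dots> \<le> (100/86) * (2 / 3 * \<sigma>)"
    proof (rule mult_mono)
      show "1 / c \<le> 100/86"
        using c dec(5) by (simp add: pos_divide_le_eq)
      show "2 / pi * s \<le> 2 / 3 * \<sigma>"
        using s dec(7) pi_gt3 by (intro mult_mono frac_le) auto
    qed (use s in auto)
    also have "\<dots> \<le> \<sigma>" using \<sigma> by simp
    finally show ?thesis .
  qed
qed

section \<open>Concentration\<close>

context sequence_space
begin

text \<open>Induction that splits off the first member of the sequence: by \<open>PiM_iter\<close>,
  one fresh sample followed by a sequence is again such a sequence.\<close>

lemma nn_integral_prod_iid:
  fixes g :: "'a \<Rightarrow> ennreal"
  assumes g[measurable]: "g \<in> borel_measurable M"
  shows "(\<integral>\<^sup>+\<omega>. (\<Prod>j<N. g (\<omega> j)) \<partial>S) = (\<integral>\<^sup>+x. g x \<partial>M) ^ N"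
proof (induction N)
  case 0
  then show ?case by (simp add: P.emeasure_space_1)
next
  case (Suc N)
  have meas: "(\<lambda>\<omega>. \<Prod>j<N. g (\<omega> j)) \<in> borel_measurable S" for N
    by measurable
  have mc: "(\<lambda>(s, \<omega>). case_nat s \<omega>) \<in> M \<Otimes>\<^sub>M S \<rightarrow>\<^sub>M S"
    by measurable
  have "(\<integral>\<^sup>+\<omega>. (\<Prod>j<Suc N. g (\<omega> j)) \<partial>S) = (\<integral>\<^sup>+\<omega>. (\<Prod>j<Suc N. g (\<omega> j)) \<partial>distr (M \<Otimes>\<^sub>M S) S (\<lambda>(s, \<omega>). case_nat s \<omega>))"
    by (simp only: PiM_iter)
  also have "\<dots> = (\<integral>\<^sup>+p. (\<Prod>j<Suc N. g ((case p of (s, \<omega>) \<Rightarrow> case_nat s \<omega>) j)) \<partial>(M \<Otimes>\<^sub>M S))"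
    by (rule nn_integral_distr[OF mc]) (simp add: meas)
  also have "\<dots> = (\<integral>\<^sup>+p. g (fst p) * (\<Prod>j<N. g (snd p j)) \<partial>(M \<Otimes>\<^sub>M S))"
    by (simp only: prod.lessThan_Suc_shift) (simp add: case_prod_beta')
  also have "\<dots> = (\<integral>\<^sup>+x. (\<integral>\<^sup>+\<omega>. g x * (\<Prod>j<N. g (\<omega> j)) \<partial>S) \<partial>M)"
    by (subst P.nn_integral_fst[symmetric]) auto
  also have "\<dots> = (\<integral>\<^sup>+x. g x * (\<integral>\<^sup>+x. g x \<partial>M) ^ N \<partial>M)"
    using meas by (simp add: nn_integral_cmult Suc.IH)
  also have "\<dots> = (\<integral>\<^sup>+x. g x \<partial>M) ^ Suc N"
    by (simp add: nn_integral_multc)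
  finally show ?case .
qed

text \<open>For negative \<open>x\<close>, \<open>exp x\<close> is the reciprocal of
  \<open>exp (- x)\<close>, which dominates its quadratic Taylor polynomial. That polynomial times 1
  - y + y^2, with y = -x, is at least 1.\<close>

lemma exp_le_quadratic:
  fixes x :: real
  assumes "x \<le> 1"
  shows "exp x \<le> 1 + x + x\<^sup>2"
proof (cases "0 \<le> x")
  case True
  then show ?thesis using exp_bound[of x] assms by simp
next
  case False
  define y where "y = - x"
  have y: "0 < y" using False by (simp add: y_def)
  have pos: "0 < 1 + y + y\<^sup>2 / 2" using y by (intro add_pos_nonneg) auto
  have "1 + y + y\<^sup>2 / 2 \<le> exp y"
    using exp_lower_Taylor_quadratic[of y] y by simp
  then have "exp x \<le> 1 / (1 + y + y\<^sup>2 / 2)"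
    using pos by (simp add: y_def exp_minus field_simps inverse_eq_divide)
  also have "\<dots> \<le> 1 - y + y\<^sup>2"
  proof -
    have "(1 - y + y\<^sup>2) * (1 + y + y\<^sup>2 / 2) = 1 + y\<^sup>2 / 2 + y * y\<^sup>2 / 2 + y\<^sup>2 * y\<^sup>2 / 2"
      by (simp add: field_simps power2_eq_square)
    moreover have "0 \<le> y\<^sup>2 / 2 + y * y\<^sup>2 / 2 + y\<^sup>2 * y\<^sup>2 / 2"
      using y by simp
    ultimately have "1 \<le> (1 - y + y\<^sup>2) * (1 + y + y\<^sup>2 / 2)" by linarith
    then show ?thesis
      using pos by (simp add: pos_divide_le_eq)
  qed
  finally show ?thesis by (simp add: y_def)
qed

text \<open>The variables are not centred, and \<open>v\<close> bounds their second moment. For a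
  sample that is 0 outside the band this is at most the band probability, which is what makes the
  number of labels per phase independent of sigma.\<close>

lemma Chernoff_iid:
  fixes f :: "'a \<Rightarrow> real"
  assumes f[measurable]: "f \<in> borel_measurable M" and bound: "AE x in M. \<bar>f x\<bar> \<le> 1"
    and mean: "(\<integral>x. f x \<partial>M) \<le> \<mu>" and sq: "(\<integral>x. (f x)\<^sup>2 \<partial>M) \<le> v" and l: "0 \<le> l" "l \<le> 1"
  shows "emeasure S {\<omega> \<in> space S. T \<le> (\<Sum>j<N. f (\<omega> j))} \<le> ennreal (exp (real N * (l * \<mu> + l\<^sup>2 * v) - l * T))"
proof -
  have if1: "integrable M f"
    using bound by (intro M.integrable_const_bound[of _ 1]) auto
  have if2: "integrable M (\<lambda>x. (f x)\<^sup>2)"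
    using bound by (intro M.integrable_const_bound[of _ 1]) (auto simp: abs_square_le_1)
  have "(\<integral>\<^sup>+x. ennreal (exp (l * f x)) \<partial>M) \<le> (\<integral>\<^sup>+x. ennreal (1 + l * f x + l\<^sup>2 * (f x)\<^sup>2) \<partial>M)"
  proof (intro nn_integral_mono_AE, use bound in eventually_elim)
    fix x assume "\<bar>f x\<bar> \<le> 1"
    then have "l * \<bar>f x\<bar> \<le> 1"
      using l by (intro mult_le_one) auto
    moreover have "l * f x \<le> l * \<bar>f x\<bar>"
      using l by (intro mult_left_mono) auto
    ultimately have "l * f x \<le> 1"
      by linarith
    from exp_le_quadratic[OF this] show "ennreal (exp (l * f x)) \<le> ennreal (1 + l * f x + l\<^sup>2 * (f x)\<^sup>2)"
      by (intro ennreal_leI) (simp add: power_mult_distrib)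
  qed
  also have "\<dots> = ennreal (\<integral>x. 1 + l * f x + l\<^sup>2 * (f x)\<^sup>2 \<partial>M)"
  proof (rule nn_integral_eq_integral)
    show "integrable M (\<lambda>x. 1 + l * f x + l\<^sup>2 * (f x)\<^sup>2)"
      using if1 if2 by auto
    have "0 \<le> 1 + l * t + l\<^sup>2 * t\<^sup>2" for t
      using sum_squares_ge_zero[of "1 + l * t / 2" "l * t"] zero_le_power2[of "1 + l * t / 2"] zero_le_power2[of "l * t"]
      by (simp add: power2_eq_square algebra_simps)
    then show "AE x in M. 0 \<le> 1 + l * f x + l\<^sup>2 * (f x)\<^sup>2"
      by simp
  qed
  also have "(\<integral>x. 1 + l * f x + l\<^sup>2 * (f x)\<^sup>2 \<partial>M) = 1 + l * (\<integral>x. f x \<partial>M) + l\<^sup>2 * (\<integral>x. (f x)\<^sup>2 \<partial>M)"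
    using if1 if2 by (simp add: M.prob_space)
  also have "ennreal \<dots> \<le> ennreal (exp (l * \<mu> + l\<^sup>2 * v))"
  proof (rule ennreal_leI)
    have "1 + l * (\<integral>x. f x \<partial>M) + l\<^sup>2 * (\<integral>x. (f x)\<^sup>2 \<partial>M) \<le> 1 + (l * \<mu> + l\<^sup>2 * v)"
      using mult_left_mono[OF mean l(1)] mult_left_mono[OF sq, of "l\<^sup>2"] by simp
    also have "\<dots> \<le> exp (l * \<mu> + l\<^sup>2 * v)"
      by (rule exp_ge_add_one_self)
    finally show "1 + l * (\<integral>x. f x \<partial>M) + l\<^sup>2 * (\<integral>x. (f x)\<^sup>2 \<partial>M) \<le> exp (l * \<mu> + l\<^sup>2 * v)" .
  qed
  finally have mgf: "(\<integral>\<^sup>+x. ennreal (exp (l * f x)) \<partial>M) \<le> ennreal (exp (l * \<mu> + l\<^sup>2 * v))" .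
  let ?A = "{\<omega> \<in> space S. T \<le> (\<Sum>j<N. f (\<omega> j))}"
  have A: "?A \<in> sets S" by measurable
  have "emeasure S ?A = (\<integral>\<^sup>+\<omega>. indicator ?A \<omega> \<partial>S)"
    using A by simp
  also have "\<dots> \<le> (\<integral>\<^sup>+\<omega>. ennreal (exp (- (l * T))) * (\<Prod>j<N. ennreal (exp (l * f (\<omega> j)))) \<partial>S)"
  proof (intro nn_integral_mono)
    fix \<omega>
    have "(\<Prod>j<N. ennreal (exp (l * f (\<omega> j)))) = ennreal (exp (l * (\<Sum>j<N. f (\<omega> j))))"
      by (simp add: prod_ennreal exp_sum sum_distrib_left)
    then have "ennreal (exp (- (l * T))) * (\<Prod>j<N. ennreal (exp (l * f (\<omega> j)))) = ennreal (exp (l * ((\<Sum>j<N. f (\<omega> j)) - T)))"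
      by (simp add: ennreal_mult[symmetric] exp_add[symmetric] algebra_simps)
    moreover have "1 \<le> exp (l * ((\<Sum>j<N. f (\<omega> j)) - T))" if "\<omega> \<in> ?A"
      using that l by simp
    ultimately show "indicator ?A \<omega> \<le> ennreal (exp (- (l * T))) * (\<Prod>j<N. ennreal (exp (l * f (\<omega> j))))"
      by (auto simp: indicator_def simp flip: ennreal_1 intro!: ennreal_leI simp del: exp_le_one_iff one_le_exp_iff)
  qed
  also have "\<dots> = ennreal (exp (- (l * T))) * (\<integral>\<^sup>+\<omega>. (\<Prod>j<N. ennreal (exp (l * f (\<omega> j)))) \<partial>S)"
    by (rule nn_integral_cmult) measurable
  also have "\<dots> = ennreal (exp (- (l * T))) * (\<integral>\<^sup>+x. ennreal (exp (l * f x)) \<partial>M) ^ N"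
    by (subst nn_integral_prod_iid[of "\<lambda>x. ennreal (exp (l * f x))"]) auto
  also have "\<dots> \<le> ennreal (exp (- (l * T))) * ennreal (exp (l * \<mu> + l\<^sup>2 * v)) ^ N"
    using mgf by (intro mult_left_mono power_mono) auto
  also have "\<dots> = ennreal (exp (real N * (l * \<mu> + l\<^sup>2 * v) - l * T))"
    by (simp add: ennreal_power ennreal_mult[symmetric] exp_of_nat_mult[symmetric] exp_add[symmetric] algebra_simps)
  finally show ?thesis .
qed

text \<open>Conditioning on the first \<open>n\<close> samples: a bound that holds for every fixed
  past, with a fresh continuation, holds for the whole sequence by Fubini.\<close>

lemma emeasure_comb_seq_le:
  assumes B: "B \<in> sets S" and le: "\<And>\<omega>. \<omega> \<in> space S \<Longrightarrow> emeasure S {\<omega>' \<in> space S. comb_seq n \<omega> \<omega>' \<in> B} \<le> \<delta>"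
  shows "emeasure S B \<le> \<delta>"
proof -
  have "emeasure S B = emeasure (distr (S \<Otimes>\<^sub>M S) S (\<lambda>(\<omega>, \<omega>'). comb_seq n \<omega> \<omega>')) B"
    by (simp only: PiM_comb_seq)
  also have "\<dots> = (\<integral>\<^sup>+\<omega>. indicator B \<omega> \<partial>distr (S \<Otimes>\<^sub>M S) S (\<lambda>(\<omega>, \<omega>'). comb_seq n \<omega> \<omega>'))"
    using B by simp
  also have "\<dots> = (\<integral>\<^sup>+p. indicator B (case p of (\<omega>, \<omega>') \<Rightarrow> comb_seq n \<omega> \<omega>') \<partial>(S \<Otimes>\<^sub>M S))"
    using B by (intro nn_integral_distr measurable_comb_seq) auto
  also have "\<dots> = (\<integral>\<^sup>+\<omega>. (\<integral>\<^sup>+\<omega>'. indicator B (comb_seq n \<omega> \<omega>') \<partial>S) \<partial>S)"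
    using B by (subst P.nn_integral_fst[symmetric]) (auto simp: case_prod_beta')
  also have "\<dots> \<le> (\<integral>\<^sup>+\<omega>. \<delta> \<partial>S)"
  proof (rule nn_integral_mono)
    fix \<omega> assume \<omega>: "\<omega> \<in> space S"
    have m: "{\<omega>' \<in> space S. comb_seq n \<omega> \<omega>' \<in> B} \<in> sets S"
      using B \<omega> by measurable
    have "(\<integral>\<^sup>+\<omega>'. indicator B (comb_seq n \<omega> \<omega>') \<partial>S) = (\<integral>\<^sup>+\<omega>'. indicator {\<omega>' \<in> space S. comb_seq n \<omega> \<omega>' \<in> B} \<omega>' \<partial>S)"
      by (intro nn_integral_cong) (simp add: indicator_def)
    then show "(\<integral>\<^sup>+\<omega>'. indicator B (comb_seq n \<omega> \<omega>') \<partial>S) \<le> \<delta>"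
      using le[OF \<omega>] m by simp
  qed
  also have "\<dots> = \<delta>"
    by (simp add: P.emeasure_space_1)
  finally show ?thesis .
qed

end

section \<open>The learner as a function of the sample\<close>

definition band_count :: "nat \<Rightarrow> nat \<Rightarrow> real \<Rightarrow> vec \<Rightarrow> (nat \<Rightarrow> vec) \<Rightarrow> nat \<Rightarrow> nat" where
  "band_count d r \<sigma> v x j = (\<Sum>l<j. if in_band d r \<sigma> v (x l) then 1 else 0)"

text \<open>The bound on \<open>band_count\<close> is the cap: only the first \<open>2 * M\<close>
  points in the band contribute, so a phase never requests more labels than that, whatever the
  outcome.\<close>

definition label_sum :: "nat \<Rightarrow> nat \<Rightarrow> real \<Rightarrow> nat \<Rightarrow> vec \<Rightarrow> (nat \<Rightarrow> vec) \<Rightarrow> (nat \<Rightarrow> real) \<Rightarrow> nat \<Rightarrow> vec" where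
  "label_sum d r \<sigma> M v x y j = (\<lambda>i. \<Sum>l<j. if in_band d r \<sigma> v (x l) \<and> band_count d r \<sigma> v x l < 2 * M
     then y l * x l i else 0)"

definition phase :: "nat \<Rightarrow> nat \<Rightarrow> real \<Rightarrow> nat \<Rightarrow> real \<Rightarrow> nat \<Rightarrow> vec \<Rightarrow> (nat \<Rightarrow> vec) \<Rightarrow> (nat \<Rightarrow> real) \<Rightarrow> vec" where
  "phase d r \<rho> M \<sigma> N v x y = advance d r \<rho> v (\<lambda>i. label_sum d r \<sigma> M v x y N i / real N)"

definition sine_bound :: "nat \<Rightarrow> real" where
  "sine_bound k = (15/16) ^ k / 2"

definition draws :: "nat \<Rightarrow> nat \<Rightarrow> nat" where
  "draws M k = nat \<lceil>real M / sine_bound k\<rceil>"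

definition offset :: "nat \<Rightarrow> nat \<Rightarrow> nat" where
  "offset M k = (\<Sum>i<k. draws M i)"

primrec direction :: "nat \<Rightarrow> nat \<Rightarrow> real \<Rightarrow> nat \<Rightarrow> (nat \<Rightarrow> vec) \<Rightarrow> (nat \<Rightarrow> real) \<Rightarrow> nat \<Rightarrow> vec" where
  "direction d r \<rho> M x y 0 = (\<lambda>i. 0)"
| "direction d r \<rho> M x y (Suc k) = phase d r \<rho> M (sine_bound k) (draws M k) (direction d r \<rho> M x y k)
     (\<lambda>l. x (offset M k + l)) (\<lambda>l. y (offset M k + l))"

definition example :: "nat \<Rightarrow> real \<Rightarrow> (vec \<times> bool \<times> bool) measure" where
  "example d \<eta> = uniform_sphere d \<Otimes>\<^sub>M (measure_pmf (bernoulli_pmf \<eta>) \<Otimes>\<^sub>M measure_pmf (bernoulli_pmf (1/2)))"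

definition noisy_label :: "nat \<Rightarrow> vec \<Rightarrow> vec \<times> bool \<times> bool \<Rightarrow> real" where
  "noisy_label d w e = (if fst (snd e) then - halfspace d w (fst e) else halfspace d w (fst e))"

section \<open>The distribution of a single example\<close>

lemma rcn_space_eq: "rcn_space d \<eta> = (\<Pi>\<^sub>M n\<in>UNIV. example d \<eta>)"
  by (simp add: rcn_space_def example_def)

lemma prob_space_example: "prob_space (example d \<eta>)"
  unfolding example_def
  by (intro prob_space_pair prob_space_uniform_sphere prob_space_measure_pmf)

lemma distr_example_fst: "distr (example d \<eta>) (uniform_sphere d) fst = uniform_sphere d"
  unfolding example_def
  by (intro prob_space.distr_pair_fst prob_space_pair prob_space_measure_pmf)

lemma fst_measurable_example [measurable]: "fst \<in> example d \<eta> \<rightarrow>\<^sub>M uniform_sphere d"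
  unfolding example_def by measurable

lemma AE_example_fst:
  assumes "AE z in uniform_sphere d. P z"
  shows "AE e in example d \<eta>. P (fst e)"
proof -
  have "AE z in distr (example d \<eta>) (uniform_sphere d) fst. P z"
    unfolding distr_example_fst by (rule assms)
  then show ?thesis
    by (rule AE_distrD[OF fst_measurable_example])
qed

lemma integral_example_fst:
  fixes f :: "vec \<Rightarrow> real"
  assumes "f \<in> borel_measurable (uniform_sphere d)"
  shows "(\<integral>e. f (fst e) \<partial>example d \<eta>) = (\<integral>z. f z \<partial>uniform_sphere d)"
  using integral_distr[OF fst_measurable_example assms, of \<eta>] by (simp add: distr_example_fst)

lemma noisy_label_measurable [measurable]: "noisy_label d w \<in> borel_measurable (example d \<eta>)"
proof -
  have [measurable]: "(\<lambda>e. fst (snd e)) \<in> example d \<eta> \<rightarrow>\<^sub>M count_space UNIV"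
    unfolding example_def by measurable
  have [measurable]: "(\<lambda>e. ip d w (fst e)) \<in> borel_measurable (example d \<eta>)"
    using measurable_compose[OF fst_measurable_example ip_measurable_uniform_sphere] .
  show ?thesis
    unfolding noisy_label_def halfspace_eq by measurable
qed

lemma abs_noisy_label [simp]: "\<bar>noisy_label d w e\<bar> = 1"
  by (simp add: noisy_label_def halfspace_eq)

text \<open>Integrating out the noise bit multiplies the clean label by (1 - eta) - eta.\<close>

lemma integral_noisy_label:
  fixes h :: "vec \<Rightarrow> real"
  assumes \<eta>: "0 \<le> \<eta>" "\<eta> \<le> 1" and d: "d \<ge> 1"
    and h: "h \<in> borel_measurable (uniform_sphere d)" and h1: "\<And>z. z \<in> unit_sphere d \<Longrightarrow> \<bar>h z\<bar> \<le> 1"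
  shows "(\<integral>e. noisy_label d w e * h (fst e) \<partial>example d \<eta>) =
    (1 - 2 * \<eta>) * (\<integral>z. halfspace d w z * h z \<partial>uniform_sphere d)"
proof -
  let ?B = "measure_pmf (bernoulli_pmf \<eta>) \<Otimes>\<^sub>M measure_pmf (bernoulli_pmf (1/2))"
  let ?f = "\<lambda>z b. noisy_label d w (z, b) * h z"
  interpret B: prob_space ?B
    by (intro prob_space_pair prob_space_measure_pmf)
  interpret U: prob_space "uniform_sphere d"
    by (rule prob_space_uniform_sphere)
  interpret pair_sigma_finite "uniform_sphere d" ?B
    by standard
  interpret E: prob_space "example d \<eta>"
    by (rule prob_space_example)
  have [measurable]: "(\<lambda>e. h (fst e)) \<in> borel_measurable (example d \<eta>)"
    using measurable_compose[OF fst_measurable_example h] .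
  have "AE e in example d \<eta>. \<bar>h (fst e)\<bar> \<le> 1"
    using AE_example_fst[OF AE_uniform_sphere[OF d], of \<eta>] by eventually_elim (rule h1)
  then have "integrable (example d \<eta>) (\<lambda>e. noisy_label d w e * h (fst e))"
    by (intro E.integrable_const_bound[of _ 1]) (auto simp: abs_mult)
  then have int: "integrable (uniform_sphere d \<Otimes>\<^sub>M ?B) (case_prod ?f)"
    by (simp add: example_def case_prod_beta')
  have "(\<integral>e. noisy_label d w e * h (fst e) \<partial>example d \<eta>) = (\<integral>z. (\<integral>b. ?f z b \<partial>?B) \<partial>uniform_sphere d)"
    unfolding integral_fst[OF int] by (simp add: example_def case_prod_beta')
  also have "\<dots> = (\<integral>z. (1 - 2 * \<eta>) * (halfspace d w z * h z) \<partial>uniform_sphere d)"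
  proof (rule Bochner_Integration.integral_cong[OF refl])
    fix z
    have "(\<integral>b. ?f z b \<partial>?B) = (\<integral>b. (\<lambda>c. if c then - (halfspace d w z * h z) else halfspace d w z * h z) (fst b) \<partial>?B)"
      by (intro Bochner_Integration.integral_cong) (auto simp: noisy_label_def)
    also have "\<dots> = (\<integral>c. (if c then - (halfspace d w z * h z) else halfspace d w z * h z)
        \<partial>distr ?B (measure_pmf (bernoulli_pmf \<eta>)) fst)"
      by (rule integral_distr[symmetric]) auto
    also have "distr ?B (measure_pmf (bernoulli_pmf \<eta>)) fst = measure_pmf (bernoulli_pmf \<eta>)"
      by (intro prob_space.distr_pair_fst prob_space_measure_pmf)
    also have "(\<integral>c. (if c then - (halfspace d w z * h z) else halfspace d w z * h z) \<partial>measure_pmf (bernoulli_pmf \<eta>)) =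
        (1 - 2 * \<eta>) * (halfspace d w z * h z)"
      using \<eta> by (simp add: integral_bernoulli_pmf algebra_simps)
    finally show "(\<integral>b. ?f z b \<partial>?B) = (1 - 2 * \<eta>) * (halfspace d w z * h z)" .
  qed
  finally show ?thesis by simp
qed

lemma sequence_space_example: "sequence_space (example d \<eta>)"
proof -
  interpret prob_space "example d \<eta>" by (rule prob_space_example)
  show ?thesis by standard
qed

lemma in_band_measurable [measurable]: "Measurable.pred (uniform_sphere d) (in_band d r \<sigma> v)"
  unfolding in_band_def by measurable

text \<open>The slab bound 2 b sqrt d for b = sigma / (20 r), with sqrt d <= r.\<close>

lemma slab_probability:
  assumes d: "d \<ge> 1" and r: "real d \<le> (real r)\<^sup>2" and \<sigma>: "0 < \<sigma>" and w: "ip d w w = 1" and g: "good d w \<sigma> v"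
  shows "(\<integral>z. (if in_band d r \<sigma> v z then 1 else 0) \<partial>uniform_sphere d) \<le> \<sigma> / 10"
proof -
  interpret prob_space "uniform_sphere d"
    by (rule prob_space_uniform_sphere)
  obtain \<nu> p u c s where "plane_coords d w \<sigma> v \<nu> p u c s"
    using good_decomposition[OF g w \<sigma>(1)] .
  note dec = plane_coordsD[OF this]
  have "real r \<noteq> 0" using d r by (cases "r = 0") auto
  then have r0: "real r > 0" by simp
  note band = in_band_iff[OF dec(1,3,4) r0 less_imp_le[OF \<sigma>]]
  have sd: "sqrt (real d) \<le> real r"
    using r by (intro real_le_lsqrt) auto
  let ?A = "{z \<in> space (uniform_sphere d). \<bar>ip d p z\<bar> \<le> \<sigma> / (20 * real r)}"
  have A: "?A \<in> sets (uniform_sphere d)"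
    by measurable
  have "(\<integral>z. (if in_band d r \<sigma> v z then 1 else 0) \<partial>uniform_sphere d) = (\<integral>z. indicator ?A z \<partial>uniform_sphere d)"
    by (intro Bochner_Integration.integral_cong) (auto simp: band indicator_def)
  also have "\<dots> = prob ?A"
    using A by simp
  also have "\<dots> \<le> 2 * (\<sigma> / (20 * real r)) * sqrt (real d)"
  proof -
    have "ennreal (prob ?A) \<le> ennreal (2 * (\<sigma> / (20 * real r)) * sqrt (real d))"
      unfolding emeasure_eq_measure[symmetric] using \<sigma> by (intro emeasure_slab_le[OF d dec(4)]) simp
    then show ?thesis
      using \<sigma> by (subst (asm) ennreal_le_iff) auto
  qed
  also have "\<dots> \<le> 2 * (\<sigma> / (20 * real r)) * real r"
    using sd \<sigma> by (intro mult_left_mono) auto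
  also have "\<dots> = \<sigma> / 10"
    using r0 by simp
  finally show ?thesis .
qed

lemma band_count_mono: "i \<le> j \<Longrightarrow> band_count d r \<sigma> v x i \<le> band_count d r \<sigma> v x j"
  unfolding band_count_def by (intro sum_mono2) auto

lemma band_count_le: "band_count d r \<sigma> v x j \<le> j"
proof -
  have "band_count d r \<sigma> v x j \<le> (\<Sum>l<j. 1)"
    unfolding band_count_def by (intro sum_mono) auto
  then show ?thesis by simp
qed

text \<open>Equality with \<open>2 * M\<close> is allowed, because the count before a point of the
  band is one less than the count after it.\<close>

lemma label_sum_uncapped:
  assumes "band_count d r \<sigma> v x N \<le> 2 * M"
  shows "label_sum d r \<sigma> M v x y N i = (\<Sum>l<N. if in_band d r \<sigma> v (x l) then y l * x l i else 0)"
  unfolding label_sum_def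
proof (intro sum.cong refl)
  fix l assume "l \<in> {..<N}"
  then have "band_count d r \<sigma> v x (Suc l) \<le> 2 * M"
    using band_count_mono[of "Suc l" N d r \<sigma> v x] assms by simp
  then show "(if in_band d r \<sigma> v (x l) \<and> band_count d r \<sigma> v x l < 2 * M then y l * x l i else 0) =
      (if in_band d r \<sigma> v (x l) then y l * x l i else 0)"
    by (auto simp: band_count_def)
qed

text \<open>Here \<open>v\<close> is fixed; it stands for a direction computed from earlier
  examples. \<open>U\<close> collects three kinds of failure: some coordinate of the sum too large,
  some coordinate too small, or too many points in the band. Outside \<open>U\<close> the cap has no
  effect and the estimate is accurate, so \<open>good_advance\<close> or
  \<open>good_initial_advance\<close> applies.\<close>

lemma phase_failure:
  fixes d r M N :: nat and \<eta> \<rho> \<sigma> L :: real and w v :: vec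
  assumes d: "d \<ge> 1" and r: "real d \<le> (real r)\<^sup>2" "(real r)\<^sup>2 \<le> 4 * real d" and w: "ip d w w = 1"
    and \<eta>: "0 \<le> \<eta>" "\<eta> < 1/2" and \<rho>: "\<rho> = 1 - 2 * \<eta>" and \<sigma>: "0 < \<sigma>" "\<sigma> \<le> 1/2"
    and M: "M \<ge> 1" and N: "real M \<le> real N * \<sigma>" "real N * \<sigma> \<le> real M + \<sigma>"
    and start: "v = (\<lambda>i. 0) \<and> \<sigma> = 1/2 \<and> N = 2 * M \<or> good d w \<sigma> v"
    and big: "1280000 * (real r) ^ 4 * L \<le> real M * \<rho>\<^sup>2" and L: "L \<ge> 1"
  defines "S \<equiv> rcn_space d \<eta>"
  shows "\<exists>U\<in>sets S. emeasure S U \<le> ennreal (3 * real d * exp (- 4 * L)) \<and>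
    (\<forall>\<omega>\<in>space S - U. good d w (15/16 * \<sigma>) (phase d r \<rho> M \<sigma> N v (\<lambda>l. fst (\<omega> l)) (\<lambda>l. noisy_label d w (\<omega> l))))"
proof -
  interpret E: sequence_space "example d \<eta>"
    by (rule sequence_space_example)
  have S: "S = E.S"
    by (simp add: S_def rcn_space_eq)
  have \<rho>0: "0 < \<rho>" "\<rho> \<le> 1" using \<eta> \<rho> by auto
  have "real r \<noteq> 0" using d r by (cases "r = 0") auto
  then have r0: "real r > 0" "real r \<ge> 1" by auto
  define \<tau> where "\<tau> = \<rho> * \<sigma> / (200 * (real r)\<^sup>2)"
  define X where "X = (\<lambda>i e. if in_band d r \<sigma> v (fst e) then noisy_label d w e * fst e i else 0)"
  define I where "I = (\<lambda>e::vec \<times> bool \<times> bool. if in_band d r \<sigma> v (fst e) then 1 else 0 :: real)"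
  have AEs: "AE e in example d \<eta>. fst e \<in> unit_sphere d"
    using AE_example_fst[OF AE_uniform_sphere[OF d]] .
  have [measurable]: "Measurable.pred (example d \<eta>) (\<lambda>e. in_band d r \<sigma> v (fst e))"
    using measurable_compose[OF fst_measurable_example in_band_measurable] .
  have Xm: "X i \<in> borel_measurable (example d \<eta>)" if "i < d" for i
  proof -
    have [measurable]: "(\<lambda>e. fst e i) \<in> borel_measurable (example d \<eta>)"
      using measurable_compose[OF fst_measurable_example coord_measurable_uniform_sphere[OF that]] .
    show ?thesis unfolding X_def by measurable
  qed
  have Im: "I \<in> borel_measurable (example d \<eta>)"
    unfolding I_def by measurable
  have X1: "AE e in example d \<eta>. \<bar>X i e\<bar> \<le> 1" if "i < d" for i
    using AEs by eventually_elim (auto simp: X_def abs_mult abs_coord_le_1[OF _ that])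
  have X2: "AE e in example d \<eta>. (X i e)\<^sup>2 \<le> I e" if "i < d" for i
    using X1[OF that] by eventually_elim (auto simp: X_def I_def abs_square_le_1)
  have I1: "\<bar>I e\<bar> \<le> 1" "0 \<le> I e" "(I e)\<^sup>2 = I e" for e
    by (auto simp: I_def)
  have Iint: "integrable (example d \<eta>) I"
    using Im I1 by (intro E.M.integrable_const_bound[of _ 1]) auto
  have EI': "(\<integral>e. I e \<partial>example d \<eta>) = (\<integral>z. (if in_band d r \<sigma> v z then 1 else 0) \<partial>uniform_sphere d)"
    unfolding I_def by (rule integral_example_fst) measurable
  have EI_good: "(\<integral>e. I e \<partial>example d \<eta>) \<le> \<sigma> / 10" if "good d w \<sigma> v"
    unfolding EI' by (rule slab_probability[OF d r(1) \<sigma>(1) w that])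
  \<comment> \<open>For the zero start every point is in the band, and the trivial bound 1 equals
    \<open>2 * \<sigma>\<close> as sigma = 1/2. So one second-moment bound serves all
    phases.\<close>
  have EI: "(\<integral>e. I e \<partial>example d \<eta>) \<le> 2 * \<sigma>"
  proof (cases "good d w \<sigma> v")
    case False
    then have "2 * \<sigma> = 1" using start by simp
    moreover have "(\<integral>e. I e \<partial>example d \<eta>) \<le> (\<integral>e. 1 \<partial>example d \<eta>)"
      using Iint I1(1) by (intro integral_mono) (auto simp: abs_le_iff)
    ultimately show ?thesis by (simp add: E.M.prob_space)
  qed (use EI_good \<sigma> in linarith)
  have EX: "(\<integral>e. X i e \<partial>example d \<eta>) = \<rho> * moment d w r \<sigma> v i" if i: "i < d" for i
  proof -
    have "(\<integral>e. X i e \<partial>example d \<eta>) = (\<integral>e. noisy_label d w e * (\<lambda>z. if in_band d r \<sigma> v z then z i else 0) (fst e) \<partial>example d \<eta>)"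
      by (intro Bochner_Integration.integral_cong) (auto simp: X_def)
    also have "\<dots> = (1 - 2 * \<eta>) * (\<integral>z. halfspace d w z * (if in_band d r \<sigma> v z then z i else 0) \<partial>uniform_sphere d)"
    proof (rule integral_noisy_label)
      have [measurable]: "(\<lambda>z. z i) \<in> borel_measurable (uniform_sphere d)"
        by (rule coord_measurable_uniform_sphere[OF i])
      show "(\<lambda>z. if in_band d r \<sigma> v z then z i else 0) \<in> borel_measurable (uniform_sphere d)"
        by measurable
    qed (use \<eta> d abs_coord_le_1[OF _ i] in auto)
    also have "(\<integral>z. halfspace d w z * (if in_band d r \<sigma> v z then z i else 0) \<partial>uniform_sphere d) = moment d w r \<sigma> v i"
      unfolding moment_def by (intro Bochner_Integration.integral_cong) auto
    finally show ?thesis by (simp add: \<rho>)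
  qed
  have EX2: "(\<integral>e. (X i e)\<^sup>2 \<partial>example d \<eta>) \<le> 2 * \<sigma>" if i: "i < d" for i
  proof -
    have "integrable (example d \<eta>) (\<lambda>e. (X i e)\<^sup>2)"
      using X1[OF i] Xm[OF i] by (intro E.M.integrable_const_bound[of _ 1]) (auto simp: abs_square_le_1)
    then have "(\<integral>e. (X i e)\<^sup>2 \<partial>example d \<eta>) \<le> (\<integral>e. I e \<partial>example d \<eta>)"
      using Iint X2[OF i] by (intro integral_mono_AE) auto
    then show ?thesis using EI by linarith
  qed
  \<comment> \<open>The minimizer tau / (4 sigma) of 2 sigma lam^2 - lam tau. Its value there,
    -rho^2 sigma / (320000 r^4), times N >= M / sigma is at most -4 L by the hypothesis on M; this
    is the origin of 1280000 = 4 * 320000.\<close>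
  define lam where "lam = \<rho> / (800 * (real r)\<^sup>2)"
  have r2: "1 \<le> (real r)\<^sup>2" using r0 by (simp add: one_le_power)
  have lam: "0 \<le> lam" "lam \<le> 1"
  proof -
    have "\<rho> \<le> 800 * (real r)\<^sup>2"
      using \<rho>0 r2 by linarith
    then show "0 \<le> lam" "lam \<le> 1"
      using \<rho>0 r0 by (simp_all add: lam_def)
  qed
  have expo: "real N * (lam * m + lam\<^sup>2 * (2 * \<sigma>)) - lam * (real N * (m + \<tau>)) \<le> - 4 * L" for m
  proof -
    have eq: "lam\<^sup>2 * (2 * \<sigma>) - lam * \<tau> = - (\<rho>\<^sup>2 * \<sigma> / (320000 * (real r)^4))"
      using r0 by (simp add: lam_def \<tau>_def power_divide power_mult_distrib field_simps power2_eq_square power4_eq_xxxx)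
    have "real N * (lam * m + lam\<^sup>2 * (2 * \<sigma>)) - lam * (real N * (m + \<tau>)) = real N * (lam\<^sup>2 * (2 * \<sigma>) - lam * \<tau>)"
      by (simp add: algebra_simps)
    also have "\<dots> = - ((real N * \<sigma>) * \<rho>\<^sup>2 / (320000 * (real r)^4))"
      unfolding eq by simp
    also have "\<dots> \<le> - (real M * \<rho>\<^sup>2 / (320000 * (real r)^4))"
      using N(1) by (simp add: divide_right_mono mult_right_mono)
    also have "\<dots> \<le> - 4 * L"
      using big r0 by (simp add: field_simps)
    finally show ?thesis .
  qed
  define U1 where "U1 = (\<lambda>i. {\<omega> \<in> space S. real N * (\<rho> * moment d w r \<sigma> v i + \<tau>) \<le> (\<Sum>l<N. X i (\<omega> l))})"
  define U2 where "U2 = (\<lambda>i. {\<omega> \<in> space S. real N * (- (\<rho> * moment d w r \<sigma> v i) + \<tau>) \<le> (\<Sum>l<N. - X i (\<omega> l))})"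
  \<comment> \<open>For the zero start there are only \<open>2 * M\<close> draws, so the cap has no
    effect and this event can be empty.\<close>
  define U3 where "U3 = (if good d w \<sigma> v then {\<omega> \<in> space S. real (2 * M) \<le> (\<Sum>l<N. I (\<omega> l))} else {})"
  have sumX: "(\<lambda>\<omega>. \<Sum>l<N. f (\<omega> l)) \<in> borel_measurable S" if [measurable]: "f \<in> borel_measurable (example d \<eta>)" for f :: "_ \<Rightarrow> real"
    unfolding S by measurable
  have sets: "U1 i \<in> sets S" "U2 i \<in> sets S" if "i < d" for i
    using sumX[OF Xm[OF that]] sumX[OF borel_measurable_uminus[OF Xm[OF that]]]
    unfolding U1_def U2_def by measurable
  have set3: "U3 \<in> sets S"
  proof -
    have [measurable]: "(\<lambda>\<omega>. \<Sum>l<N. I (\<omega> l)) \<in> borel_measurable S"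
      by (rule sumX[OF Im])
    have "{\<omega> \<in> space S. real (2 * M) \<le> (\<Sum>l<N. I (\<omega> l))} \<in> sets S"
      by measurable
    then show ?thesis
      by (simp add: U3_def)
  qed
  have U1: "emeasure S (U1 i) \<le> ennreal (exp (- 4 * L))" if i: "i < d" for i
  proof -
    have "emeasure S (U1 i) \<le> ennreal (exp (real N * (lam * (\<rho> * moment d w r \<sigma> v i) + lam\<^sup>2 * (2 * \<sigma>))
        - lam * (real N * (\<rho> * moment d w r \<sigma> v i + \<tau>))))"
      unfolding U1_def S using Xm[OF i] X1[OF i] EX[OF i] EX2[OF i] lam by (intro E.Chernoff_iid) auto
    also have "\<dots> \<le> ennreal (exp (- 4 * L))"
      using expo by (intro ennreal_leI) simp
    finally show ?thesis .
  qed
  have U2: "emeasure S (U2 i) \<le> ennreal (exp (- 4 * L))" if i: "i < d" for i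
  proof -
    have "emeasure S (U2 i) \<le> ennreal (exp (real N * (lam * (- (\<rho> * moment d w r \<sigma> v i)) + lam\<^sup>2 * (2 * \<sigma>))
        - lam * (real N * (- (\<rho> * moment d w r \<sigma> v i) + \<tau>))))"
      unfolding U2_def S using Xm[OF i] X1[OF i] EX[OF i] EX2[OF i] lam
      by (intro E.Chernoff_iid[where f="\<lambda>e. - X i e"]) auto
    also have "\<dots> \<le> ennreal (exp (- 4 * L))"
      using expo[of "- (\<rho> * moment d w r \<sigma> v i)"] by (intro ennreal_leI) simp
    finally show ?thesis .
  qed
  have LM: "4 * L \<le> real M"
  proof -
    have "1 \<le> (real r) ^ 4" using r0 by (simp add: one_le_power)
    then have "1280000 * L \<le> 1280000 * (real r) ^ 4 * L"
      using L by simp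
    also have "\<dots> \<le> real M * 1"
      using big \<rho>0 by (intro order_trans[OF big] mult_left_mono) (auto simp: power_le_one)
    finally show ?thesis using L by simp
  qed
  have U3: "emeasure S U3 \<le> ennreal (exp (- 4 * L))"
  proof (cases "good d w \<sigma> v")
    case True
    have "emeasure S U3 \<le> ennreal (exp (real N * (1 * (\<sigma> / 10) + 1\<^sup>2 * (\<sigma> / 10)) - 1 * real (2 * M)))"
      unfolding U3_def S using True Im I1 EI_good[OF True] by (simp only: if_True) (intro E.Chernoff_iid, auto)
    also have "\<dots> \<le> ennreal (exp (- 4 * L))"
    proof (intro ennreal_leI, simp only: exp_le_cancel_iff)
      have "real N * (1 * (\<sigma> / 10) + 1\<^sup>2 * (\<sigma> / 10)) - 1 * real (2 * M) = (real N * \<sigma>) / 5 - 2 * real M"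
        by simp
      also have "\<dots> \<le> - 4 * L"
        using N(2) \<sigma> LM M by simp
      finally show "real N * (1 * (\<sigma> / 10) + 1\<^sup>2 * (\<sigma> / 10)) - 1 * real (2 * M) \<le> - 4 * L" .
    qed
    finally show ?thesis .
  qed (simp add: U3_def)
  define U where "U = ((\<Union>i\<in>{..<d}. U1 i) \<union> (\<Union>i\<in>{..<d}. U2 i)) \<union> U3"
  show ?thesis
  proof (intro bexI[of _ U] conjI ballI)
    show Us: "U \<in> sets S"
      unfolding U_def using sets set3 by auto
    have "emeasure S U \<le> ((\<Sum>i<d. emeasure S (U1 i)) + (\<Sum>i<d. emeasure S (U2 i))) + emeasure S U3"
      unfolding U_def using sets set3
      by (intro order_trans[OF emeasure_subadditive] add_mono order_refl emeasure_subadditive_finite) auto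
    also have "\<dots> \<le> ((\<Sum>i<d. ennreal (exp (- 4 * L))) + (\<Sum>i<d. ennreal (exp (- 4 * L)))) + ennreal (exp (- 4 * L))"
      using U1 U2 U3 by (intro add_mono sum_mono) auto
    also have "\<dots> = ennreal (real d * exp (- 4 * L) + real d * exp (- 4 * L) + exp (- 4 * L))"
    proof -
      have s: "(\<Sum>i<d. ennreal (exp (- 4 * L))) = ennreal (real d * exp (- 4 * L))"
        by (subst sum_ennreal) auto
      show ?thesis
        unfolding s by (simp only: ennreal_plus add_nonneg_nonneg mult_nonneg_nonneg of_nat_0_le_iff exp_ge_zero)
    qed
    also have "\<dots> \<le> ennreal (3 * real d * exp (- 4 * L))"
    proof (intro ennreal_leI)
      have "1 * exp (- 4 * L) \<le> real d * exp (- 4 * L)"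
        using d by (intro mult_right_mono) auto
      then show "real d * exp (- 4 * L) + real d * exp (- 4 * L) + exp (- 4 * L) \<le> 3 * real d * exp (- 4 * L)"
        by simp
    qed
    finally show "emeasure S U \<le> ennreal (3 * real d * exp (- 4 * L))" .
    fix \<omega> assume \<omega>: "\<omega> \<in> space S - U"
    let ?x = "\<lambda>l. fst (\<omega> l)" and ?y = "\<lambda>l. noisy_label d w (\<omega> l)"
    have cap: "band_count d r \<sigma> v ?x N \<le> 2 * M"
    proof (cases "good d w \<sigma> v")
      case True
      then have "(\<Sum>l<N. I (\<omega> l)) < real (2 * M)"
        using \<omega> by (auto simp: U_def U3_def)
      moreover have "(\<Sum>l<N. I (\<omega> l)) = real (band_count d r \<sigma> v ?x N)"
        by (simp add: band_count_def I_def if_distrib cong: if_cong)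
      ultimately show ?thesis by simp
    next
      case False
      then show ?thesis
        using start band_count_le[of d r \<sigma> v ?x N] by simp
    qed
    define g where "g = (\<lambda>i. label_sum d r \<sigma> M v ?x ?y N i / real N)"
    have N0: "real N > 0"
      using N(1) M by (cases "N = 0") auto
    have est: "\<bar>g i - \<rho> * moment d w r \<sigma> v i\<bar> \<le> \<rho> * \<sigma> / (200 * (real r)\<^sup>2)" if i: "i < d" for i
    proof -
      have gi: "g i = (\<Sum>l<N. X i (\<omega> l)) / real N"
        unfolding g_def label_sum_uncapped[OF cap] X_def ..
      have "(\<Sum>l<N. X i (\<omega> l)) < real N * (\<rho> * moment d w r \<sigma> v i + \<tau>)"
        "- (\<Sum>l<N. X i (\<omega> l)) < real N * (- (\<rho> * moment d w r \<sigma> v i) + \<tau>)"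
        using \<omega> i by (auto simp: U_def U1_def U2_def sum_negf not_le)
      then have "g i < \<rho> * moment d w r \<sigma> v i + \<tau>" "- g i < - (\<rho> * moment d w r \<sigma> v i) + \<tau>"
        using N0 by (auto simp: gi field_simps)
      then show ?thesis
        unfolding \<tau>_def[symmetric] by linarith
    qed
    show "good d w (15/16 * \<sigma>) (phase d r \<rho> M \<sigma> N v ?x ?y)"
      unfolding phase_def g_def[symmetric]
    proof (cases "good d w \<sigma> v")
      case True
      then show "good d w (15/16 * \<sigma>) (advance d r \<rho> v g)"
        using good_advance[OF d r(1) w \<sigma> \<rho>0(1) _ est] by blast
    next
      case False
      then have v: "v = (\<lambda>i. 0)" "\<sigma> = 1/2" using start by auto
      show "good d w (15/16 * \<sigma>) (advance d r \<rho> v g)"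
        using good_initial_advance[OF d r w \<rho>0(1), of g] est unfolding v by blast
    qed
  qed
qed

section \<open>Measurability and locality of the computed directions\<close>

lemma ip_measurable_family:
  assumes "\<And>i. i < d \<Longrightarrow> (\<lambda>\<omega>. f \<omega> i) \<in> borel_measurable A" "\<And>i. i < d \<Longrightarrow> (\<lambda>\<omega>. g \<omega> i) \<in> borel_measurable A"
  shows "(\<lambda>\<omega>. ip d (f \<omega>) (g \<omega>)) \<in> borel_measurable A"
  unfolding ip_def using assms by (intro borel_measurable_sum borel_measurable_times) auto

lemma newton_pow_measurable:
  assumes "\<And>i. i < d \<Longrightarrow> (\<lambda>\<omega>. f \<omega> i) \<in> borel_measurable A" "i < d"
  shows "(\<lambda>\<omega>. (newton d ^^ k) (f \<omega>) i) \<in> borel_measurable A"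
  using assms(2)
proof (induction k arbitrary: i)
  case (Suc k)
  have [measurable]: "(\<lambda>\<omega>. ip d ((newton d ^^ k) (f \<omega>)) ((newton d ^^ k) (f \<omega>))) \<in> borel_measurable A"
    using Suc.IH by (intro ip_measurable_family) auto
  have [measurable]: "(\<lambda>\<omega>. (newton d ^^ k) (f \<omega>) i) \<in> borel_measurable A"
    using Suc by simp
  have "(\<lambda>\<omega>. 2 * (newton d ^^ k) (f \<omega>) i / (1 + ip d ((newton d ^^ k) (f \<omega>)) ((newton d ^^ k) (f \<omega>)))) \<in> borel_measurable A"
    by measurable
  then show ?case
    by (subst funpow.simps, subst comp_apply, subst newton_def)
qed (use assms(1) in simp)

lemma advance_measurable:
  assumes v: "\<And>i. i < d \<Longrightarrow> (\<lambda>\<omega>. v \<omega> i) \<in> borel_measurable A" and g: "\<And>i. i < d \<Longrightarrow> (\<lambda>\<omega>. g \<omega> i) \<in> borel_measurable A"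
    and i: "i < d"
  shows "(\<lambda>\<omega>. advance d r \<rho> (v \<omega>) (g \<omega>) i) \<in> borel_measurable A"
  unfolding advance_def correction_def
proof (rule newton_pow_measurable[OF _ i])
  fix i assume i: "i < d"
  have [measurable]: "(\<lambda>\<omega>. ip d (v \<omega>) (g \<omega>)) \<in> borel_measurable A" "(\<lambda>\<omega>. ip d (v \<omega>) (v \<omega>)) \<in> borel_measurable A"
    "(\<lambda>\<omega>. v \<omega> i) \<in> borel_measurable A" "(\<lambda>\<omega>. g \<omega> i) \<in> borel_measurable A"
    using v g i by (auto intro!: ip_measurable_family)
  show "(\<lambda>\<omega>. v \<omega> i + 10 * real r / \<rho> * (g \<omega> i - ip d (v \<omega>) (g \<omega>) / ip d (v \<omega>) (v \<omega>) * v \<omega> i)) \<in> borel_measurable A"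
    by measurable
qed

lemma phase_measurable:
  assumes v: "\<And>i. i < d \<Longrightarrow> (\<lambda>\<omega>. v \<omega> i) \<in> borel_measurable A"
    and x: "\<And>l i. i < d \<Longrightarrow> (\<lambda>\<omega>. x \<omega> l i) \<in> borel_measurable A" and y: "\<And>l. (\<lambda>\<omega>. y \<omega> l) \<in> borel_measurable A"
    and i: "i < d"
  shows "(\<lambda>\<omega>. phase d r \<rho> M \<sigma> N (v \<omega>) (x \<omega>) (y \<omega>) i) \<in> borel_measurable A"
  unfolding phase_def
proof (rule advance_measurable[OF v _ i])
  fix i assume i: "i < d"
  have b [measurable]: "Measurable.pred A (\<lambda>\<omega>. in_band d r \<sigma> (v \<omega>) (x \<omega> l))" for l
  proof -
    have [measurable]: "(\<lambda>\<omega>. ip d (v \<omega>) (x \<omega> l)) \<in> borel_measurable A" "(\<lambda>\<omega>. ip d (v \<omega>) (v \<omega>)) \<in> borel_measurable A"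
      using v x by (auto intro!: ip_measurable_family)
    show ?thesis
      unfolding in_band_def by measurable
  qed
  have [measurable]: "(\<lambda>\<omega>. band_count d r \<sigma> (v \<omega>) (x \<omega>) l) \<in> A \<rightarrow>\<^sub>M count_space UNIV" for l
    unfolding band_count_def by measurable
  have [measurable]: "(\<lambda>\<omega>. x \<omega> l i) \<in> borel_measurable A" "(\<lambda>\<omega>. y \<omega> l) \<in> borel_measurable A" for l
    using x i y by auto
  show "(\<lambda>\<omega>. label_sum d r \<sigma> M (v \<omega>) (x \<omega>) (y \<omega>) N i / real N) \<in> borel_measurable A"
    unfolding label_sum_def by measurable
qed

lemma direction_measurable:
  assumes x: "\<And>l i. i < d \<Longrightarrow> (\<lambda>\<omega>. x \<omega> l i) \<in> borel_measurable A" and y: "\<And>l. (\<lambda>\<omega>. y \<omega> l) \<in> borel_measurable A"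
    and i: "i < d"
  shows "(\<lambda>\<omega>. direction d r \<rho> M (x \<omega>) (y \<omega>) k i) \<in> borel_measurable A"
  using i
proof (induction k arbitrary: i)
  case (Suc k)
  then show ?case
    using x y by (simp, intro phase_measurable) auto
qed simp

lemma good_measurable:
  assumes "\<And>i. i < d \<Longrightarrow> (\<lambda>\<omega>. v \<omega> i) \<in> borel_measurable A"
  shows "Measurable.pred A (\<lambda>\<omega>. good d w \<sigma> (v \<omega>))"
proof -
  have [measurable]: "(\<lambda>\<omega>. ip d (v \<omega>) (v \<omega>)) \<in> borel_measurable A" "(\<lambda>\<omega>. ip d (v \<omega>) w) \<in> borel_measurable A"
    using assms by (auto intro!: ip_measurable_family)
  show ?thesis
    unfolding good_def by measurable
qed

lemma phase_cong:
  assumes "\<And>l. l < N \<Longrightarrow> x l = x' l" "\<And>l. l < N \<Longrightarrow> y l = y' l"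
  shows "phase d r \<rho> M \<sigma> N v x y = phase d r \<rho> M \<sigma> N v x' y'"
proof -
  have "band_count d r \<sigma> v x l = band_count d r \<sigma> v x' l" if "l < N" for l
    unfolding band_count_def using that assms by (intro sum.cong) auto
  then have "label_sum d r \<sigma> M v x y N = label_sum d r \<sigma> M v x' y' N"
    unfolding label_sum_def using assms by (intro ext sum.cong) auto
  then show ?thesis
    by (simp add: phase_def)
qed

text \<open>The direction before phase \<open>k\<close> depends on the first
  \<open>offset M k\<close> examples only. This leaves the examples of phase \<open>k\<close> fresh,
  as \<open>emeasure_comb_seq_le\<close> requires.\<close>

lemma direction_cong:
  assumes "\<And>l. l < offset M k \<Longrightarrow> x l = x' l" "\<And>l. l < offset M k \<Longrightarrow> y l = y' l"
  shows "direction d r \<rho> M x y k = direction d r \<rho> M x' y' k"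
  using assms
proof (induction k)
  case (Suc k)
  have "direction d r \<rho> M x y k = direction d r \<rho> M x' y' k"
    using Suc.prems by (intro Suc.IH) (auto simp: offset_def)
  moreover have "x (offset M k + l) = x' (offset M k + l)" "y (offset M k + l) = y' (offset M k + l)"
    if "l < draws M k" for l
    using Suc.prems that by (auto simp: offset_def)
  ultimately show ?case
    by (auto intro!: phase_cong)
qed simp

lemma sine_bound_pos [simp]: "0 < sine_bound k"
  by (simp add: sine_bound_def)

lemma sine_bound_Suc: "sine_bound (Suc k) = 15/16 * sine_bound k"
  by (simp add: sine_bound_def)

lemma sine_bound_le: "sine_bound k \<le> 1/2"
  by (simp add: sine_bound_def power_le_one)

text \<open>The last equation matches the cap: in the first phase, where every point is in the band,
  there are no more than \<open>2 * M\<close> draws.\<close>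

lemma draws_bounds:
  "real M \<le> real (draws M k) * sine_bound k" "real (draws M k) * sine_bound k \<le> real M + sine_bound k" "draws M 0 = 2 * M"
proof -
  have d: "real (draws M k) = of_int \<lceil>real M / sine_bound k\<rceil>"
    by (simp add: draws_def less_imp_le)
  have "real M / sine_bound k \<le> real (draws M k)"
    unfolding d by (rule le_of_int_ceiling)
  then show "real M \<le> real (draws M k) * sine_bound k"
    by (simp add: pos_divide_le_eq)
  have "real (draws M k) \<le> real M / sine_bound k + 1"
    unfolding d by (rule of_int_ceiling_le_add_one)
  then have "real (draws M k) * sine_bound k \<le> (real M / sine_bound k + 1) * sine_bound k"
    by (intro mult_right_mono) (auto simp: less_imp_le)
  then show "real (draws M k) * sine_bound k \<le> real M + sine_bound k"
    by (simp add: distrib_right less_imp_neq[OF sine_bound_pos, symmetric])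
  have "real M / sine_bound 0 = of_int (int (2 * M))"
    by (simp add: sine_bound_def)
  then show "draws M 0 = 2 * M"
    unfolding draws_def by (simp only: ceiling_of_int nat_int)
qed

text \<open>Union bound over the phases. Given the earlier examples, the direction before a phase is
  fixed and its examples are fresh, so \<open>phase_failure\<close> bounds the probability that a
  good direction is lost in that phase.\<close>

lemma direction_failure:
  fixes d r M :: nat and \<eta> \<rho> L :: real and w :: vec
  assumes d: "d \<ge> 1" and r: "real d \<le> (real r)\<^sup>2" "(real r)\<^sup>2 \<le> 4 * real d" and w: "ip d w w = 1"
    and \<eta>: "0 \<le> \<eta>" "\<eta> < 1/2" and \<rho>: "\<rho> = 1 - 2 * \<eta>"
    and M: "M \<ge> 1" and big: "1280000 * (real r) ^ 4 * L \<le> real M * \<rho>\<^sup>2" and L: "L \<ge> 1"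
  defines "S \<equiv> rcn_space d \<eta>"
    and "dir \<equiv> \<lambda>\<omega>. direction d r \<rho> M (\<lambda>l. fst (\<omega> l)) (\<lambda>l. noisy_label d w (\<omega> l))"
  shows "emeasure S {\<omega> \<in> space S. \<not> good d w (sine_bound (Suc k)) (dir \<omega> (Suc k))} \<le>
    ennreal (real (Suc k) * (3 * real d * exp (- 4 * L)))"
    and "{\<omega> \<in> space S. \<not> good d w (sine_bound (Suc k)) (dir \<omega> (Suc k))} \<in> sets S"
proof -
  interpret E: sequence_space "example d \<eta>"
    by (rule sequence_space_example)
  have S: "S = E.S"
    by (simp add: S_def rcn_space_eq)
  define \<delta> where "\<delta> = 3 * real d * exp (- 4 * L)"
  have \<delta>: "0 \<le> \<delta>" by (simp add: \<delta>_def)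
  have dir_meas: "(\<lambda>\<omega>. dir \<omega> k i) \<in> borel_measurable S" if i: "i < d" for k i
    unfolding dir_def
  proof (rule direction_measurable[OF _ _ i])
    fix l
    have c: "(\<lambda>\<omega>. \<omega> l) \<in> S \<rightarrow>\<^sub>M example d \<eta>"
      unfolding S by measurable
    show "(\<lambda>\<omega>. noisy_label d w (\<omega> l)) \<in> borel_measurable S"
      using measurable_compose[OF c noisy_label_measurable] .
    fix i assume "i < d"
    show "(\<lambda>\<omega>. fst (\<omega> l) i) \<in> borel_measurable S"
      using measurable_compose[OF measurable_compose[OF c fst_measurable_example] coord_measurable_uniform_sphere[OF \<open>i < d\<close>]] .
  qed
  have good_meas [measurable]: "Measurable.pred S (\<lambda>\<omega>. good d w t (dir \<omega> k))" for k t
    using dir_meas by (rule good_measurable)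
  \<comment> \<open>The direction is lost in phase \<open>k\<close>. The disjunct for
    \<open>k = 0\<close> is there because the initial zero vector is not
    \<open>good\<close>.\<close>
  define B where "B = (\<lambda>k. {\<omega> \<in> space S. (k = 0 \<or> good d w (sine_bound k) (dir \<omega> k)) \<and> \<not> good d w (sine_bound (Suc k)) (dir \<omega> (Suc k))})"
  have B_sets: "B k \<in> sets S" for k
    unfolding B_def by measurable
  have B_le: "emeasure S (B k) \<le> ennreal \<delta>" for k
    unfolding S
  proof (rule E.emeasure_comb_seq_le[where n="offset M k"])
    show "B k \<in> sets E.S" using B_sets[of k] by (simp add: S)
    fix \<omega> assume \<omega>: "\<omega> \<in> space E.S"
    let ?c = "comb_seq (offset M k) \<omega>"
    have dir1: "dir (?c \<omega>') k = dir \<omega> k" for \<omega>'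
      unfolding dir_def by (rule direction_cong) (auto simp: comb_seq_less)
    have dir2: "dir (?c \<omega>') (Suc k) = phase d r \<rho> M (sine_bound k) (draws M k) (dir \<omega> k) (\<lambda>l. fst (\<omega>' l)) (\<lambda>l. noisy_label d w (\<omega>' l))" for \<omega>'
    proof -
      have "?c \<omega>' (offset M k + l) = \<omega>' l" for l
        using comb_seq_add[of "offset M k" \<omega> \<omega>' l] by (simp add: add.commute)
      then show ?thesis
        using dir1[of \<omega>'] by (simp add: dir_def)
    qed
    show "emeasure E.S {\<omega>' \<in> space E.S. ?c \<omega>' \<in> B k} \<le> ennreal \<delta>"
    proof (cases "k = 0 \<or> good d w (sine_bound k) (dir \<omega> k)")
      case False
      then have empty: "{\<omega>' \<in> space E.S. ?c \<omega>' \<in> B k} = {}"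
        by (auto simp: B_def dir1)
      show ?thesis
        unfolding empty by simp
    next
      case True
      then have start: "dir \<omega> k = (\<lambda>i. 0) \<and> sine_bound k = 1/2 \<and> draws M k = 2 * M \<or> good d w (sine_bound k) (dir \<omega> k)"
        using draws_bounds(3) by (auto simp: dir_def sine_bound_def)
      from phase_failure[OF d r w \<eta> \<rho> sine_bound_pos sine_bound_le M draws_bounds(1,2) start big L]
      obtain U where U: "U \<in> sets S" "emeasure S U \<le> ennreal \<delta>"
        "\<And>\<omega>'. \<omega>' \<in> space S - U \<Longrightarrow> good d w (15/16 * sine_bound k) (phase d r \<rho> M (sine_bound k) (draws M k) (dir \<omega> k) (\<lambda>l. fst (\<omega>' l)) (\<lambda>l. noisy_label d w (\<omega>' l)))"
        unfolding S_def \<delta>_def by blast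
      have "{\<omega>' \<in> space E.S. ?c \<omega>' \<in> B k} \<subseteq> U"
        using U(3) by (auto simp: B_def dir2 sine_bound_Suc S)
      then show ?thesis
        using emeasure_mono[of _ U S] U(1,2) order_trans unfolding S by blast
    qed
  qed
  show "{\<omega> \<in> space S. \<not> good d w (sine_bound (Suc k)) (dir \<omega> (Suc k))} \<in> sets S" for k
    by measurable
  show "emeasure S {\<omega> \<in> space S. \<not> good d w (sine_bound (Suc k)) (dir \<omega> (Suc k))} \<le> ennreal (real (Suc k) * (3 * real d * exp (- 4 * L)))"
    unfolding \<delta>_def[symmetric]
  proof (induction k)
    case 0
    then show ?case
      using B_le[of 0] by (simp add: B_def)
  next
    case (Suc k)
    let ?A = "{\<omega> \<in> space S. \<not> good d w (sine_bound (Suc k)) (dir \<omega> (Suc k))}"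
    have A: "?A \<in> sets S" by measurable
    have "{\<omega> \<in> space S. \<not> good d w (sine_bound (Suc (Suc k))) (dir \<omega> (Suc (Suc k)))} \<subseteq> ?A \<union> B (Suc k)"
      by (auto simp: B_def)
    then have "emeasure S {\<omega> \<in> space S. \<not> good d w (sine_bound (Suc (Suc k))) (dir \<omega> (Suc (Suc k)))} \<le> emeasure S (?A \<union> B (Suc k))"
      using A B_sets by (intro emeasure_mono) auto
    also have "\<dots> \<le> emeasure S ?A + emeasure S (B (Suc k))"
      using A B_sets by (intro emeasure_subadditive) auto
    also have "\<dots> \<le> ennreal (real (Suc k) * \<delta>) + ennreal \<delta>"
      using Suc.IH B_le by (intro add_mono) auto
    also have "\<dots> = ennreal (real (Suc k) * \<delta> + \<delta>)"
      using \<delta> by (intro ennreal_plus[symmetric]) auto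
    also have "real (Suc k) * \<delta> + \<delta> = real (Suc (Suc k)) * \<delta>"
      by (simp add: algebra_simps)
    finally show ?case .
  qed
qed

lemma direction_success:
  fixes d r M K L :: nat and \<eta> \<rho> :: real and w :: vec
  assumes d: "d \<ge> 1" and r: "real d \<le> (real r)\<^sup>2" "(real r)\<^sup>2 \<le> 4 * real d" and w: "ip d w w = 1"
    and \<eta>: "0 \<le> \<eta>" "\<eta> < 1/2" and \<rho>: "\<rho> = 1 - 2 * \<eta>"
    and M: "M \<ge> 1" and big: "1280000 * (real r) ^ 4 * real L \<le> real M * \<rho>\<^sup>2" and L: "L \<ge> 1"
    and K: "K \<ge> 1" "real d * real K \<le> 2 ^ (L - 1)"
  defines "S \<equiv> rcn_space d \<eta>"
    and "dir \<equiv> \<lambda>\<omega>. direction d r \<rho> M (\<lambda>l. fst (\<omega> l)) (\<lambda>l. noisy_label d w (\<omega> l))"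
  shows "{\<omega> \<in> space S. good d w (sine_bound K) (dir \<omega> K)} \<in> sets S"
    and "2/3 \<le> measure S {\<omega> \<in> space S. good d w (sine_bound K) (dir \<omega> K)}"
proof -
  interpret E: sequence_space "example d \<eta>"
    by (rule sequence_space_example)
  have S: "S = E.S"
    by (simp add: S_def rcn_space_eq)
  obtain k where k: "K = Suc k" using K by (cases K) auto
  let ?A = "{\<omega> \<in> space S. \<not> good d w (sine_bound K) (dir \<omega> K)}"
  have A: "?A \<in> sets S" "emeasure S ?A \<le> ennreal (real K * (3 * real d * exp (- 4 * real L)))"
    using direction_failure[OF d r w \<eta> \<rho> M big, of k] L by (simp_all add: k S_def dir_def)
  have eq: "{\<omega> \<in> space S. good d w (sine_bound K) (dir \<omega> K)} = space S - ?A"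
    by auto
  then show "{\<omega> \<in> space S. good d w (sine_bound K) (dir \<omega> K)} \<in> sets S"
    using A by auto
  \<comment> \<open>From exp L >= 2^L >= 2 d K and exp (3 L) >= 8 follows d K exp (-4 L) <= 1/16, so
    the failure probability is at most 3/16.\<close>
  have "real K * (3 * real d * exp (- 4 * real L)) \<le> 1/3"
  proof -
    have "2 * (2::real) ^ (L - 1) = 2 ^ L"
      using L by (metis Suc_diff_1 less_le_trans power_Suc zero_less_one)
    also have "\<dots> \<le> exp 1 ^ L"
      using exp_ge_add_one_self[of 1] by (intro power_mono) auto
    also have "\<dots> = exp (real L)"
      by (simp add: exp_of_nat_mult[symmetric])
    finally have 1: "2 * (real d * real K) \<le> exp (real L)"
      using K(2) by linarith
    have 2: "8 \<le> exp (3 * real L)"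
    proof -
      have "(8::real) = 2 ^ 3" by simp
      also have "\<dots> \<le> exp 1 ^ 3"
        using exp_ge_add_one_self[of 1] by (intro power_mono) auto
      also have "\<dots> = exp 3" by (simp add: exp_of_nat_mult[symmetric])
      also have "\<dots> \<le> exp (3 * real L)" using L by simp
      finally show ?thesis .
    qed
    have "16 * (real d * real K) \<le> exp (3 * real L) * exp (real L)"
      using mult_mono[OF 2 1] by simp
    also have "\<dots> = exp (4 * real L)"
      by (simp add: exp_add[symmetric])
    finally have "16 * (real d * real K) \<le> exp (4 * real L)" .
    then have "(real d * real K) * exp (- 4 * real L) \<le> 1/16"
      by (simp add: exp_minus field_simps)
    then show ?thesis by (simp add: mult_ac)
  qed
  then have "emeasure S ?A \<le> ennreal (1/3)"
    using A(2) order_trans ennreal_leI by blast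
  then have "measure S ?A \<le> 1/3"
    unfolding S E.P.emeasure_eq_measure by (subst (asm) ennreal_le_iff) auto
  moreover have "measure S (space S - ?A) = 1 - measure S ?A"
    using A(1) unfolding S by (rule E.P.prob_compl)
  ultimately show "2/3 \<le> measure S {\<omega> \<in> space S. good d w (sine_bound K) (dir \<omega> K)}"
    unfolding eq by linarith
qed

section \<open>The program\<close>

text \<open>Total correctness with a time budget \<open>T\<close>, relative to the steps already
  taken. Asking for some execution is enough, since \<open>exec\<close> is deterministic.\<close>

definition wp :: "environment \<Rightarrow> com \<Rightarrow> nat \<Rightarrow> (state \<Rightarrow> bool) \<Rightarrow> state \<Rightarrow> bool" where
  "wp E c T Q s \<longleftrightarrow> (\<exists>t. exec E c s t \<and> steps t \<le> steps s + T \<and> Q t)"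

section \<open>Proof rules for time-bounded total correctness\<close>

lemma tick_simps [simp]:
  "reg (tick n s) = reg s" "arr (tick n s) = arr s" "drawn (tick n s) = drawn s"
  "requested (tick n s) = requested s" "steps (tick n s) = steps s + n"
  by (simp_all add: tick_def)

lemma set_simps [simp]:
  "reg (set_reg r n s) = (reg s)(r := n)" "arr (set_reg r n s) = arr s" "drawn (set_reg r n s) = drawn s"
  "requested (set_reg r n s) = requested s" "steps (set_reg r n s) = steps s"
  "reg (set_cell a i z s) = reg s" "arr (set_cell a i z s) = (arr s)(a := (arr s a)(i := z))"
  "drawn (set_cell a i z s) = drawn s" "requested (set_cell a i z s) = requested s" "steps (set_cell a i z s) = steps s"
  "reg (set_vec d a x s) = reg s" "arr (set_vec d a x s) = (arr s)(a := (\<lambda>i. if i < d then x i else 0))"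
  "drawn (set_vec d a x s) = drawn s" "requested (set_vec d a x s) = requested s" "steps (set_vec d a x s) = steps s"
  by (simp_all add: set_reg_def set_cell_def set_vec_def)

lemma wp_conseq: "wp E c T Q s \<Longrightarrow> T \<le> T' \<Longrightarrow> (\<And>t. Q t \<Longrightarrow> Q' t) \<Longrightarrow> wp E c T' Q' s"
  unfolding wp_def by (meson add_left_mono order_trans)

lemma wp_weaken: "wp E c T Q s \<Longrightarrow> T \<le> T' \<Longrightarrow> wp E c T' Q s"
  by (rule wp_conseq)

lemma wp_Skip: "Q (tick 1 s) \<Longrightarrow> wp E Skip 1 Q s"
  unfolding wp_def using exec_Skip[of E s] by force

lemma wp_NSet: "Q (tick 1 (set_reg r (nval e s) s)) \<Longrightarrow> wp E (NSet r e) 1 Q s"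
  unfolding wp_def using exec_NSet[of E r e s] by force

lemma wp_RSet: "Q (tick 1 (set_cell a (nval i s) (rval e s) s)) \<Longrightarrow> wp E (RSet a i e) 1 Q s"
  unfolding wp_def using exec_RSet[of E a i e s] by force

lemma wp_Draw:
  assumes "Q (tick (dimension E + 1) ((set_vec (dimension E) a (point E (drawn s)) s)\<lparr>drawn := drawn s + 1\<rparr>))"
  shows "wp E (Draw a) (dimension E + 1) Q s"
  unfolding wp_def using exec_Draw[of E a s] assms by force

lemma wp_Request:
  assumes "Q (tick 1 ((set_cell a (nval i s) (if nval e s < drawn s then label E (nval e s) else 0) s)
               \<lparr>requested := requested s + 1\<rparr>))"
  shows "wp E (Request e a i) 1 Q s"
  unfolding wp_def using exec_Request[of E e a i s] assms by force

lemma wp_Seq: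
  assumes "wp E c T1 (\<lambda>t. wp E c' T2 Q t) s"
  shows "wp E (Seq c c') (T1 + T2) Q s"
proof -
  obtain t where t: "exec E c s t" "steps t \<le> steps s + T1" "wp E c' T2 Q t"
    using assms unfolding wp_def by blast
  then obtain u where "exec E c' t u" "steps u \<le> steps t + T2" "Q u"
    unfolding wp_def by blast
  with t show ?thesis
    unfolding wp_def by (intro exI[of _ u]) (auto intro: exec_Seq)
qed

lemma wp_Cond:
  assumes "bval b s \<Longrightarrow> wp E c T Q (tick 1 s)" "\<not> bval b s \<Longrightarrow> wp E c' T Q (tick 1 s)"
  shows "wp E (Cond b c c') (1 + T) Q s"
proof (cases "bval b s")
  case True
  then obtain t where "exec E c (tick 1 s) t" "steps t \<le> steps s + (1 + T)" "Q t"
    using assms(1) unfolding wp_def by force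
  with True show ?thesis
    unfolding wp_def by (blast intro: exec_CondT)
next
  case False
  then obtain t where "exec E c' (tick 1 s) t" "steps t \<le> steps s + (1 + T)" "Q t"
    using assms(2) unfolding wp_def by force
  with False show ?thesis
    unfolding wp_def by (blast intro: exec_CondF)
qed

text \<open>The number of iterations is known in advance, so the index of the invariant doubles as
  the termination measure. The cost beyond the bodies is \<open>n + 1\<close> evaluations of the
  test.\<close>

lemma wp_Loop:
  assumes start: "I 0 s"
    and body: "\<And>j t. j < n \<Longrightarrow> I j t \<Longrightarrow> bval b t \<and> wp E c T (I (Suc j)) (tick 1 t)"
    and stop: "\<And>t. I n t \<Longrightarrow> \<not> bval b t \<and> Q (tick 1 t)"
  shows "wp E (Loop b c) (n * (T + 1) + 1) Q s"
proof -
  have "wp E (Loop b c) (m * (T + 1) + 1) Q t" if "I j t" "j + m = n" for j m t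
    using that
  proof (induction m arbitrary: j t)
    case 0
    then have "\<not> bval b t" "Q (tick 1 t)"
      using stop by auto
    then show ?case
      unfolding wp_def by (intro exI[of _ "tick 1 t"] conjI exec_LoopF) auto
  next
    case (Suc m)
    then have b: "bval b t" "wp E c T (I (Suc j)) (tick 1 t)"
      using body[of j t] by auto
    then obtain t' where t': "exec E c (tick 1 t) t'" "steps t' \<le> steps t + 1 + T" "I (Suc j) t'"
      unfolding wp_def by auto
    obtain u where "exec E (Loop b c) t' u" "steps u \<le> steps t' + (m * (T + 1) + 1)" "Q u"
      using Suc.IH[OF t'(3)] Suc.prems unfolding wp_def by auto
    with b t' show ?case
      unfolding wp_def by (intro exI[of _ u]) (auto intro: exec_LoopT)
  qed
  from this[OF start] show ?thesis by simp
qed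

text \<open>
  Registers: 0 dimension, 1 coordinate, 2 \<open>r\<close>, 3 number of phases, 4 \<open>L\<close>, 5 \<open>M\<close>, 6 phase, 7 draws and
  8 requests of the current phase, 9 Newton step, 10 number of the current point.  Arrays: 0 input,
  1 direction, 2 drawn point, 3 accumulated vector, 4 scalars; cells of array 4: 0 \<open>\<sigma>\<close>, 1 \<open>\<langle>v, v\<rangle>\<close>,
  2 inner product with \<open>v\<close>, 3 label, 4 power of two.
\<close>

abbreviation incr :: "nat \<Rightarrow> com" where
  "incr i \<equiv> NSet i (NPlus (NReg i) (NConst 1))"

definition for_dim :: "com \<Rightarrow> com" where
  "for_dim c = Seq (NSet 1 (NConst 0)) (Loop (NLess (NReg 1) (NReg 0)) (Seq c (incr 1)))"

definition map_vec :: "nat \<Rightarrow> rexp \<Rightarrow> com" where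
  "map_vec a e = for_dim (RSet a (NReg 1) e)"

definition dot_prog :: "nat \<Rightarrow> nat \<Rightarrow> nat \<Rightarrow> com" where
  "dot_prog a b c = Seq (RSet 4 (NConst c) (OfNat (NConst 0)))
     (for_dim (RSet 4 (NConst c) (RPlus (Cell 4 (NConst c)) (RTimes (Cell a (NReg 1)) (Cell b (NReg 1))))))"

text \<open>Per coordinate one step each for the test, the body and the increment, plus the
  initialization and the last test. The body must establish the next invariant for every value of
  the counter, because the increment happens after it.\<close>

lemma wp_for_dim:
  assumes start: "\<And>t. reg t = (reg s)(1 := 0) \<Longrightarrow> arr t = arr s \<Longrightarrow> drawn t = drawn s \<Longrightarrow> requested t = requested s \<Longrightarrow> I 0 t"
    and body: "\<And>j t. j < reg s 0 \<Longrightarrow> I j t \<Longrightarrow> reg t = (reg s)(1 := j) \<Longrightarrow> drawn t = drawn s \<Longrightarrow> requested t = requested s \<Longrightarrow>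
       wp E c 1 (\<lambda>u. reg u = reg t \<and> drawn u = drawn t \<and> requested u = requested t \<and> (\<forall>n. I (Suc j) (tick 1 (set_reg 1 n u)))) (tick 1 t)"
    and stop: "\<And>t. I (reg s 0) t \<Longrightarrow> reg t = (reg s)(1 := reg s 0) \<Longrightarrow> drawn t = drawn s \<Longrightarrow> requested t = requested s \<Longrightarrow> Q (tick 1 t)"
  shows "wp E (for_dim c) (3 * reg s 0 + 2) Q s"
proof -
  let ?I = "\<lambda>j t. I j t \<and> reg t = (reg s)(1 := j) \<and> drawn t = drawn s \<and> requested t = requested s"
  have "wp E (Loop (NLess (NReg 1) (NReg 0)) (Seq c (incr 1))) (reg s 0 * (1 + 1 + 1) + 1) Q
      (tick 1 (set_reg 1 0 s))"
  proof (rule wp_Loop[where I="?I"])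
    show "?I 0 (tick 1 (set_reg 1 0 s))"
      using start by simp
    fix j t assume j: "j < reg s 0" and I: "?I j t"
    show "bval (NLess (NReg 1) (NReg 0)) t \<and> wp E (Seq c (incr 1)) (1 + 1) (?I (Suc j)) (tick 1 t)"
    proof
      show "bval (NLess (NReg 1) (NReg 0)) t"
        using I j by simp
      show "wp E (Seq c (incr 1)) (1 + 1) (?I (Suc j)) (tick 1 t)"
        using I j by (intro wp_Seq wp_conseq[OF body[of j t]] wp_NSet) auto
    qed
  next
    fix t assume I: "?I (reg s 0) t"
    then show "\<not> bval (NLess (NReg 1) (NReg 0)) t \<and> Q (tick 1 t)"
      using stop by simp
  qed
  then have "wp E (for_dim c) (1 + (reg s 0 * (1 + 1 + 1) + 1)) Q s"
    unfolding for_dim_def by (intro wp_Seq wp_NSet) simp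
  then show ?thesis
    by (rule wp_conseq) auto
qed

lemma wp_map_vec:
  assumes d: "reg s 0 = d"
    and val: "\<And>i t. i < d \<Longrightarrow> reg t = (reg s)(1 := i) \<Longrightarrow>
      arr t = (arr s)(a := (\<lambda>j. if j < i then f j else arr s a j)) \<Longrightarrow> rval e t = f i"
    and Q: "\<And>t. reg t = (reg s)(1 := d) \<Longrightarrow> arr t = (arr s)(a := (\<lambda>j. if j < d then f j else arr s a j)) \<Longrightarrow>
      drawn t = drawn s \<Longrightarrow> requested t = requested s \<Longrightarrow> Q t"
  shows "wp E (map_vec a e) (3 * d + 2) Q s"
  unfolding map_vec_def d[symmetric]
proof (rule wp_for_dim[where I="\<lambda>i (t::state). arr t = (arr s)(a := (\<lambda>j. if j < i then f j else arr s a j))"])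
  fix i and t :: state assume i: "i < reg s 0" and t: "arr t = (arr s)(a := (\<lambda>j. if j < i then f j else arr s a j))"
    "reg t = (reg s)(1 := i)" "drawn t = drawn s" "requested t = requested s"
  have v: "rval e (tick 1 t) = f i"
    using val[unfolded d[symmetric], OF i, of "tick 1 t"] t by simp
  show "wp E (RSet a (NReg 1) e) 1 (\<lambda>u. reg u = reg t \<and> drawn u = drawn t \<and> requested u = requested t \<and>
      (\<forall>n. arr (tick 1 (set_reg 1 n u)) = (arr s)(a := (\<lambda>j. if j < Suc i then f j else arr s a j)))) (tick 1 t)"
    by (rule wp_RSet) (use t v in \<open>auto simp: fun_eq_iff less_Suc_eq\<close>)
qed (auto intro!: Q simp: fun_upd_idem d)

lemma wp_dot_prog:
  assumes d: "reg s 0 = d"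
    and ab: "a \<noteq> 4" "b \<noteq> 4"
    and Q: "\<And>t. reg t = (reg s)(1 := d) \<Longrightarrow> arr t = (arr s)(4 := (arr s 4)(c := ip d (arr s a) (arr s b))) \<Longrightarrow>
      drawn t = drawn s \<Longrightarrow> requested t = requested s \<Longrightarrow> Q t"
  shows "wp E (dot_prog a b c) (1 + (3 * d + 2)) Q s"
  unfolding dot_prog_def d[symmetric]
proof (intro wp_Seq wp_RSet)
  let ?s = "tick 1 (set_cell 4 (nval (NConst c) s) (rval (OfNat (NConst 0)) s) s)"
  have r: "reg ?s = reg s" by simp
  show "wp E (for_dim (RSet 4 (NConst c) (RPlus (Cell 4 (NConst c)) (RTimes (Cell a (NReg 1)) (Cell b (NReg 1))))))
      (3 * reg s 0 + 2) Q ?s"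
    unfolding r[symmetric]
  proof (rule wp_for_dim[where I="\<lambda>i (t::state). arr t = (arr s)(4 := (arr s 4)(c := ip i (arr s a) (arr s b)))"])
    fix i and t :: state assume i: "i < reg ?s 0" and t: "arr t = (arr s)(4 := (arr s 4)(c := ip i (arr s a) (arr s b)))"
      "reg t = (reg ?s)(1 := i)" "drawn t = drawn ?s" "requested t = requested ?s"
    show "wp E (RSet 4 (NConst c) (RPlus (Cell 4 (NConst c)) (RTimes (Cell a (NReg 1)) (Cell b (NReg 1))))) 1
      (\<lambda>u. reg u = reg t \<and> drawn u = drawn t \<and> requested u = requested t \<and>
      (\<forall>n. arr (tick 1 (set_reg 1 n u)) = (arr s)(4 := (arr s 4)(c := ip (Suc i) (arr s a) (arr s b))))) (tick 1 t)"
      by (rule wp_RSet) (use t ab in \<open>simp add: ip_def\<close>)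
  qed (auto intro!: Q simp: ip_def d)
qed

section \<open>Processing one point\<close>

abbreviation rho_expr :: rexp where
  "rho_expr \<equiv> RMinus (OfNat (NConst 1)) (RTimes (OfNat (NConst 2)) (Cell 0 (NConst 0)))"

abbreviation take_test :: bexp where
  "take_test \<equiv> BAnd (BNot (RLess (RTimes (RTimes (Cell 4 (NConst 0)) (Cell 4 (NConst 0))) (Cell 4 (NConst 1)))
       (RTimes (RTimes (OfNat (NConst 400)) (RTimes (OfNat (NReg 2)) (OfNat (NReg 2))))
         (RTimes (Cell 4 (NConst 2)) (Cell 4 (NConst 2))))))
     (NLess (NReg 8) (NPlus (NReg 5) (NReg 5)))"

abbreviation take_expr :: rexp where
  "take_expr \<equiv> RPlus (Cell 3 (NReg 1)) (RTimes (Cell 4 (NConst 3)) (Cell 2 (NReg 1)))"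

abbreviation take_prog :: com where
  "take_prog \<equiv> Seq (Request (NReg 10) 4 (NConst 3)) (Seq (map_vec 3 take_expr) (incr 8))"

definition draw_prog :: com where
  "draw_prog = Seq (Draw 2) (Seq (dot_prog 1 2 2)
     (Seq (Cond
       take_test
       take_prog
       Skip)
     (Seq (incr 10) (incr 7))))"

text \<open>\<open>n0\<close> and \<open>q0\<close> are the numbers of points drawn and labels
  requested before the phase. Register 8 holds the capped count of band points, which is the number
  of requests in this phase.\<close>

definition draw_inv :: "environment \<Rightarrow> nat \<Rightarrow> nat \<Rightarrow> nat \<Rightarrow> nat \<Rightarrow> nat \<Rightarrow> real \<Rightarrow> real \<Rightarrow> vec \<Rightarrow> nat \<Rightarrow> nat \<Rightarrow> nat \<Rightarrow> state \<Rightarrow> bool" where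
  "draw_inv E d r K M k \<eta> \<sigma> v n0 q0 j t \<longleftrightarrow>
     (let x = (\<lambda>l. point E (n0 + l)); y = (\<lambda>l. label E (n0 + l)); c = min (2 * M) (band_count d r \<sigma> v x j) in
      reg t 0 = d \<and> reg t 2 = r \<and> reg t 3 = K \<and> reg t 5 = M \<and> reg t 6 = k \<and> reg t 7 = j \<and> reg t 8 = c \<and> reg t 10 = n0 + j \<and>
      arr t 0 0 = \<eta> \<and> arr t 1 = v \<and> (\<forall>i<d. arr t 3 i = label_sum d r \<sigma> M v x y j i) \<and>
      arr t 4 0 = \<sigma> \<and> arr t 4 1 = ip d v v \<and> drawn t = n0 + j \<and> requested t = q0 + c)"

lemma wp_draw_prog:
  assumes E: "dimension E = d" and I: "draw_inv E d r K M k \<eta> \<sigma> v n0 q0 j t"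
  shows "wp E draw_prog (7 * d + 11) (draw_inv E d r K M k \<eta> \<sigma> v n0 q0 (Suc j)) t"
proof -
  let ?x = "\<lambda>l. point E (n0 + l)" and ?y = "\<lambda>l. label E (n0 + l)"
  let ?b = "band_count d r \<sigma> v ?x"
  note I' = I[unfolded draw_inv_def Let_def]
  have ip_x: "ip d v (\<lambda>i. if i < d then point E n i else 0) = ip d v (point E n)" for n
    by (rule ip_cong) auto
  have bj: "?b (Suc j) = ?b j + (if in_band d r \<sigma> v (?x j) then 1 else 0)"
    by (simp add: band_count_def)
  have lj: "label_sum d r \<sigma> M v ?x ?y (Suc j) i = label_sum d r \<sigma> M v ?x ?y j i +
      (if in_band d r \<sigma> v (?x j) \<and> ?b j < 2 * M then ?y j * ?x j i else 0)" for i
    by (simp add: label_sum_def)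
  let ?tail = "Seq (incr 10) (incr 7)"
  \<comment> \<open>The budget is bracketed like the program, so that \<open>wp_Seq\<close> and
    \<open>wp_Cond\<close> match it; it is simplified only at the end.\<close>
  let ?T = "(d + 1) + ((1 + (3 * d + 2)) + ((1 + (1 + ((3 * d + 2) + 1))) + (1 + 1)))"
  have "wp E draw_prog ?T (draw_inv E d r K M k \<eta> \<sigma> v n0 q0 (Suc j)) t"
    unfolding draw_prog_def E[symmetric]
  proof (intro wp_Seq wp_Draw, unfold E)
    let ?t1 = "tick (d + 1) ((set_vec d 2 (point E (drawn t)) t)\<lparr>drawn := drawn t + 1\<rparr>)"
    have t1: "reg ?t1 = reg t" "arr ?t1 = (arr t)(2 := (\<lambda>i. if i < d then ?x j i else 0))"
      "drawn ?t1 = n0 + Suc j" "requested ?t1 = requested t"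
      using I' by simp_all
    have d1: "reg ?t1 0 = d" using I' by simp
    show "wp E (dot_prog 1 2 2) (1 + (3 * d + 2)) (\<lambda>t. wp E (Seq (Cond
       take_test
       take_prog
       Skip) ?tail) ((1 + (1 + ((3 * d + 2) + 1))) + (1 + 1)) (draw_inv E d r K M k \<eta> \<sigma> v n0 q0 (Suc j)) t) ?t1"
    proof (rule wp_dot_prog[OF d1])
      fix t2 :: state assume t2: "reg t2 = (reg ?t1)(1 := d)"
        "arr t2 = (arr ?t1)(4 := (arr ?t1 4)(2 := ip d (arr ?t1 1) (arr ?t1 2)))"
        "drawn t2 = drawn ?t1" "requested t2 = requested ?t1"
      let ?bx = take_test
      \<comment> \<open>Register 8 holds the minimum of \<open>2 * M\<close> and the count, and it
        is below \<open>2 * M\<close> exactly if the count is.\<close>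
      have test: "bval ?bx t2 \<longleftrightarrow> in_band d r \<sigma> v (?x j) \<and> ?b j < 2 * M"
        using I' by (simp add: t2 t1 in_band_def power2_eq_square ip_x min_less_iff_disj min_def)
      show "wp E (Seq (Cond ?bx
         take_prog
         Skip) ?tail) ((1 + (1 + ((3 * d + 2) + 1))) + (1 + 1)) (draw_inv E d r K M k \<eta> \<sigma> v n0 q0 (Suc j)) t2"
      proof (intro wp_Seq, rule wp_Cond)
        assume "\<not> bval ?bx t2"
        then have nb: "\<not> (in_band d r \<sigma> v (?x j) \<and> ?b j < 2 * M)"
          by (simp only: test simp_thms)
        then have m: "min (2 * M) (?b (Suc j)) = min (2 * M) (?b j)"
          unfolding bj by auto
        show "wp E Skip (1 + ((3 * d + 2) + 1)) (wp E ?tail (1 + 1) (draw_inv E d r K M k \<eta> \<sigma> v n0 q0 (Suc j))) (tick 1 t2)"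
          using I' nb by (intro wp_weaken[OF wp_Skip] wp_Seq wp_NSet)
            (auto simp: draw_inv_def Let_def t2 t1 m lj)
      next
        assume "bval ?bx t2"
        then have b: "in_band d r \<sigma> v (?x j)" "?b j < 2 * M"
          by (simp_all only: test simp_thms)
        then have m: "min (2 * M) (?b (Suc j)) = Suc (min (2 * M) (?b j))"
          unfolding bj by auto
        let ?t3 = "tick 1 ((set_cell 4 (nval (NConst 3) (tick 1 t2)) (if nval (NReg 10) (tick 1 t2) < drawn (tick 1 t2)
            then label E (nval (NReg 10) (tick 1 t2)) else 0) (tick 1 t2))\<lparr>requested := requested (tick 1 t2) + 1\<rparr>)"
        have t3: "reg ?t3 = (reg t)(1 := d)" "arr ?t3 4 3 = ?y j" "arr ?t3 4 0 = \<sigma>" "arr ?t3 4 1 = ip d v v"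
          "arr ?t3 0 0 = \<eta>" "arr ?t3 1 = v" "arr ?t3 3 = arr t 3" "arr ?t3 2 = (\<lambda>i. if i < d then ?x j i else 0)"
          "drawn ?t3 = n0 + Suc j" "requested ?t3 = Suc (requested t)"
          using I' by (simp_all add: t2 t1)
        have d3: "reg ?t3 0 = d" unfolding t3(1) using I' by simp
        show "wp E take_prog (1 + ((3 * d + 2) + 1)) (wp E ?tail (1 + 1) (draw_inv E d r K M k \<eta> \<sigma> v n0 q0 (Suc j))) (tick 1 t2)"
        proof (intro wp_Seq wp_Request)
          show "wp E (map_vec 3 take_expr) (3 * d + 2)
             (\<lambda>t. wp E (incr 8) 1 (wp E ?tail (1 + 1) (draw_inv E d r K M k \<eta> \<sigma> v n0 q0 (Suc j))) t) ?t3"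
          proof (rule wp_map_vec[OF d3, where f="\<lambda>i. arr t 3 i + ?y j * ?x j i"])
            fix i and t' :: state assume i: "i < d" and "reg t' = (reg ?t3)(1 := i)"
              and "arr t' = (arr ?t3)(3 := (\<lambda>ja. if ja < i then arr t 3 ja + ?y j * ?x j ja else arr ?t3 3 ja))"
            then show "rval take_expr t' = arr t 3 i + ?y j * ?x j i"
              using t3 by (simp del: tick_simps set_simps)
          next
            fix u :: state assume u: "reg u = (reg ?t3)(1 := d)"
              "arr u = (arr ?t3)(3 := (\<lambda>ja. if ja < d then arr t 3 ja + ?y j * ?x j ja else arr ?t3 3 ja))"
              "drawn u = drawn ?t3" "requested u = requested ?t3"
            note u' = u[unfolded t3]
            have a: "arr u 4 0 = \<sigma>" "arr u 4 1 = ip d v v" "arr u 0 0 = \<eta>" "arr u 1 = v"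
              "\<And>i. i < d \<Longrightarrow> arr u 3 i = arr t 3 i + ?y j * ?x j i"
              using u(2) t3 by (simp_all del: tick_simps set_simps)
            show "wp E (incr 8) 1 (wp E ?tail (1 + 1) (draw_inv E d r K M k \<eta> \<sigma> v n0 q0 (Suc j))) u"
              using I' b by (intro wp_Seq wp_NSet) (simp add: draw_inv_def Let_def u'(1,3,4) a[unfolded One_nat_def] m lj)
          qed
        qed
      qed
    qed auto
  qed
  then show ?thesis
    by (rule wp_conseq) auto
qed

section \<open>Running one phase\<close>

abbreviation draw_test :: bexp where
  "draw_test \<equiv> RLess (OfNat (NReg 7)) (RDivide (OfNat (NReg 5)) (Cell 4 (NConst 0)))"

abbreviation step_expr :: rexp where
  "step_expr \<equiv> RPlus (Cell 1 (NReg 1)) (RTimes (RDivide (RTimes (OfNat (NConst 10)) (OfNat (NReg 2))) rho_expr)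
     (RMinus (Cell 3 (NReg 1)) (RTimes (RDivide (Cell 4 (NConst 2)) (Cell 4 (NConst 1))) (Cell 1 (NReg 1)))))"

abbreviation newton_expr :: rexp where
  "newton_expr \<equiv> RDivide (RTimes (OfNat (NConst 2)) (Cell 1 (NReg 1))) (RPlus (OfNat (NConst 1)) (Cell 4 (NConst 1)))"

abbreviation shrink_expr :: rexp where
  "shrink_expr \<equiv> RDivide (RTimes (OfNat (NConst 15)) (Cell 4 (NConst 0))) (OfNat (NConst 16))"

definition phase_start_prog :: com where
  "phase_start_prog = Seq (dot_prog 1 1 1) (Seq (NSet 7 (NConst 0)) (Seq (NSet 8 (NConst 0))
     (map_vec 3 (OfNat (NConst 0)))))"

definition draw_loop_prog :: com where
  "draw_loop_prog = Loop draw_test draw_prog"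

definition step_prog :: com where
  "step_prog = Seq (map_vec 3 (RDivide (Cell 3 (NReg 1)) (OfNat (NReg 7)))) (Seq (dot_prog 1 3 2)
     (map_vec 1 step_expr))"

definition newton_prog :: com where
  "newton_prog = Seq (NSet 9 (NConst 0)) (Loop (NLess (NReg 9) (NConst 8))
     (Seq (dot_prog 1 1 1) (Seq (map_vec 1 newton_expr) (incr 9))))"

definition phase_prog :: com where
  "phase_prog = Seq phase_start_prog (Seq draw_loop_prog (Seq step_prog (Seq newton_prog
     (Seq (RSet 4 (NConst 0) shrink_expr)
       (incr 6)))))"

text \<open>What averaging, the step and the Newton iteration leave unchanged. The direction, the
  accumulated vector and the scratch cells are left out.\<close>

definition core :: "state \<Rightarrow> nat \<times> nat \<times> nat \<times> nat \<times> nat \<times> nat \<times> real \<times> real \<times> nat \<times> nat" where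
  "core t = (reg t 0, reg t 2, reg t 3, reg t 5, reg t 6, reg t 10, arr t 0 0, arr t 4 0, drawn t, requested t)"

definition phase_inv :: "environment \<Rightarrow> nat \<Rightarrow> nat \<Rightarrow> nat \<Rightarrow> nat \<Rightarrow> real \<Rightarrow> nat \<Rightarrow> state \<Rightarrow> bool" where
  "phase_inv E d r K M \<eta> k t \<longleftrightarrow> (\<exists>q \<le> 2 * M * k. core t = (d, r, K, M, k, offset M k, \<eta>, sine_bound k, offset M k, q)) \<and>
     (\<forall>i<d. arr t 1 i = direction d r (1 - 2 * \<eta>) M (point E) (label E) k i)"

text \<open>A loop that counts while j < M / sigma makes as many iterations as the ceiling of M /
  sigma, so the machine can do without rounding.\<close>

lemma less_draws_iff: "j < draws M k \<longleftrightarrow> real j < real M / sine_bound k"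
  by (simp add: draws_def zless_nat_eq_int_zless less_ceiling_iff)

lemma wp_phase_start:
  assumes "core t = (d, r, K, M, k, n0, \<eta>, \<sigma>, n0, q0)"
  shows "wp E phase_start_prog (6 * d + 7) (draw_inv E d r K M k \<eta> \<sigma> (arr t 1) n0 q0 0) t"
proof -
  note c = assms[unfolded core_def, simplified]
  have d: "reg t 0 = d" using c by simp
  have "wp E phase_start_prog ((1 + (3 * d + 2)) + (1 + (1 + (3 * d + 2)))) (draw_inv E d r K M k \<eta> \<sigma> (arr t 1) n0 q0 0) t"
    unfolding phase_start_prog_def
  proof (intro wp_Seq wp_dot_prog[OF d] wp_NSet)
    fix t1 :: state assume t1: "reg t1 = (reg t)(1 := d)" "arr t1 = (arr t)(4 := (arr t 4)(1 := ip d (arr t 1) (arr t 1)))"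
      "drawn t1 = drawn t" "requested t1 = requested t"
    let ?t2 = "tick 1 (set_reg 8 (nval (NConst 0) (tick 1 (set_reg 7 (nval (NConst 0) t1) t1))) (tick 1 (set_reg 7 (nval (NConst 0) t1) t1)))"
    have d2: "reg ?t2 0 = d" using d by (simp add: t1)
    show "wp E (map_vec 3 (OfNat (NConst 0))) (3 * d + 2) (draw_inv E d r K M k \<eta> \<sigma> (arr t 1) n0 q0 0) ?t2"
    proof (rule wp_map_vec[OF d2, where f="\<lambda>_. 0"])
      fix u :: state assume u: "reg u = (reg ?t2)(1 := d)" "arr u = (arr ?t2)(3 := (\<lambda>j. if j < d then 0 else arr ?t2 3 j))"
        "drawn u = drawn ?t2" "requested u = requested ?t2"
      show "draw_inv E d r K M k \<eta> \<sigma> (arr t 1) n0 q0 0 u"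
        using c by (simp add: draw_inv_def Let_def u t1 label_sum_def band_count_def)
    qed simp
  qed auto
  then show ?thesis
    by (rule wp_weaken) simp
qed

lemma wp_draw_loop:
  assumes E: "dimension E = d" and I: "draw_inv E d r K M k \<eta> (sine_bound k') v n0 q0 0 t"
  shows "wp E draw_loop_prog (draws M k' * (7 * d + 12) + 1) (draw_inv E d r K M k \<eta> (sine_bound k') v n0 q0 (draws M k')) t"
proof -
  have "wp E draw_loop_prog (draws M k' * ((7 * d + 11) + 1) + 1) (draw_inv E d r K M k \<eta> (sine_bound k') v n0 q0 (draws M k')) t"
    unfolding draw_loop_prog_def
  proof (rule wp_Loop[where I="draw_inv E d r K M k \<eta> (sine_bound k') v n0 q0"])
    show "draw_inv E d r K M k \<eta> (sine_bound k') v n0 q0 0 t" by (rule I)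
  next
    fix j and t :: state assume j: "j < draws M k'" and I: "draw_inv E d r K M k \<eta> (sine_bound k') v n0 q0 j t"
    then have "draw_inv E d r K M k \<eta> (sine_bound k') v n0 q0 j (tick 1 t)"
      by (simp add: draw_inv_def)
    from wp_draw_prog[OF E this] show "bval draw_test t \<and>
        wp E draw_prog (7 * d + 11) (draw_inv E d r K M k \<eta> (sine_bound k') v n0 q0 (Suc j)) (tick 1 t)"
      using I j by (simp add: draw_inv_def Let_def less_draws_iff)
  next
    fix t :: state assume I: "draw_inv E d r K M k \<eta> (sine_bound k') v n0 q0 (draws M k') t"
    have "\<not> real (draws M k') < real M / sine_bound k'"
      using less_draws_iff[of "draws M k'" M k'] by simp
    then show "\<not> bval draw_test t \<and>
        draw_inv E d r K M k \<eta> (sine_bound k') v n0 q0 (draws M k') (tick 1 t)"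
      using I by (simp add: draw_inv_def Let_def)
  qed
  then show ?thesis
    by (rule wp_weaken) simp
qed

lemma wp_step:
  assumes c: "core t = (d, r, K, M, k, n, \<eta>, \<sigma>, n, q)" and N: "reg t 7 = N" and v: "arr t 1 = v"
    and vv: "arr t 4 1 = ip d v v" and g: "\<And>i. i < d \<Longrightarrow> arr t 3 i = real N * g i" and N0: "N > 0"
  shows "wp E step_prog (9 * d + 7) (\<lambda>u. core u = core t \<and>
    (\<forall>i<d. arr u 1 i = v i + 10 * real r / (1 - 2 * \<eta>) * correction d v g i)) t"
proof -
  note c' = c[unfolded core_def, simplified]
  have d: "reg t 0 = d" using c' by simp
  let ?Q = "\<lambda>u. core u = core t \<and> (\<forall>i<d. arr u 1 i = v i + 10 * real r / (1 - 2 * \<eta>) * correction d v g i)"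
  have "wp E step_prog ((3 * d + 2) + ((1 + (3 * d + 2)) + (3 * d + 2))) ?Q t"
    unfolding step_prog_def
  proof (intro wp_Seq, rule wp_map_vec[OF d, where f=g])
    fix i and t' :: state assume "i < d" "reg t' = (reg t)(1 := i)" "arr t' = (arr t)(3 := (\<lambda>j. if j < i then g j else arr t 3 j))"
    then show "rval (RDivide (Cell 3 (NReg 1)) (OfNat (NReg 7))) t' = g i"
      using N N0 g by simp
  next
    fix t1 :: state assume t1: "reg t1 = (reg t)(1 := d)" "arr t1 = (arr t)(3 := (\<lambda>j. if j < d then g j else arr t 3 j))"
      "drawn t1 = drawn t" "requested t1 = requested t"
    have d1: "reg t1 0 = d" using d by (simp add: t1)
    let ?e = step_expr
    show "wp E (Seq (dot_prog 1 3 2) (map_vec 1 ?e)) ((1 + (3 * d + 2)) + (3 * d + 2)) ?Q t1"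
    proof (intro wp_Seq, rule wp_dot_prog[OF d1])
      fix t2 :: state assume t2: "reg t2 = (reg t1)(1 := d)" "arr t2 = (arr t1)(4 := (arr t1 4)(2 := ip d (arr t1 1) (arr t1 3)))"
        "drawn t2 = drawn t1" "requested t2 = requested t1"
      have d2: "reg t2 0 = d" using d by (simp add: t2 t1)
      have ipg: "ip d v (\<lambda>j. if j < d then g j else arr t 3 j) = ip d v g"
        by (rule ip_cong) auto
      have a2: "arr t2 4 2 = ip d v g" "arr t2 4 1 = ip d v v" "arr t2 1 = v" "arr t2 0 0 = \<eta>" "reg t2 2 = r"
        "\<And>i. i < d \<Longrightarrow> arr t2 3 i = g i"
        using v vv c' by (simp_all add: t2 t1 ipg)
      show "wp E (map_vec 1 ?e) (3 * d + 2) ?Q t2"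
      proof (rule wp_map_vec[OF d2, where f="\<lambda>i. v i + 10 * real r / (1 - 2 * \<eta>) * correction d v g i"])
        fix i and t' :: state assume "i < d" "reg t' = (reg t2)(1 := i)"
          "arr t' = (arr t2)(1 := (\<lambda>j. if j < i then v j + 10 * real r / (1 - 2 * \<eta>) * correction d v g j else arr t2 1 j))"
        then show "rval ?e t' = v i + 10 * real r / (1 - 2 * \<eta>) * correction d v g i"
          using a2 by (simp add: correction_def)
      next
        fix u :: state assume u: "reg u = (reg t2)(1 := d)"
          "arr u = (arr t2)(1 := (\<lambda>j. if j < d then v j + 10 * real r / (1 - 2 * \<eta>) * correction d v g j else arr t2 1 j))"
          "drawn u = drawn t2" "requested u = requested t2"
        show "?Q u"
          by (simp add: core_def u t2 t1)
      qed
    qed auto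
  qed
  then show ?thesis
    by (rule wp_weaken) simp
qed

lemma wp_newton:
  assumes d: "reg t 0 = d" and u: "\<And>i. i < d \<Longrightarrow> arr t 1 i = u i"
  shows "wp E newton_prog (48 * d + 58) (\<lambda>s. core s = core t \<and> (\<forall>i<d. arr s 1 i = (newton d ^^ 8) u i)) t"
proof -
  let ?I = "\<lambda>m s. core s = core t \<and> reg s 9 = m \<and> (\<forall>i<d. arr s 1 i = (newton d ^^ m) u i)"
  let ?T = "(1 + (3 * d + 2)) + ((3 * d + 2) + 1)"
  have "wp E newton_prog (1 + (8 * (?T + 1) + 1)) (\<lambda>s. core s = core t \<and> (\<forall>i<d. arr s 1 i = (newton d ^^ 8) u i)) t"
    unfolding newton_prog_def
  proof (intro wp_Seq wp_NSet, rule wp_Loop[where I="?I"])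
    show "?I 0 (tick 1 (set_reg 9 (nval (NConst 0) t) t))"
      using u by (simp add: core_def)
  next
    fix m and s :: state assume m: "m < 8" and I: "?I m s"
    have d0: "reg (tick 1 s) 0 = d" using I d by (simp add: core_def)
    show "bval (NLess (NReg 9) (NConst 8)) s \<and>
      wp E (Seq (dot_prog 1 1 1) (Seq (map_vec 1 newton_expr) (incr 9))) ?T (?I (Suc m)) (tick 1 s)"
    proof (intro conjI wp_Seq wp_dot_prog[OF d0])
      show "bval (NLess (NReg 9) (NConst 8)) s" using I m by simp
    next
      fix t1 :: state assume t1: "reg t1 = (reg (tick 1 s))(1 := d)"
        "arr t1 = (arr (tick 1 s))(4 := (arr (tick 1 s) 4)(1 := ip d (arr (tick 1 s) 1) (arr (tick 1 s) 1)))"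
        "drawn t1 = drawn (tick 1 s)" "requested t1 = requested (tick 1 s)"
      have d1: "reg t1 0 = d" using I d by (simp add: t1 core_def)
      have ipe: "ip d (arr s 1) (arr s 1) = ip d ((newton d ^^ m) u) ((newton d ^^ m) u)"
        using I by (intro ip_cong) auto
      have nt: "(newton d ^^ Suc m) u i = 2 * (newton d ^^ m) u i / (1 + ip d ((newton d ^^ m) u) ((newton d ^^ m) u))" for i
        by (simp add: newton_def[of d "(newton d ^^ m) u"])
      show "wp E (map_vec 1 newton_expr) (3 * d + 2)
        (\<lambda>s. wp E (incr 9) 1 (?I (Suc m)) s) t1"
      proof (rule wp_map_vec[OF d1, where f="(newton d ^^ Suc m) u"])
        fix i and t' :: state assume "i < d" "reg t' = (reg t1)(1 := i)"
          "arr t' = (arr t1)(1 := (\<lambda>j. if j < i then (newton d ^^ Suc m) u j else arr t1 1 j))"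
        then show "rval newton_expr t' = (newton d ^^ Suc m) u i"
          using I unfolding nt by (simp add: t1 ipe[unfolded One_nat_def])
      next
        fix t2 :: state assume t2: "reg t2 = (reg t1)(1 := d)"
          "arr t2 = (arr t1)(1 := (\<lambda>j. if j < d then (newton d ^^ Suc m) u j else arr t1 1 j))"
          "drawn t2 = drawn t1" "requested t2 = requested t1"
        show "wp E (incr 9) 1 (?I (Suc m)) t2"
          using I by (intro wp_NSet) (simp add: core_def t2 t1 del: funpow.simps)
      qed
    qed auto
  qed (auto simp: core_def)
  then show ?thesis
    by (rule wp_weaken) simp
qed

lemma in_band_cong:
  assumes "\<And>i. i < d \<Longrightarrow> v i = v' i"
  shows "in_band d r \<sigma> v z = in_band d r \<sigma> v' z"
proof -
  have "ip d v v = ip d v' v'" "ip d v z = ip d v' z"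
    using assms by (auto intro!: ip_cong)
  then show ?thesis by (simp add: in_band_def)
qed

text \<open>Array 1 is known to agree with \<open>direction\<close> only below \<open>d\<close>;
  this lets the phase be computed from the array.\<close>

lemma phase_agree:
  assumes v: "\<And>i. i < d \<Longrightarrow> v i = v' i" and i: "i < d"
  shows "phase d r \<rho> M \<sigma> N v x y i = phase d r \<rho> M \<sigma> N v' x y i"
proof -
  have ib: "in_band d r \<sigma> v z = in_band d r \<sigma> v' z" for z
    by (rule in_band_cong[OF v])
  have ls: "label_sum d r \<sigma> M v x y N = label_sum d r \<sigma> M v' x y N"
    by (simp add: label_sum_def band_count_def ib)
  show ?thesis
    unfolding phase_def advance_def ls correction_def
  proof (rule newton_pow_cong[OF _ i])
    fix i assume i: "i < d"
    have "ip d v g = ip d v' g" "ip d v v = ip d v' v'" for g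
      using v by (auto intro!: ip_cong)
    then show "v i + 10 * real r / \<rho> * (label_sum d r \<sigma> M v' x y N i / real N -
          ip d v (\<lambda>i. label_sum d r \<sigma> M v' x y N i / real N) / ip d v v * v i) =
        v' i + 10 * real r / \<rho> * (label_sum d r \<sigma> M v' x y N i / real N -
          ip d v' (\<lambda>i. label_sum d r \<sigma> M v' x y N i / real N) / ip d v' v' * v' i)"
      using v[OF i] by simp
  qed
qed

lemma wp_phase:
  assumes E: "dimension E = d" and M: "M \<ge> 1" and I: "phase_inv E d r K M \<eta> k t"
  shows "wp E phase_prog (draws M k * (7 * d + 12) + 63 * d + 75) (phase_inv E d r K M \<eta> (Suc k)) t"
proof -
  obtain q where q: "q \<le> 2 * M * k" and c: "core t = (d, r, K, M, k, offset M k, \<eta>, sine_bound k, offset M k, q)"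
    and dir: "\<And>i. i < d \<Longrightarrow> arr t 1 i = direction d r (1 - 2 * \<eta>) M (point E) (label E) k i"
    using I unfolding phase_inv_def by blast
  let ?x = "\<lambda>l. point E (offset M k + l)" and ?y = "\<lambda>l. label E (offset M k + l)" and ?N = "draws M k"
  let ?v = "arr t 1" and ?n = "offset M (Suc k)"
  let ?g = "\<lambda>i. label_sum d r (sine_bound k) M ?v ?x ?y ?N i / real ?N"
  let ?u = "\<lambda>i. ?v i + 10 * real r / (1 - 2 * \<eta>) * correction d ?v ?g i"
  have n: "?n = offset M k + ?N"
    by (simp add: offset_def)
  have N0: "?N > 0"
    using M draws_bounds(1)[of M k] by (cases "?N = 0") auto
  have "wp E phase_prog ((6 * d + 7) + ((?N * (7 * d + 12) + 1) + ((9 * d + 7) + ((48 * d + 58) + (1 + 1)))))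
      (phase_inv E d r K M \<eta> (Suc k)) t"
    unfolding phase_prog_def
  proof (intro wp_Seq, rule wp_conseq[OF wp_phase_start[OF c] order_refl])
    fix t1 assume t1: "draw_inv E d r K M k \<eta> (sine_bound k) ?v (offset M k) q 0 t1"
    show "wp E (Seq draw_loop_prog (Seq step_prog (Seq newton_prog
     (Seq (RSet 4 (NConst 0) shrink_expr)
       (incr 6))))) ((?N * (7 * d + 12) + 1) + ((9 * d + 7) + ((48 * d + 58) + (1 + 1))))
       (phase_inv E d r K M \<eta> (Suc k)) t1"
    proof (intro wp_Seq, rule wp_conseq[OF wp_draw_loop[OF E t1] order_refl])
      fix t2 assume "draw_inv E d r K M k \<eta> (sine_bound k) ?v (offset M k) q ?N t2"
      note t2 = this[unfolded draw_inv_def Let_def]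
      define q' where "q' = q + min (2 * M) (band_count d r (sine_bound k) ?v ?x ?N)"
      have q': "q' \<le> 2 * M * Suc k" using q by (simp add: q'_def)
      have c2: "core t2 = (d, r, K, M, k, ?n, \<eta>, sine_bound k, ?n, q')"
        using t2 by (simp add: core_def n q'_def)
      have N2: "reg t2 7 = ?N" and v2: "arr t2 1 = ?v" and vv2: "arr t2 4 1 = ip d ?v ?v"
        using t2 by auto
      have g2: "arr t2 3 i = real ?N * ?g i" if "i < d" for i
        using t2 that N0 by simp
      show "wp E (Seq step_prog (Seq newton_prog
       (Seq (RSet 4 (NConst 0) shrink_expr)
         (incr 6)))) ((9 * d + 7) + ((48 * d + 58) + (1 + 1)))
         (phase_inv E d r K M \<eta> (Suc k)) t2"
      proof (intro wp_Seq, rule wp_conseq[OF wp_step[OF c2 N2 v2 vv2 g2 N0] order_refl])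
        fix t3 assume t3: "core t3 = core t2 \<and> (\<forall>i<d. arr t3 1 i = ?u i)"
        then have d3: "reg t3 0 = d" and u3: "\<And>i. i < d \<Longrightarrow> arr t3 1 i = ?u i"
          using c2 by (auto simp: core_def)
        show "wp E (Seq newton_prog
         (Seq (RSet 4 (NConst 0) shrink_expr)
           (incr 6))) ((48 * d + 58) + (1 + 1))
           (phase_inv E d r K M \<eta> (Suc k)) t3"
        proof (intro wp_Seq, rule wp_conseq[OF wp_newton[OF d3 u3] order_refl])
          fix t4 assume t4: "core t4 = core t3 \<and> (\<forall>i<d. arr t4 1 i = (newton d ^^ 8) ?u i)"
          have ph: "arr t4 1 i = direction d r (1 - 2 * \<eta>) M (point E) (label E) (Suc k) i" if "i < d" for i
          proof -
            have "arr t4 1 i = phase d r (1 - 2 * \<eta>) M (sine_bound k) ?N ?v ?x ?y i"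
              using t4 that by (simp add: phase_def advance_def)
            also have "\<dots> = phase d r (1 - 2 * \<eta>) M (sine_bound k) ?N (direction d r (1 - 2 * \<eta>) M (point E) (label E) k) ?x ?y i"
              by (rule phase_agree[OF dir that])
            finally show ?thesis by simp
          qed
          have c4: "core t4 = (d, r, K, M, k, ?n, \<eta>, sine_bound k, ?n, q')"
            using t4 t3 c2 by simp
          show "wp E (Seq (RSet 4 (NConst 0) shrink_expr)
             (incr 6)) (1 + 1) (phase_inv E d r K M \<eta> (Suc k)) t4"
          proof (intro wp_Seq wp_RSet wp_NSet)
            let ?t5 = "tick 1 (set_cell 4 (nval (NConst 0) t4)
              (rval shrink_expr t4) t4)"
            let ?t6 = "tick 1 (set_reg 6 (nval (NPlus (NReg 6) (NConst 1)) ?t5) ?t5)"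
            have "core ?t6 = (d, r, K, M, Suc k, ?n, \<eta>, sine_bound (Suc k), ?n, q')"
              using c4 by (simp add: core_def sine_bound_Suc)
            moreover have "arr ?t6 1 = arr t4 1"
              by simp
            ultimately show "phase_inv E d r K M \<eta> (Suc k) ?t6"
              unfolding phase_inv_def using q' ph by metis
          qed
        qed
      qed
    qed
  qed
  then show ?thesis
    by (rule wp_weaken) simp
qed

section \<open>Searching for the parameters\<close>

abbreviation set_half :: com where
  "set_half \<equiv> RSet 4 (NConst 0) (RDivide (OfNat (NConst 1)) (OfNat (NConst 2)))"

abbreviation budget_expr :: rexp where
  "budget_expr \<equiv> RDivide (RTimes (RTimes (OfNat (NConst 1280000))
     (RTimes (RTimes (OfNat (NReg 2)) (OfNat (NReg 2))) (RTimes (OfNat (NReg 2)) (OfNat (NReg 2))))) (OfNat (NReg 4)))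
     (RTimes rho_expr rho_expr)"

definition root_prog :: com where
  "root_prog = Loop (RLess (RTimes (OfNat (NReg 2)) (OfNat (NReg 2))) (OfNat (NReg 0))) (incr 2)"

definition phases_prog :: com where
  "phases_prog = Seq set_half (Seq (NSet 3 (NConst 1))
     (Loop (RLess (Cell 0 (NConst 1)) (Cell 4 (NConst 0)))
       (Seq (RSet 4 (NConst 0) shrink_expr)
         (incr 3))))"

definition log_prog :: com where
  "log_prog = Seq (RSet 4 (NConst 4) (OfNat (NConst 1))) (Seq (NSet 4 (NConst 1))
     (Loop (RLess (Cell 4 (NConst 4)) (RTimes (OfNat (NReg 0)) (OfNat (NReg 3))))
       (Seq (RSet 4 (NConst 4) (RTimes (OfNat (NConst 2)) (Cell 4 (NConst 4))))
         (incr 4))))"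

text \<open>The search for the number of phases has shrunk cell 0 of array 4, so it is set to 1/2
  again before the first phase.\<close>

definition budget_prog :: com where
  "budget_prog = Seq
     (Loop (RLess (OfNat (NReg 5)) budget_expr)
      (incr 5))
     set_half"

definition learner_prog :: com where
  "learner_prog = Seq root_prog (Seq phases_prog (Seq log_prog (Seq budget_prog
     (Loop (NLess (NReg 6) (NReg 3)) phase_prog))))"

definition evaluator_prog :: com where
  "evaluator_prog = Seq (dot_prog 1 0 0) (RSet 0 (NConst 0) (Cell 4 (NConst 0)))"

abbreviation input_arr :: "real \<Rightarrow> real \<Rightarrow> nat \<Rightarrow> nat \<Rightarrow> real" where
  "input_arr \<eta> \<epsilon> \<equiv> (\<lambda>_ _. 0)(0 := (\<lambda>_. 0)(0 := \<eta>, 1 := \<epsilon>))"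

abbreviation blank :: "state \<Rightarrow> bool" where
  "blank s \<equiv> drawn s = 0 \<and> requested s = 0"

text \<open>\<^term>\<open>r\<close>, \<^term>\<open>m\<close>, \<^term>\<open>n\<close>, \<^term>\<open>M\<close> are the results of the four searches by counting up.\<close>

definition search_results :: "nat \<Rightarrow> real \<Rightarrow> real \<Rightarrow> nat \<Rightarrow> nat \<Rightarrow> nat \<Rightarrow> nat \<Rightarrow> bool" where
  "search_results d \<eta> \<epsilon> r m n M \<longleftrightarrow>
     real d \<le> (real r)\<^sup>2 \<and> (\<forall>j<r. (real j)\<^sup>2 < real d) \<and>
     sine_bound m \<le> \<epsilon> \<and> (\<forall>j<m. \<epsilon> < sine_bound j) \<and>
     real d * real (Suc m) \<le> 2 ^ n \<and> (\<forall>j<n. 2 ^ j < real d * real (Suc m)) \<and>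
     1280000 * (real r) ^ 4 * real (Suc n) / (1 - 2 * \<eta>)\<^sup>2 \<le> real M \<and>
     (\<forall>j<M. real j < 1280000 * (real r) ^ 4 * real (Suc n) / (1 - 2 * \<eta>)\<^sup>2)"

lemma ex_first: "\<exists>n::nat. P n \<Longrightarrow> \<exists>n. P n \<and> (\<forall>j<n. \<not> P j)"
  using exists_least_iff[of P] by blast

lemma ex_search_results:
  assumes "0 < \<epsilon>"
  shows "\<exists>r m n M. search_results d \<eta> \<epsilon> r m n M"
proof -
  have "real d \<le> (real d)\<^sup>2"
    using power2_eq_square[of "real d"] by (cases d) (auto simp: algebra_simps)
  then obtain r where r: "real d \<le> (real r)\<^sup>2" "\<forall>j<r. \<not> real d \<le> (real j)\<^sup>2"
    using ex_first[of "\<lambda>j. real d \<le> (real j)\<^sup>2"] by blast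
  obtain m0 where "(15/16 :: real) ^ m0 < \<epsilon>"
    using real_arch_pow_inv[OF assms, of "15/16"] by auto
  then have "sine_bound m0 \<le> \<epsilon>"
    using assms by (simp add: sine_bound_def)
  then obtain m where m: "sine_bound m \<le> \<epsilon>" "\<forall>j<m. \<not> sine_bound j \<le> \<epsilon>"
    using ex_first[of "\<lambda>j. sine_bound j \<le> \<epsilon>"] by blast
  obtain n0 where "real d * real (Suc m) < 2 ^ n0"
    using real_arch_pow[of 2 "real d * real (Suc m)"] by auto
  then obtain n where n: "real d * real (Suc m) \<le> 2 ^ n" "\<forall>j<n. \<not> real d * real (Suc m) \<le> 2 ^ j"
    using ex_first[of "\<lambda>j. real d * real (Suc m) \<le> 2 ^ j"] less_imp_le by blast
  obtain M where M: "1280000 * (real r) ^ 4 * real (Suc n) / (1 - 2 * \<eta>)\<^sup>2 \<le> real M"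
    "\<forall>j<M. \<not> 1280000 * (real r) ^ 4 * real (Suc n) / (1 - 2 * \<eta>)\<^sup>2 \<le> real j"
    using ex_first[of "\<lambda>j. 1280000 * (real r) ^ 4 * real (Suc n) / (1 - 2 * \<eta>)\<^sup>2 \<le> real j"] real_arch_simple by blast
  show ?thesis
    unfolding search_results_def using r m n M by (auto simp: not_le)
qed

lemma wp_root:
  assumes s: "reg s = (\<lambda>_. 0)(0 := d)" "arr s = A" "blank s"
    and r: "real d \<le> (real r)\<^sup>2" "\<forall>j<r. (real j)\<^sup>2 < real d"
  shows "wp E root_prog (2 * r + 1) (\<lambda>t. reg t = (\<lambda>_. 0)(0 := d, 2 := r) \<and> arr t = A \<and> blank t) s"
proof -
  have "wp E root_prog (r * (1 + 1) + 1) (\<lambda>t. reg t = (\<lambda>_. 0)(0 := d, 2 := r) \<and> arr t = A \<and> blank t) s"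
    unfolding root_prog_def
  proof (rule wp_Loop[where I="\<lambda>j t. reg t = (\<lambda>_. 0)(0 := d, 2 := j) \<and> arr t = A \<and> blank t"])
    fix j and t :: state assume "j < r" "reg t = (\<lambda>_. 0)(0 := d, 2 := j) \<and> arr t = A \<and> blank t"
    then show "bval (RLess (RTimes (OfNat (NReg 2)) (OfNat (NReg 2))) (OfNat (NReg 0))) t \<and>
        wp E (incr 2) 1 (\<lambda>t. reg t = (\<lambda>_. 0)(0 := d, 2 := Suc j) \<and> arr t = A \<and> blank t) (tick 1 t)"
      using r by (intro conjI wp_NSet) (auto simp: power2_eq_square)
  qed (use s r in \<open>auto simp: power2_eq_square fun_upd_idem\<close>)
  then show ?thesis
    by (rule wp_weaken) simp
qed

lemma wp_phases:
  assumes s: "reg s = (\<lambda>_. 0)(0 := d, 2 := r)" "arr s = input_arr \<eta> \<epsilon>" "blank s"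
    and m: "sine_bound m \<le> \<epsilon>" "\<forall>j<m. \<epsilon> < sine_bound j"
  shows "wp E phases_prog (3 * m + 3) (\<lambda>t. reg t = (\<lambda>_. 0)(0 := d, 2 := r, 3 := Suc m) \<and>
    arr t = (input_arr \<eta> \<epsilon>)(4 := (\<lambda>_. 0)(0 := sine_bound m)) \<and> blank t) s"
proof -
  let ?I = "\<lambda>j t. reg t = (\<lambda>_. 0)(0 := d, 2 := r, 3 := Suc j) \<and>
    arr t = (input_arr \<eta> \<epsilon>)(4 := (\<lambda>_. 0)(0 := sine_bound j)) \<and> blank t"
  have "wp E phases_prog (1 + (1 + (m * ((1 + 1) + 1) + 1))) (?I m) s"
    unfolding phases_prog_def
  proof (intro wp_Seq wp_RSet wp_NSet, rule wp_Loop[where I="?I"])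
    fix j and t :: state assume "j < m" "?I j t"
    then show "bval (RLess (Cell 0 (NConst 1)) (Cell 4 (NConst 0))) t \<and>
        wp E (Seq (RSet 4 (NConst 0) shrink_expr)
         (incr 3)) (1 + 1) (?I (Suc j)) (tick 1 t)"
      using m by (intro conjI wp_Seq wp_RSet wp_NSet) (auto simp: sine_bound_Suc)
  qed (use s m in \<open>auto simp: sine_bound_def\<close>)
  then show ?thesis
    by (rule wp_weaken) simp
qed

lemma wp_log:
  assumes s: "reg s = (\<lambda>_. 0)(0 := d, 2 := r, 3 := K)" "arr s = (input_arr \<eta> \<epsilon>)(4 := (\<lambda>_. 0)(0 := \<sigma>))" "blank s"
    and n: "real d * real K \<le> 2 ^ n" "\<forall>j<n. 2 ^ j < real d * real K"
  shows "wp E log_prog (3 * n + 3) (\<lambda>t. reg t = (\<lambda>_. 0)(0 := d, 2 := r, 3 := K, 4 := Suc n) \<and>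
    arr t = (input_arr \<eta> \<epsilon>)(4 := (\<lambda>_. 0)(0 := \<sigma>, 4 := 2 ^ n)) \<and> blank t) s"
proof -
  let ?I = "\<lambda>j t. reg t = (\<lambda>_. 0)(0 := d, 2 := r, 3 := K, 4 := Suc j) \<and>
    arr t = (input_arr \<eta> \<epsilon>)(4 := (\<lambda>_. 0)(0 := \<sigma>, 4 := 2 ^ j)) \<and> blank t"
  have "wp E log_prog (1 + (1 + (n * ((1 + 1) + 1) + 1))) (?I n) s"
    unfolding log_prog_def
  proof (intro wp_Seq wp_RSet wp_NSet, rule wp_Loop[where I="?I"])
    fix j and t :: state assume "j < n" "?I j t"
    then show "bval (RLess (Cell 4 (NConst 4)) (RTimes (OfNat (NReg 0)) (OfNat (NReg 3)))) t \<and>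
        wp E (Seq (RSet 4 (NConst 4) (RTimes (OfNat (NConst 2)) (Cell 4 (NConst 4))))
         (incr 4)) (1 + 1) (?I (Suc j)) (tick 1 t)"
      using n by (intro conjI wp_Seq wp_RSet wp_NSet) auto
  qed (use s n in auto)
  then show ?thesis
    by (rule wp_weaken) simp
qed

lemma wp_budget:
  assumes s: "reg s = (\<lambda>_. 0)(0 := d, 2 := r, 3 := K, 4 := L)" "arr s = (input_arr \<eta> \<epsilon>)(4 := (\<lambda>_. 0)(0 := \<sigma>, 4 := p))" "blank s"
    and M: "1280000 * (real r) ^ 4 * real L / (1 - 2 * \<eta>)\<^sup>2 \<le> real M"
      "\<forall>j<M. real j < 1280000 * (real r) ^ 4 * real L / (1 - 2 * \<eta>)\<^sup>2"
  shows "wp E budget_prog (2 * M + 2) (phase_inv E d r K M \<eta> 0) s"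
proof -
  let ?I = "\<lambda>j t. reg t = (\<lambda>_. 0)(0 := d, 2 := r, 3 := K, 4 := L, 5 := j) \<and>
    arr t = (input_arr \<eta> \<epsilon>)(4 := (\<lambda>_. 0)(0 := \<sigma>, 4 := p)) \<and> blank t"
  let ?b = "RLess (OfNat (NReg 5)) budget_expr"
  have b: "bval ?b t \<longleftrightarrow> real j < 1280000 * (real r) ^ 4 * real L / (1 - 2 * \<eta>)\<^sup>2" if "?I j t" for j t
    using that by (simp add: power2_eq_square power4_eq_xxxx mult.assoc)
  have "wp E budget_prog ((M * (1 + 1) + 1) + 1) (phase_inv E d r K M \<eta> 0) s"
    unfolding budget_prog_def
  proof (rule wp_Seq, rule wp_Loop[where I="?I"])
    show "?I 0 s"
      using s by (simp add: fun_upd_idem)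
  next
    fix j and t :: state assume j: "j < M" and I: "?I j t"
    then show "bval ?b t \<and> wp E (incr 5) 1 (?I (Suc j)) (tick 1 t)"
      using M(2) b[OF I] by (intro conjI wp_NSet) auto
  next
    fix t :: state assume I: "?I M t"
    have "wp E set_half 1 (phase_inv E d r K M \<eta> 0) (tick 1 t)"
      using I by (intro wp_RSet) (simp add: phase_inv_def core_def offset_def sine_bound_def)
    then show "\<not> bval ?b t \<and> wp E set_half 1 (phase_inv E d r K M \<eta> 0) (tick 1 t)"
      using M(1) b[OF I] by auto
  qed
  then show ?thesis
    by (rule wp_weaken) simp
qed

section \<open>The complete learner and its evaluator\<close>

lemma draws_mono: "k \<le> m \<Longrightarrow> draws M k \<le> draws M m"
proof -
  assume "k \<le> m"
  then have "sine_bound m \<le> sine_bound k"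
    unfolding sine_bound_def by (intro divide_right_mono power_decreasing) auto
  then have "real M / sine_bound k \<le> real M / sine_bound m"
    by (intro divide_left_mono) auto
  then show "draws M k \<le> draws M m"
    unfolding draws_def by (intro nat_mono ceiling_mono)
qed

text \<open>Bounding all phases by the last and longest one costs a factor \<open>Suc m\<close>, of
  order log (1 / epsilon), which the claimed number of unlabeled samples contains.\<close>

lemma offset_le: "offset M (Suc m) \<le> Suc m * draws M m"
proof -
  have "offset M (Suc m) \<le> (\<Sum>i<Suc m. draws M m)"
    unfolding offset_def by (intro sum_mono draws_mono) auto
  then show ?thesis by simp
qed

definition total_time :: "nat \<Rightarrow> nat \<Rightarrow> nat \<Rightarrow> nat \<Rightarrow> nat \<Rightarrow> nat" where
  "total_time d r m n M = (2 * r + 1) + ((3 * m + 3) + ((3 * n + 3) + ((2 * M + 2) +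
     (Suc m * ((draws M m * (7 * d + 12) + 63 * d + 75) + 1) + 1))))"

lemma wp_learner:
  assumes E: "dimension E = d" and M1: "M \<ge> 1" and S: "search_results d \<eta> \<epsilon> r m n M"
  shows "wp E learner_prog (total_time d r m n M) (phase_inv E d r (Suc m) M \<eta> (Suc m)) (initial_state d \<eta> \<epsilon>)"
  unfolding learner_prog_def total_time_def
proof (intro wp_Seq, rule wp_conseq[OF wp_root order_refl])
  note S' = S[unfolded search_results_def]
  show "reg (initial_state d \<eta> \<epsilon>) = (\<lambda>_. 0)(0 := d)" "arr (initial_state d \<eta> \<epsilon>) = input_arr \<eta> \<epsilon>" "blank (initial_state d \<eta> \<epsilon>)"
    "real d \<le> (real r)\<^sup>2" "\<forall>j<r. (real j)\<^sup>2 < real d"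
    using S' by (simp_all add: initial_state_def)
  let ?loop = "Loop (NLess (NReg 6) (NReg 3)) phase_prog"
  let ?Tl = "Suc m * ((draws M m * (7 * d + 12) + 63 * d + 75) + 1) + 1"
  let ?Q = "phase_inv E d r (Suc m) M \<eta> (Suc m)"
  fix t1 :: state assume t1: "reg t1 = (\<lambda>_. 0)(0 := d, 2 := r) \<and> arr t1 = input_arr \<eta> \<epsilon> \<and> blank t1"
  show "wp E (Seq phases_prog (Seq log_prog (Seq budget_prog ?loop))) ((3 * m + 3) + ((3 * n + 3) + ((2 * M + 2) + ?Tl))) ?Q t1"
  proof (intro wp_Seq, rule wp_conseq[OF wp_phases order_refl])
    show "reg t1 = (\<lambda>_. 0)(0 := d, 2 := r)" "arr t1 = input_arr \<eta> \<epsilon>" "blank t1" "sine_bound m \<le> \<epsilon>" "\<forall>j<m. \<epsilon> < sine_bound j"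
      using t1 S' by auto
    fix t2 :: state assume t2: "reg t2 = (\<lambda>_. 0)(0 := d, 2 := r, 3 := Suc m) \<and>
      arr t2 = (input_arr \<eta> \<epsilon>)(4 := (\<lambda>_. 0)(0 := sine_bound m)) \<and> blank t2"
    show "wp E (Seq log_prog (Seq budget_prog ?loop)) ((3 * n + 3) + ((2 * M + 2) + ?Tl)) ?Q t2"
    proof (intro wp_Seq, rule wp_conseq[OF wp_log order_refl])
      show "reg t2 = (\<lambda>_. 0)(0 := d, 2 := r, 3 := Suc m)" "arr t2 = (input_arr \<eta> \<epsilon>)(4 := (\<lambda>_. 0)(0 := sine_bound m))" "blank t2"
        "real d * real (Suc m) \<le> 2 ^ n" "\<forall>j<n. 2 ^ j < real d * real (Suc m)"
        using t2 S' by blast+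
      fix t3 :: state assume t3: "reg t3 = (\<lambda>_. 0)(0 := d, 2 := r, 3 := Suc m, 4 := Suc n) \<and>
        arr t3 = (input_arr \<eta> \<epsilon>)(4 := (\<lambda>_. 0)(0 := sine_bound m, 4 := 2 ^ n)) \<and> blank t3"
      show "wp E (Seq budget_prog ?loop) ((2 * M + 2) + ?Tl) ?Q t3"
      proof (intro wp_Seq, rule wp_conseq[OF wp_budget order_refl])
        show "reg t3 = (\<lambda>_. 0)(0 := d, 2 := r, 3 := Suc m, 4 := Suc n)"
          "arr t3 = (input_arr \<eta> \<epsilon>)(4 := (\<lambda>_. 0)(0 := sine_bound m, 4 := 2 ^ n))" "blank t3"
          "1280000 * (real r) ^ 4 * real (Suc n) / (1 - 2 * \<eta>)\<^sup>2 \<le> real M"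
          "\<forall>j<M. real j < 1280000 * (real r) ^ 4 * real (Suc n) / (1 - 2 * \<eta>)\<^sup>2"
          using t3 S' by blast+
        fix t4 assume t4: "phase_inv E d r (Suc m) M \<eta> 0 t4"
        show "wp E ?loop ?Tl ?Q t4"
        proof (rule wp_Loop[where I="phase_inv E d r (Suc m) M \<eta>"])
          fix k and t :: state assume k: "k < Suc m" and I: "phase_inv E d r (Suc m) M \<eta> k t"
          have tick: "phase_inv E d r (Suc m) M \<eta> j (tick 1 t) = phase_inv E d r (Suc m) M \<eta> j t" for j t
            by (simp add: phase_inv_def core_def)
          have "draws M k * (7 * d + 12) \<le> draws M m * (7 * d + 12)"
            using draws_mono[of k m M] k by (intro mult_right_mono) auto
          then have le: "draws M k * (7 * d + 12) + 63 * d + 75 \<le> draws M m * (7 * d + 12) + 63 * d + 75"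
            by linarith
          have "phase_inv E d r (Suc m) M \<eta> k (tick 1 t)"
            using I unfolding tick .
          from wp_weaken[OF wp_phase[OF E M1 this] le]
          have "wp E phase_prog (draws M m * (7 * d + 12) + 63 * d + 75) (phase_inv E d r (Suc m) M \<eta> (Suc k)) (tick 1 t)" .
          moreover have "bval (NLess (NReg 6) (NReg 3)) t"
            using I k by (auto simp: phase_inv_def core_def)
          ultimately show "bval (NLess (NReg 6) (NReg 3)) t \<and>
              wp E phase_prog (draws M m * (7 * d + 12) + 63 * d + 75) (phase_inv E d r (Suc m) M \<eta> (Suc k)) (tick 1 t)"
            by blast
        next
          fix t :: state assume I: "phase_inv E d r (Suc m) M \<eta> (Suc m) t"
          then show "\<not> bval (NLess (NReg 6) (NReg 3)) t \<and> ?Q (tick 1 t)"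
            by (auto simp: phase_inv_def core_def)
        qed (rule t4)
      qed
    qed
  qed
qed

lemma evaluator_represents:
  assumes d: "reg s 0 = d" and T: "real (3 * d + 4) \<le> T"
  shows "represents evaluator_prog d T s (halfspace d (arr s 1))"
  unfolding represents_def
proof
  fix x assume "x \<in> unit_sphere d"
  let ?s = "(set_vec d 0 x s)\<lparr>steps := 0\<rparr>"
  have d0: "reg ?s 0 = d" using d by simp
  have ipx: "ip d v (\<lambda>i. if i < d then x i else 0) = ip d v x" for v
    by (rule ip_cong) auto
  have "wp (no_examples d) evaluator_prog ((1 + (3 * d + 2)) + 1) (\<lambda>t. arr t 0 0 = ip d (arr s 1) x) ?s"
    unfolding evaluator_prog_def
  proof (intro wp_Seq wp_dot_prog[OF d0] wp_RSet)
    fix t :: state assume "arr t = (arr ?s)(4 := (arr ?s 4)(0 := ip d (arr ?s 1) (arr ?s 0)))"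
    then show "arr (tick 1 (set_cell 0 (nval (NConst 0) t) (rval (Cell 4 (NConst 0)) t) t)) 0 0 = ip d (arr s 1) x"
      by (simp add: ipx)
  qed auto
  then obtain t where "exec (no_examples d) evaluator_prog ?s t" "steps t \<le> 0 + ((1 + (3 * d + 2)) + 1)" "arr t 0 0 = ip d (arr s 1) x"
    unfolding wp_def by auto
  then show "\<exists>t. exec (no_examples d) evaluator_prog ?s t \<and> real (steps t) \<le> T \<and> halfspace d (arr s 1) x = sign_pm (arr t 0 0)"
    using T by (intro exI[of _ t]) (auto simp: halfspace_eq)
qed

section \<open>Resources\<close>

lemma log1_ge_1: "1 \<le> log1 z"
  by (simp add: log1_def)

lemma ln_le_log1: "ln z \<le> log1 z"
  by (simp add: log1_def)

lemma log1_le_self: "1 \<le> z \<Longrightarrow> log1 z \<le> z"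
  using ln_le_minus_one[of z] by (simp add: log1_def)

text \<open>The test still held at m - 1, so (15/16)^(m - 1) > 2 epsilon, and ln (15/16) <= -1/16
  gives m - 1 <= 16 ln (1 / epsilon). The second claim says that the search stops soon after
  reaching epsilon, so that even the last phase draws only O(M / epsilon) points.\<close>

lemma phase_count_bound:
  assumes \<epsilon>: "0 < \<epsilon>" "\<epsilon> < 1" and m: "\<forall>j<m. \<epsilon> < sine_bound j"
  shows "real (Suc m) \<le> 18 * log1 (1 / \<epsilon>)" "\<epsilon> / 2 \<le> sine_bound m"
proof -
  have "real (Suc m) \<le> 18 * log1 (1 / \<epsilon>) \<and> \<epsilon> / 2 \<le> sine_bound m"
  proof (cases m)
    case 0
    then show ?thesis
      using log1_ge_1[of "1 / \<epsilon>"] \<epsilon> by (simp add: sine_bound_def)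
  next
    case (Suc j)
    then have j: "\<epsilon> < (15/16) ^ j / 2"
      using m by (simp add: sine_bound_def)
    then have "\<epsilon> \<le> (15/16) ^ j"
      using \<epsilon> by linarith
    then have "ln \<epsilon> \<le> ln ((15/16) ^ j)"
      using \<epsilon> by (subst ln_le_cancel_iff) auto
    also have "\<dots> = real j * ln (15/16)"
      by (simp add: ln_realpow)
    also have "\<dots> \<le> real j * (-1/16)"
      using ln_le_minus_one[of "15/16"] by (intro mult_left_mono) auto
    finally have "real j \<le> 16 * ln (1 / \<epsilon>)"
      using \<epsilon> by (simp add: ln_div)
    then have "real j \<le> 16 * log1 (1 / \<epsilon>)"
      using ln_le_log1[of "1 / \<epsilon>"] by linarith
    moreover have "\<epsilon> / 2 \<le> sine_bound m"
      using j \<epsilon> by (simp add: Suc sine_bound_def)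
    ultimately show ?thesis
      using log1_ge_1[of "1 / \<epsilon>"] Suc by simp
  qed
  then show "real (Suc m) \<le> 18 * log1 (1 / \<epsilon>)" "\<epsilon> / 2 \<le> sine_bound m" by auto
qed

text \<open>The search still ran at n - 1, so 2^(n - 1) < 18 y <= 2^5 y. With 1/2 <= ln 2 <= 1 this
  gives n - 1 <= 10 + 2 ln y.\<close>

lemma log_count_bound:
  assumes x: "1 \<le> x" "x \<le> 18 * y" and y: "1 \<le> y" and n: "\<forall>j<n. 2 ^ j < x"
  shows "real (Suc n) \<le> 14 * log1 y"
proof (cases n)
  case 0
  then show ?thesis
    using log1_ge_1[of y] by simp
next
  case (Suc j)
  then have "2 ^ j < x"
    using n by simp
  then have "2 ^ j \<le> 32 * y"
    using x(2) y by linarith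
  then have "ln (2 ^ j) \<le> ln (2 ^ 5 * y)"
    using y by (subst ln_le_cancel_iff) auto
  moreover have "ln (2 ^ 5 * y) = ln (2 ^ 5) + ln y"
    using y by (intro ln_mult_pos) auto
  moreover have "ln ((2::real) ^ i) = real i * ln 2" for i
    by (simp add: ln_realpow)
  ultimately have "real j * ln 2 \<le> real 5 * ln 2 + ln y"
    by metis
  then have "real j * ln 2 \<le> 5 * ln 2 + ln y"
    by simp
  moreover have ln2: "ln (2::real) \<le> 1" "1/2 \<le> ln (2::real)"
    using ln_le_minus_one[of 2] ln_le_minus_one[of "1/2"] by (simp_all add: ln_div)
  moreover have "real j * (1/2) \<le> real j * ln 2"
    using ln2 by (intro mult_left_mono) auto
  ultimately have "real j \<le> 10 + 2 * ln y"
    by linarith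
  then show ?thesis
    using ln_le_log1[of y] log1_ge_1[of y] Suc by simp
qed

text \<open>\<open>2 \<cdot> 1280000 \<cdot> 16 \<cdot> 14\<close>, from \<open>r\<^sup>4 \<le> 16 d\<^sup>2\<close> and the bound \<open>L \<le> 14 log1 (d log1 (1/\<epsilon>))\<close>.\<close>

definition budget_const :: real where
  "budget_const = 573440000"

lemma search_bounds:
  assumes S: "search_results d \<eta> \<epsilon> r m n M" and d: "d \<ge> 1" and \<eta>: "0 \<le> \<eta>" "\<eta> < 1/2" and \<epsilon>: "0 < \<epsilon>" "\<epsilon> < 1"
  defines "\<Lambda> \<equiv> log1 (1 / \<epsilon>)" and "l \<equiv> log1 (real d * log1 (1 / \<epsilon>))"
  shows "real d \<le> (real r)\<^sup>2" "(real r)\<^sup>2 \<le> 4 * real d" "M \<ge> 1"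
    "1280000 * (real r) ^ 4 * real (Suc n) \<le> real M * (1 - 2 * \<eta>)\<^sup>2" "real d * real (Suc m) \<le> 2 ^ (Suc n - 1)" "sine_bound m \<le> \<epsilon>"
    "real (Suc m) \<le> 18 * \<Lambda>" "real (Suc n) \<le> 14 * l" "real M \<le> budget_const * (1 / (1 - 2 * \<eta>)\<^sup>2 * (real d)\<^sup>2 * l)"
    "real (draws M m) \<le> 3 * real M / \<epsilon>"
proof -
  note S' = S[unfolded search_results_def]
  let ?\<rho> = "1 - 2 * \<eta>"
  have \<rho>: "0 < ?\<rho>" "?\<rho> \<le> 1" using \<eta> by auto
  show r: "real d \<le> (real r)\<^sup>2" "real d * real (Suc m) \<le> 2 ^ (Suc n - 1)" "sine_bound m \<le> \<epsilon>" using S' by auto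
  have "r \<noteq> 0" using r(1) d by (cases "r = 0") auto
  then obtain j where j: "r = Suc j" by (cases r) auto
  \<comment> \<open>The predecessor of \<open>r\<close> failed the search, so r <= sqrt d + 1 <= 2
    sqrt d.\<close>
  have "(real j)\<^sup>2 \<le> (sqrt (real d))\<^sup>2"
    using S' j by (simp add: less_imp_le)
  then have "real j \<le> sqrt (real d)"
    by (rule power2_le_imp_le) simp
  moreover have "1 \<le> sqrt (real d)" using d by simp
  ultimately have "real r \<le> 2 * sqrt (real d)"
    unfolding j of_nat_Suc by linarith
  then have "(real r)\<^sup>2 \<le> (2 * sqrt (real d))\<^sup>2"
    by (intro power_mono) auto
  then show r4: "(real r)\<^sup>2 \<le> 4 * real d"
    by (simp add: power_mult_distrib)
  have \<Lambda>1: "1 \<le> \<Lambda>" and l1: "1 \<le> l"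
    by (simp_all add: \<Lambda>_def l_def log1_ge_1)
  show K: "real (Suc m) \<le> 18 * \<Lambda>"
    unfolding \<Lambda>_def using phase_count_bound(1)[OF \<epsilon>] S' by blast
  show L: "real (Suc n) \<le> 14 * l"
    unfolding l_def
  proof (rule log_count_bound)
    show "1 \<le> real d * real (Suc m)"
      using d mult_mono[of 1 "real d" 1 "real (Suc m)"] by simp
    have "real d * real (Suc m) \<le> real d * (18 * \<Lambda>)"
      using K by (intro mult_left_mono) auto
    then show "real d * real (Suc m) \<le> 18 * (real d * log1 (1 / \<epsilon>))"
      by (simp add: \<Lambda>_def mult_ac)
    show "1 \<le> real d * log1 (1 / \<epsilon>)"
      using d \<Lambda>1 mult_mono[of 1 "real d" 1 \<Lambda>] by (simp add: \<Lambda>_def)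
    show "\<forall>j<n. 2 ^ j < real d * real (Suc m)" using S' by blast
  qed
  let ?X = "1280000 * (real r) ^ 4 * real (Suc n) / ?\<rho>\<^sup>2"
  have X1: "1 \<le> ?X"
  proof -
    have "1 \<le> (real r) ^ 4" using j by (simp add: one_le_power)
    then have "1 \<le> 1280000 * (real r) ^ 4 * real (Suc n)"
      using mult_mono[of 1 "1280000 * (real r) ^ 4" 1 "real (Suc n)"] by simp
    moreover have "?\<rho>\<^sup>2 \<le> 1" using \<rho> by (simp add: power_le_one)
    ultimately show ?thesis using \<rho> by (simp add: pos_le_divide_eq)
  qed
  have MX: "?X \<le> real M" using S' by blast
  then show M1: "M \<ge> 1" using X1 by (cases M) auto
  show "1280000 * (real r) ^ 4 * real (Suc n) \<le> real M * ?\<rho>\<^sup>2"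
    using MX \<rho> by (simp add: pos_divide_le_eq)
  have "\<forall>j<M. real j < ?X" using S' by blast
  moreover have "M - 1 < M" using M1 by simp
  ultimately have "real (M - 1) < ?X" by blast
  \<comment> \<open>\<open>M\<close> is the first integer that reaches \<open>?X\<close>, so it is
    below \<open>?X + 1\<close>, and \<open>?X\<close> is at least 1.\<close>
  then have "real M \<le> 2 * ?X" using X1 M1 by (simp add: of_nat_diff)
  also have "?X \<le> 1280000 * (16 * (real d)\<^sup>2) * (14 * l) / ?\<rho>\<^sup>2"
  proof (intro divide_right_mono mult_mono)
    have "((real r)\<^sup>2)\<^sup>2 \<le> (4 * real d)\<^sup>2"
      using r4 by (intro power_mono) auto
    then show "(real r) ^ 4 \<le> 16 * (real d)\<^sup>2"
      by (simp add: power_mult_distrib flip: power_mult)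
  qed (use L \<rho> in auto)
  finally show MB: "real M \<le> budget_const * (1 / ?\<rho>\<^sup>2 * (real d)\<^sup>2 * l)"
    by (simp add: budget_const_def)
  have "real (draws M m) \<le> real M / sine_bound m + 1"
    unfolding draws_def using of_int_ceiling_le_add_one[of "real M / sine_bound m"] by (simp add: less_imp_le)
  also have "real M / sine_bound m \<le> real M / (\<epsilon> / 2)"
    using phase_count_bound(2)[OF \<epsilon>, of m] S' \<epsilon> by (intro divide_left_mono) auto
  also have "real M / (\<epsilon> / 2) + 1 \<le> 2 * real M / \<epsilon> + real M / \<epsilon>"
  proof -
    have "1 \<le> real M / \<epsilon>"
      using M1 \<epsilon> by (simp add: pos_le_divide_eq)
    then show ?thesis by simp
  qed
  also have "\<dots> = 3 * real M / \<epsilon>" by (simp add: add_divide_distrib[symmetric])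
  finally show "real (draws M m) \<le> 3 * real M / \<epsilon>" by simp
qed

text \<open>One constant for all bounds: the time needs 1028 times \<open>budget_const\<close> plus
  2616, the labels 36 times and the draws 54 times \<open>budget_const\<close>.\<close>

definition resource_const :: real where
  "resource_const = 2000 * budget_const"

text \<open>The exponent 9: 1 / rho^2, d^2 and the logarithmic factor are at most B^2 each, so M is
  O(B^6); the draws of a phase add 1 / epsilon, the cost of a draw adds d, and the number of phases
  is O(B).\<close>

lemma time_bound:
  assumes S: "search_results d \<eta> \<epsilon> r m n M" and d: "d \<ge> 1" and \<eta>: "0 \<le> \<eta>" "\<eta> < 1/2" and \<epsilon>: "0 < \<epsilon>" "\<epsilon> < 1"
  defines "B \<equiv> real d + 1 / \<epsilon> + 1 / (1 - 2 * \<eta>)"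
  shows "real (total_time d r m n M) \<le> resource_const * B ^ 9" "real (3 * d + 4) \<le> resource_const * B ^ 9"
proof -
  note b = search_bounds[OF S d \<eta> \<epsilon>]
  let ?\<Lambda> = "log1 (1 / \<epsilon>)" and ?l = "log1 (real d * log1 (1 / \<epsilon>))" and ?\<rho> = "1 - 2 * \<eta>" and ?c = budget_const
  have z: "1 \<le> 1 / \<epsilon>" using \<epsilon> by simp
  have \<rho>: "0 < 1 / ?\<rho>" using \<eta> by simp
  have B: "1 \<le> B" "real d \<le> B" "1 / \<epsilon> \<le> B" "1 / ?\<rho> \<le> B"
  proof -
    have "1 \<le> real d" using d by simp
    then show "1 \<le> B" "real d \<le> B" "1 / \<epsilon> \<le> B" "1 / ?\<rho> \<le> B"
      using z \<rho> unfolding B_def by linarith+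
  qed
  have c: "1000 \<le> ?c" by (simp add: budget_const_def)
  have pw: "B ^ i \<le> B ^ j" if "i \<le> j" for i j
    using that B by (intro power_increasing) auto
  have \<Lambda>: "?\<Lambda> \<le> B" "1 \<le> ?\<Lambda>"
    using log1_le_self[OF z] B log1_ge_1 by auto
  have "1 \<le> real d * ?\<Lambda>"
    using d \<Lambda> mult_mono[of 1 "real d" 1 ?\<Lambda>] by simp
  then have "?l \<le> real d * ?\<Lambda>" by (rule log1_le_self)
  also have "\<dots> \<le> B * B" using B \<Lambda> by (intro mult_mono) auto
  finally have l: "?l \<le> B ^ 2" "0 \<le> ?l" using log1_ge_1[of "real d * ?\<Lambda>"] by (simp_all add: power2_eq_square)
  have "real r \<le> (real r)\<^sup>2"
    by (cases r) (auto simp: power2_eq_square algebra_simps)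
  then have r: "real r \<le> 4 * B ^ 9" using b(2) B pw[of 1 9, simplified] by linarith
  have m: "real m \<le> 18 * B ^ 9" using b(7) \<Lambda> pw[of 1 9] by simp
  have n: "real n \<le> 14 * B ^ 9" using b(8) l pw[of 2 9] by simp
  have "1 / ?\<rho>\<^sup>2 \<le> B ^ 2"
    using power_mono[OF B(4), of 2] \<rho> by (simp add: power_divide)
  then have "1 / ?\<rho>\<^sup>2 * (real d)\<^sup>2 * ?l \<le> B ^ 2 * B ^ 2 * B ^ 2"
    using B l by (intro mult_mono power_mono) auto
  then have "?c * (1 / ?\<rho>\<^sup>2 * (real d)\<^sup>2 * ?l) \<le> ?c * B ^ 6"
    using c by (intro mult_left_mono) (auto simp: power_add[symmetric])
  then have M6: "real M \<le> ?c * B ^ 6"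
    using b(9) by linarith
  have M: "real M \<le> ?c * B ^ 9"
  proof -
    have "?c * B ^ 6 \<le> ?c * B ^ 9"
      using c by (intro mult_left_mono pw) auto
    with M6 show ?thesis by linarith
  qed
  have "real (draws M m) \<le> 3 * real M * (1 / \<epsilon>)" using b(10) by simp
  also have "\<dots> \<le> 3 * (?c * B ^ 6) * B"
    using M6 B c \<epsilon> by (intro mult_mono) auto
  finally have N: "real (draws M m) \<le> 3 * ?c * B ^ 7"
    by (simp add: eval_nat_numeral mult_ac)
  have "real (draws M m) * (7 * real d + 12) \<le> (3 * ?c * B ^ 7) * (19 * B)"
    using N B c by (intro mult_mono) auto
  also have "\<dots> = 57 * ?c * B ^ 8" by (simp add: eval_nat_numeral mult_ac)
  finally have "real (draws M m) * (7 * real d + 12) + 63 * real d + 76 \<le> 57 * ?c * B ^ 8 + 139 * B ^ 8"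
    using B pw[of 1 8] by simp
  then have "real (Suc m) * (real (draws M m) * (7 * real d + 12) + 63 * real d + 76) \<le> (18 * B) * (57 * ?c * B ^ 8 + 139 * B ^ 8)"
    using b(7) \<Lambda> B by (intro mult_mono) auto
  also have "\<dots> = (1026 * ?c + 2502) * B ^ 9"
    by (simp add: eval_nat_numeral algebra_simps)
  finally have P: "real (Suc m) * (real (draws M m) * (7 * real d + 12) + 63 * real d + 76) \<le> (1026 * ?c + 2502) * B ^ 9" .
  have one: "1 \<le> B ^ 9" using B by (simp add: one_le_power)
  have T: "real (total_time d r m n M) = 2 * real r + 3 * real m + 3 * real n + 2 * real M + 10 +
      real (Suc m) * (real (draws M m) * (7 * real d + 12) + 63 * real d + 76)"
    unfolding total_time_def by (simp add: algebra_simps)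
  have "real (total_time d r m n M) \<le> (8 + 54 + 42 + 2 * ?c + 10 + (1026 * ?c + 2502)) * B ^ 9"
    unfolding T using r m n M P one by (simp add: algebra_simps)
  also have "\<dots> \<le> resource_const * B ^ 9"
    using one B(1) by (intro mult_right_mono) (auto simp: resource_const_def budget_const_def)
  finally show "real (total_time d r m n M) \<le> resource_const * B ^ 9" .
  have "real (3 * d + 4) \<le> 7 * B ^ 9" using B pw[of 1 9] by simp
  also have "\<dots> \<le> resource_const * B ^ 9"
    using one B(1) by (intro mult_right_mono) (auto simp: resource_const_def budget_const_def)
  finally show "real (3 * d + 4) \<le> resource_const * B ^ 9" .
qed

lemma rcn_environment_simps:
  "dimension (rcn_environment d w \<omega>) = d" "point (rcn_environment d w \<omega>) = (\<lambda>l. fst (\<omega> l))"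
  "label (rcn_environment d w \<omega>) = (\<lambda>l. noisy_label d w (\<omega> l))"
  by (simp_all add: rcn_environment_def noisy_label_def fun_eq_iff)

lemma learner_run:
  assumes S: "search_results d \<eta> \<epsilon> r m n M" and d: "d \<ge> 1" and \<eta>: "0 \<le> \<eta>" "\<eta> < 1/2" and \<epsilon>: "0 < \<epsilon>" "\<epsilon> < 1"
  defines "B \<equiv> real d + 1 / \<epsilon> + 1 / (1 - 2 * \<eta>)"
  obtains s where "exec (rcn_environment d w \<omega>) learner_prog (initial_state d \<eta> \<epsilon>) s"
    "steps s \<le> total_time d r m n M" "requested s \<le> 2 * M * Suc m" "drawn s = offset M (Suc m)"
    "represents evaluator_prog d (resource_const * B ^ 9) s (halfspace d (arr s 1))"
    "\<And>i. i < d \<Longrightarrow> arr s 1 i = direction d r (1 - 2 * \<eta>) M (\<lambda>l. fst (\<omega> l)) (\<lambda>l. noisy_label d w (\<omega> l)) (Suc m) i"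
proof -
  obtain s where s: "exec (rcn_environment d w \<omega>) learner_prog (initial_state d \<eta> \<epsilon>) s"
    "steps s \<le> steps (initial_state d \<eta> \<epsilon>) + total_time d r m n M"
    "phase_inv (rcn_environment d w \<omega>) d r (Suc m) M \<eta> (Suc m) s"
    using wp_learner[OF rcn_environment_simps(1) search_bounds(3)[OF S d \<eta> \<epsilon>] S] unfolding wp_def by blast
  have inv: "requested s \<le> 2 * M * Suc m" "drawn s = offset M (Suc m)" "reg s 0 = d"
    "\<And>i. i < d \<Longrightarrow> arr s 1 i = direction d r (1 - 2 * \<eta>) M (\<lambda>l. fst (\<omega> l)) (\<lambda>l. noisy_label d w (\<omega> l)) (Suc m) i"
    using s(3) unfolding phase_inv_def core_def rcn_environment_simps by auto
  show ?thesis
  proof (rule that[OF s(1) _ inv(1,2) _ inv(4)])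
    show "steps s \<le> total_time d r m n M"
      using s(2) by (simp add: initial_state_def)
    show "represents evaluator_prog d (resource_const * B ^ 9) s (halfspace d (arr s 1))"
      using inv(3) time_bound(2)[OF S d \<eta> \<epsilon>] unfolding B_def by (rule evaluator_represents)
  qed
qed

text \<open>The searches fix the numbers of phases and draws before any example is seen, and the cap
  bounds the requests, so the argument involves no probability.\<close>

lemma learner_runs_within:
  assumes d: "d \<ge> 1" and \<eta>: "0 \<le> \<eta>" "\<eta> < 1/2" and \<epsilon>: "0 < \<epsilon>" "\<epsilon> < 1"
  shows "runs_within learner_prog evaluator_prog d \<eta> \<epsilon> w
    (resource_const * (real d + 1/\<epsilon> + 1/(1 - 2*\<eta>)) ^ 9)
    (resource_const * ((1 / (1 - 2*\<eta>)\<^sup>2) * (real d)\<^sup>2 * log1 (1/\<epsilon>) * log1 (real d * log1 (1/\<epsilon>))))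
    (resource_const * ((1 / (1 - 2*\<eta>)\<^sup>2) * (real d)\<^sup>2 * (1/\<epsilon>) * log1 (1/\<epsilon>) * log1 (real d * log1 (1/\<epsilon>))))"
  unfolding runs_within_def
proof (intro allI impI)
  fix \<omega> :: outcome
  obtain r m n M where S: "search_results d \<eta> \<epsilon> r m n M"
    using ex_search_results[OF \<epsilon>(1)] by blast
  obtain s where s: "exec (rcn_environment d w \<omega>) learner_prog (initial_state d \<eta> \<epsilon>) s"
    "steps s \<le> total_time d r m n M" "requested s \<le> 2 * M * Suc m" "drawn s = offset M (Suc m)"
    "represents evaluator_prog d (resource_const * (real d + 1 / \<epsilon> + 1 / (1 - 2 * \<eta>)) ^ 9) s (halfspace d (arr s 1))"
    using learner_run[OF S d \<eta> \<epsilon>, of w \<omega>] by metis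
  note b = search_bounds[OF S d \<eta> \<epsilon>]
  let ?\<Lambda> = "log1 (1 / \<epsilon>)" and ?l = "log1 (real d * log1 (1 / \<epsilon>))" and ?c = budget_const
  let ?D = "1 / (1 - 2 * \<eta>)\<^sup>2 * (real d)\<^sup>2"
  have D: "0 \<le> ?D" by simp
  have \<Lambda>: "0 \<le> ?\<Lambda>" and l: "0 \<le> ?l"
    using log1_ge_1[of "1 / \<epsilon>"] log1_ge_1[of "real d * log1 (1 / \<epsilon>)"] by auto
  have c: "0 \<le> ?c" by (simp add: budget_const_def)
  have KM: "real (Suc m) * real M \<le> (18 * ?\<Lambda>) * (?c * (?D * ?l))"
    using b(7,9) \<Lambda> by (intro mult_mono) auto
  have "real (requested s) \<le> 2 * (real (Suc m) * real M)"
    using s(3) of_nat_mono[OF s(3), where 'a=real] by (simp add: algebra_simps)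
  also have "\<dots> \<le> 2 * ((18 * ?\<Lambda>) * (?c * (?D * ?l)))"
    using KM by simp
  also have "\<dots> = (36 * ?c) * (?D * ?\<Lambda> * ?l)"
    by (simp add: mult_ac)
  also have "\<dots> \<le> resource_const * (?D * ?\<Lambda> * ?l)"
    using c D \<Lambda> l by (intro mult_right_mono) (auto simp: resource_const_def)
  finally have req: "real (requested s) \<le> resource_const * (?D * ?\<Lambda> * ?l)" .
  have "real (drawn s) \<le> real (Suc m) * real (draws M m)"
    using s(4) offset_le[of M m] by (metis of_nat_le_iff of_nat_mult)
  also have "\<dots> \<le> real (Suc m) * (3 * real M / \<epsilon>)"
    using b(10) by (intro mult_left_mono) auto
  also have "\<dots> = 3 * (1 / \<epsilon>) * (real (Suc m) * real M)"
    by simp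
  also have "\<dots> \<le> 3 * (1 / \<epsilon>) * ((18 * ?\<Lambda>) * (?c * (?D * ?l)))"
    using KM \<epsilon> by (intro mult_left_mono) auto
  also have "\<dots> = (54 * ?c) * (?D * (1 / \<epsilon>) * ?\<Lambda> * ?l)"
    by (simp add: mult_ac)
  also have "\<dots> \<le> resource_const * (?D * (1 / \<epsilon>) * ?\<Lambda> * ?l)"
    using c D \<Lambda> l \<epsilon> by (intro mult_right_mono) (auto simp: resource_const_def)
  finally have dr: "real (drawn s) \<le> resource_const * (?D * (1 / \<epsilon>) * ?\<Lambda> * ?l)" .
  have "real (steps s) \<le> real (total_time d r m n M)"
    using s(2) by simp
  also have "\<dots> \<le> resource_const * (real d + 1 / \<epsilon> + 1 / (1 - 2 * \<eta>)) ^ 9"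
    by (rule time_bound(1)[OF S d \<eta> \<epsilon>])
  finally have st: "real (steps s) \<le> resource_const * (real d + 1 / \<epsilon> + 1 / (1 - 2 * \<eta>)) ^ 9" .
  show "\<exists>s h. exec (rcn_environment d w \<omega>) learner_prog (initial_state d \<eta> \<epsilon>) s \<and>
      real (steps s) \<le> resource_const * (real d + 1/\<epsilon> + 1/(1 - 2*\<eta>)) ^ 9 \<and>
      real (requested s) \<le> resource_const * (?D * ?\<Lambda> * ?l) \<and>
      real (drawn s) \<le> resource_const * (?D * (1 / \<epsilon>) * ?\<Lambda> * ?l) \<and>
      represents evaluator_prog d (resource_const * (real d + 1/\<epsilon> + 1/(1 - 2*\<eta>)) ^ 9) s h"
    using s(1,5) req dr st by blast
qed

lemma good_cong:
  assumes "\<And>i. i < d \<Longrightarrow> v i = v' i"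
  shows "good d w \<sigma> v = good d w \<sigma> v'"
  using newton_pow_good_cong[of d v v' w \<sigma> 0] assms by simp

lemma learner_learns:
  assumes d: "d \<ge> 1" and \<eta>: "0 \<le> \<eta>" "\<eta> < 1/2" and \<epsilon>: "0 < \<epsilon>" "\<epsilon> < 1" and w: "w \<in> unit_sphere d"
  shows "learns_with_probability learner_prog evaluator_prog d \<eta> \<epsilon> w
    (resource_const * (real d + 1/\<epsilon> + 1/(1 - 2*\<eta>)) ^ 9) (2/3)"
proof -
  obtain r m n M where S: "search_results d \<eta> \<epsilon> r m n M"
    using ex_search_results[OF \<epsilon>(1)] by blast
  note b = search_bounds[OF S d \<eta> \<epsilon>]
  have w1: "ip d w w = 1"
    using w by (simp add: unit_sphere_def ip_self_conv)
  let ?dir = "\<lambda>\<omega>. direction d r (1 - 2 * \<eta>) M (\<lambda>l. fst (\<omega> l)) (\<lambda>l. noisy_label d w (\<omega> l)) (Suc m)"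
  let ?A = "{\<omega> \<in> space (rcn_space d \<eta>). good d w (sine_bound (Suc m)) (?dir \<omega>)}"
  have A: "?A \<in> sets (rcn_space d \<eta>)" "2/3 \<le> measure (rcn_space d \<eta>) ?A"
    using direction_success[OF d b(1,2) w1 \<eta> refl b(3,4) _ _ b(5)] by simp_all
  show ?thesis
    unfolding learns_with_probability_def
  proof (intro bexI[OF _ A(1)] conjI A(2) ballI)
    fix \<omega> assume \<omega>: "\<omega> \<in> ?A"
    obtain s where s: "exec (rcn_environment d w \<omega>) learner_prog (initial_state d \<eta> \<epsilon>) s"
      "represents evaluator_prog d (resource_const * (real d + 1 / \<epsilon> + 1 / (1 - 2 * \<eta>)) ^ 9) s (halfspace d (arr s 1))"
      "\<And>i. i < d \<Longrightarrow> arr s 1 i = ?dir \<omega> i"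
      using learner_run[OF S d \<eta> \<epsilon>, of w \<omega>] by metis
    have "good d w (sine_bound (Suc m)) (arr s 1)"
      using \<omega> good_cong[of d "arr s 1" "?dir \<omega>" w, OF s(3)] by simp
    note err = good_error[OF d w1 sine_bound_pos sine_bound_le this]
    \<comment> \<open>The learner runs \<open>Suc m\<close> phases, so the last shrinking takes the
      bound from at most epsilon to below it.\<close>
    have "sine_bound (Suc m) \<le> \<epsilon>"
      using b(6) sine_bound_pos[of m] unfolding sine_bound_Suc by linarith
    then have "has_error_at_most d w \<epsilon> (halfspace d (arr s 1))"
      using err unfolding has_error_at_most_def by linarith
    then show "\<exists>s h. exec (rcn_environment d w \<omega>) learner_prog (initial_state d \<eta> \<epsilon>) s \<and>
        represents evaluator_prog d (resource_const * (real d + 1/\<epsilon> + 1/(1 - 2*\<eta>)) ^ 9) s h \<and> has_error_at_most d w \<epsilon> h"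
      using s(1,2) by blast
  qed
qed

theorem corollary4p10:
  shows "\<exists>(learner :: com) (evaluator :: com) (C :: real) (k :: nat).
    \<forall>(d :: nat) (\<eta> :: real) (\<epsilon> :: real) (w :: vec).
      d \<ge> 1 \<and> 0 \<le> \<eta> \<and> \<eta> < 1/2 \<and> 0 < \<epsilon> \<and> \<epsilon> < 1 \<and> w \<in> unit_sphere d \<longrightarrow>
        runs_within learner evaluator d \<eta> \<epsilon> w
          (C * (real d + 1/\<epsilon> + 1/(1 - 2*\<eta>)) ^ k)
          (C * ((1 / (1 - 2*\<eta>)\<^sup>2) * (real d)\<^sup>2 * log1 (1/\<epsilon>) * log1 (real d * log1 (1/\<epsilon>))))
          (C * ((1 / (1 - 2*\<eta>)\<^sup>2) * (real d)\<^sup>2 * (1/\<epsilon>) * log1 (1/\<epsilon>) * log1 (real d * log1 (1/\<epsilon>)))) \<and>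
        learns_with_probability learner evaluator d \<eta> \<epsilon> w
          (C * (real d + 1/\<epsilon> + 1/(1 - 2*\<eta>)) ^ k) (2/3)"
  using learner_runs_within learner_learns by blast

end
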